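(* Let $(X,\mathcal{X},\mu)$ and $(Y,\mathcal{Y},\nu)$ be two stable probability spaces. Let $f:X\times Y\to L^0$ be a stable integrable function with respect to $(X\times Y,\mathcal{X}\otimes\mathcal{Y},\mu\otimes\nu)$. Then the functions $$x\mapsto\int_Yf_x\,d\nu\quad\text{and}\quad y\mapsto\int_Xf_y\,d\mu$$ are stable integrable functions, and one has $$\int_{X\times Y}f\,d\mu\otimes\nu=\int_X\left(\int_Yf_x\,d\nu\right)d\mu=\int_Y\left(\int_Xf_y\,d\mu\right)d\nu.$$
   Context: $(\Omega,\mathscr{F},\mathbb{P})$ is a complete probability space; $A,B\in\mathscr{F}$ are identified if $\mathbb{P}(A\Delta B)=0$, and inclusions and (in)equalities between (extended) random variables are understood a.s. $L^0$, $L^0_+$, $\bar L^0_+$ are the sets of measurable functions on $\Omega$ with values in $\mathbb{R}$, $[0,\infty)$, $[0,\infty]$; $L^0_{++}=\{x\in L^0:x>0\}$. The supremum of a family in $\mathscr{F}$ is its essential supremum. A partition (of $\Omega$) is a countable pairwise disjoint family $(A_k)$ in $\mathscr{F}$ with union $\Omega$. For a function $x$ on $\Omega$ and $A\in\mathscr{F}$, $x|A$ is the restriction to $A$; $x|A$ and $y|B$ are identified if $\mathbb{P}(A\Delta B)=0$ and $x=y$ a.e. on $A\cap B$. $\sum x_k|A_k$ is the function equal to $x_k$ on $A_k$ for each $k$ (so $r|A+0|A^c$ equals $r$ on $A$ and $0$ on $A^c$). For a set $X$ of functions on $\Omega$, $X|A:=\{x|A: x\in X\}$, $(X|A)|B:=X|A\cap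 B$, $X|\emptyset=\{\ast\}$, $X|\Omega=X$. A set $X$ of functions on $\Omega$ with values in a fixed set is stable if $X\neq\emptyset$ and $\sum x_k|A_k\in X$ for all partitions $(A_k)$ and sequences $(x_k)$ in $X$. $\mathcal{P}(X)$ is the collection of all conditional subsets $V|A$, $V\subseteq X$ stable, $A\in\mathscr{F}$. For stable $V_k\subseteq X$, $\sum V_k|A_k:=\{\sum x_k|A_k: x_k\in V_k\ \forall k\}$, and $\sum (V_k|B_k)|A_k:=(\sum V_k|A_k)|\bigcup_k(A_k\cap B_k)$. A subset of $\mathcal{P}(X)$ is a stable collection if nonempty and closed under such countable concatenations. $V|A\sqsubseteq W|B$ iff $A\subseteq B$ and $V|A\subseteq W|A$. $(\mathcal{P}(X),\sqsubseteq)$ is a complete Boolean algebra with greatest element $X$ and least element $\{\ast\}$; $\sqcup,\sqcap,{}^\sqsubset$ are its supremum, infimum, complement; disjoint means $V|A\sqcap W|B=\{\ast\}$. A stable collection $\mathcal{X}$ is a stable $\sigma$-algebra if $X\in\mathcal{X}$ and it is closed under ${}^\sqsubset$ and countable $\sqcup$. A stable measure on a stable $\sigma$-algebra $\mathcal{X}$ is a function $\mu:\mathcal{X}\to\bar L^0_+$ with $\mu(\sum(V_k|B_k)|A_k)=\sum\mu(V_k|B_k)|A_k$ (stability), (M1) $\mu(V|A)=\mu(V|A)|A+0|A^c$, and (M2) $\mu(\sqcup_k(V_k|A_k))=\sum_{k}\mu(V_k|A_k)$ for sequences of pairwise disjoint elements of $\mathcal{X}$; if $\mu(X)=1$, $\mu$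 is a stable probability measure and $(X,\mathcal{X},\mu)$ a stable probability space. A function $f:X\to Y$ between stable sets is stable if $f(\sum x_k|A_k)=\sum f(x_k)|A_k$. For $W|A\in\mathcal{P}(Y)$, with $C_\ast:=\sup\{A'\subseteq A:\exists x\in X,\ f(x)|A'\in W|A'\}$ (attained), $f^{-1}(W|A):=\{x\in X:f(x)|C_\ast\in W|C_\ast\}|C_\ast$. A stable function is stably measurable if preimages of elements of the stable $\sigma$-algebra on $Y$ belong to that on $X$; $L^0$ carries the stable Borel $\sigma$-algebra $\mathcal{B}(L^0)$ generated by the balls $\{y\in L^0:|x-y|<r\}$, $x\in L^0$, $r\in L^0_{++}$. The stable indicator function is $1_{V|A}(x):=1|A_x+0|A_x^c$, with $A_x:=\sup\{A'\subseteq A: x|A'\in V|A'\}$. A stable elementary function is $\sum_{k\le n}r_k1_{V_k|A_k}$ with $r_k\in L^0_+$ and pairwise disjoint $V_k|A_k\in\mathcal{X}$ with $\sqcup_kV_k|A_k=X$; its integral is $\sum_{k\le n}r_k\mu(V_k|A_k)\in\bar L^0_+$ ($0\cdot\infty=0$). For stably measurable $f:X\to L^0_+$, $\int_Xf\,d\mu:=\sup_n\int_Xf_n\,d\mu$ for any increasing sequence $(f_n)$ of stable elementary functions with $\sup_nf_n=f$ pointwise (exists; independent of the choice). A stably measurable $f:X\to L^0$ is (stable) integrable if $\int_X f^\pm d\mu\in L^0$, and then $\int_Xf\,d\mu:=\int_Xf^+d\mu-\int_Xf^-d\mu$. $X\times Y$ is regarded as the stable set of functions $\omega\mapsto(x(\omega),y(\omega))$.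 Conditional rectangles: $V|A\times W|B:=(V\times W)|A\cap B$. $\mathcal{X}\otimes\mathcal{Y}$ is the smallest stable $\sigma$-algebra on $X\times Y$ containing all $V|A\times W|B$, $V|A\in\mathcal{X}$, $W|B\in\mathcal{Y}$; $\mu\otimes\nu$ is the unique stable probability measure on $\mathcal{X}\otimes\mathcal{Y}$ with $\mu\otimes\nu(V|A\times W|B)=\mu(V|A)\nu(W|B)$ for all such rectangles. Sections: $f_x(y)=f_y(x)=f(x,y)$.
   Formalization: Sections f_x, f_y need not be integrable for every x, y; it is proved that they are for x, y in a stable subset of full measure, and the inner integral is set to 0 on the part of Ω where the integral of the positive or negative part of the section is infinite. *)

theory Defs
  imports "HOL-Probability.Probability_Measure"
begin

text \<open>
  Throughout, \<open>M\<close> is the underlying complete probability space. Objects that the theory identifies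
  almost surely are represented by arbitrary representatives, and sets of such objects by sets that
  are saturated, i.e. closed under almost sure equality of their elements. In particular, equality
  of (conditional) sets is plain HOL equality, whereas equality of random variables is stated with
  \<open>AE w in M\<close>.

  A restriction \<open>x|A\<close> is the partial function with domain \<open>A\<close>; the identification of \<open>x|A\<close> with
  \<open>y|B\<close> (if \<open>A\<close>, \<open>B\<close> differ by a null set and \<open>x = y\<close> a.e. on \<open>A \<inter> B\<close>) is then almost sure
  equality of partial functions. A conditional set \<open>V|A\<close> is a saturated set of partial functions.
\<close>

definition partition_of :: "'w measure \<Rightarrow> (nat \<Rightarrow> 'w set) \<Rightarrow> bool" where
  "partition_of M A \<longleftrightarrow>
     range A \<subseteq> sets M \<and> disjoint_family A \<and> (\<Union>k. A k) = space M"

text \<open>\<open>is_concat M A x y\<close>: \<open>y\<close> is (a representative of) the concatenation of the \<open>x k|A k\<close>.\<close>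

definition is_concat ::
  "'w measure \<Rightarrow> (nat \<Rightarrow> 'w set) \<Rightarrow> (nat \<Rightarrow> 'w \<Rightarrow> 'e) \<Rightarrow> ('w \<Rightarrow> 'e) \<Rightarrow> bool" where
  "is_concat M A x y \<longleftrightarrow> (AE w in M. \<forall>k. w \<in> A k \<longrightarrow> y w = x k w)"

text \<open>The partition consisting of the whole space only (padded by empty sets) shows that a stable
  set is saturated.\<close>

definition stable :: "'w measure \<Rightarrow> ('w \<Rightarrow> 'e) set \<Rightarrow> bool" where
  "stable M X \<longleftrightarrow> X \<noteq> {} \<and>
     (\<forall>A x y. partition_of M A \<longrightarrow> range x \<subseteq> X \<longrightarrow> is_concat M A x y \<longrightarrow> y \<in> X)"

text \<open>The essential supremum of a family of measurable sets; \<open>SOME\<close> chooses a representative.\<close>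

definition ess_Sup :: "'w measure \<Rightarrow> 'w set set \<Rightarrow> 'w set" where
  "ess_Sup M \<A> = (SOME A. A \<in> sets M \<and> (\<forall>B\<in>\<A>. AE w in M. w \<in> B \<longrightarrow> w \<in> A) \<and>
     (\<forall>C\<in>sets M. (\<forall>B\<in>\<A>. AE w in M. w \<in> B \<longrightarrow> w \<in> C) \<longrightarrow> (AE w in M. w \<in> A \<longrightarrow> w \<in> C)))"

subsection \<open>Conditional sets\<close>

definition restr :: "('w \<Rightarrow> 'e) \<Rightarrow> 'w set \<Rightarrow> 'w \<Rightarrow> 'e option" where
  "restr x A = (\<lambda>w. if w \<in> A then Some (x w) else None)"

definition cond_set :: "'w measure \<Rightarrow> ('w \<Rightarrow> 'e) set \<Rightarrow> 'w set \<Rightarrow> ('w \<Rightarrow> 'e option) set" where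
  "cond_set M V A = {p. \<exists>x\<in>V. AE w in M. p w = restr x A w}"

text \<open>\<open>(V|A)|B = V|(A \<inter> B)\<close>\<close>

definition cond_restr ::
  "'w measure \<Rightarrow> ('w \<Rightarrow> 'e option) set \<Rightarrow> 'w set \<Rightarrow> ('w \<Rightarrow> 'e option) set" where
  "cond_restr M S B = {p. \<exists>q\<in>S. AE w in M. p w = (q |` B) w}"

text \<open>The set \<open>A\<close> in \<open>V|A\<close>, which is determined by \<open>V|A\<close> up to a null set.\<close>

definition cond_dom :: "'w measure \<Rightarrow> ('w \<Rightarrow> 'e option) set \<Rightarrow> 'w set" where
  "cond_dom M S = (SOME A. A \<in> sets M \<and> (\<forall>p\<in>S. AE w in M. w \<in> A \<longleftrightarrow> p w \<noteq> None))"

definition cond_Pow :: "'w measure \<Rightarrow> ('w \<Rightarrow> 'e) set \<Rightarrow> ('w \<Rightarrow> 'e option) set set" where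
  "cond_Pow M X = {cond_set M V A | V A. V \<subseteq> X \<and> stable M V \<and> A \<in> sets M}"

text \<open>The least element \<open>{*} = V|{}\<close>.\<close>

definition cond_bot :: "'w measure \<Rightarrow> ('w \<Rightarrow> 'e option) set" where
  "cond_bot M = {p. AE w in M. p w = None}"

definition cond_top :: "'w measure \<Rightarrow> ('w \<Rightarrow> 'e) set \<Rightarrow> ('w \<Rightarrow> 'e option) set" where
  "cond_top M X = cond_set M X (space M)"

text \<open>An element of the concatenation of the \<open>(V k|B k)|A k\<close> is, on \<open>A k\<close>, an element of
  \<open>V k|B k\<close>; hence it is undefined precisely off the union of the \<open>A k \<inter> B k\<close>.\<close>

definition cond_concat ::
  "'w measure \<Rightarrow> (nat \<Rightarrow> 'w set) \<Rightarrow> (nat \<Rightarrow> ('w \<Rightarrow> 'e option) set) \<Rightarrow> ('w \<Rightarrow> 'e option) set" where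
  "cond_concat M A S = {p. \<exists>q. (\<forall>k. q k \<in> S k) \<and> is_concat M A q p}"

lemma cond_restr_cond_set:
  "cond_restr M (cond_set M V A) B = cond_set M V (A \<inter> B)"
proof (intro set_eqI iffI)
  fix p assume "p \<in> cond_restr M (cond_set M V A) B"
  then obtain q x where "x \<in> V" and
    *: "AE w in M. p w = (q |` B) w" "AE w in M. q w = restr x A w"
    unfolding cond_restr_def cond_set_def by blast
  have "AE w in M. p w = restr x (A \<inter> B) w"
    using *(1) *(2) by eventually_elim (auto simp: restr_def restrict_map_def)
  with \<open>x \<in> V\<close> show "p \<in> cond_set M V (A \<inter> B)"
    unfolding cond_set_def by blast
next
  fix p assume "p \<in> cond_set M V (A \<inter> B)"
  then obtain x where x: "x \<in> V" and *: "AE w in M. p w = restr x (A \<inter> B) w"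
    unfolding cond_set_def by blast
  have "AE w in M. p w = (restr x A |` B) w"
    using * by eventually_elim (auto simp: restr_def restrict_map_def)
  moreover have "restr x A \<in> cond_set M V A"
    using x unfolding cond_set_def by auto
  ultimately show "p \<in> cond_restr M (cond_set M V A) B"
    unfolding cond_restr_def by blast
qed

lemma cond_dom_cond_set:
  assumes "V \<noteq> {}" "A \<in> sets M"
  shows "AE w in M. w \<in> cond_dom M (cond_set M V A) \<longleftrightarrow> w \<in> A"
proof -
  obtain x where x: "x \<in> V" using assms by blast
  let ?P = "\<lambda>D. D \<in> sets M \<and> (\<forall>p\<in>cond_set M V A. AE w in M. w \<in> D \<longleftrightarrow> p w \<noteq> None)"
  have "AE w in M. w \<in> A \<longleftrightarrow> p w \<noteq> None" if "p \<in> cond_set M V A" for p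
  proof -
    obtain y where "AE w in M. p w = restr y A w"
      using \<open>p \<in> cond_set M V A\<close> unfolding cond_set_def by blast
    then show ?thesis by eventually_elim (simp add: restr_def)
  qed
  with assms(2) have "?P A" by blast
  then have "?P (cond_dom M (cond_set M V A))"
    unfolding cond_dom_def by (rule someI)
  moreover have "restr x A \<in> cond_set M V A"
    using x unfolding cond_set_def by auto
  ultimately have "AE w in M. w \<in> cond_dom M (cond_set M V A) \<longleftrightarrow> restr x A w \<noteq> None"
    by blast
  then show ?thesis
    by eventually_elim (auto simp: restr_def split: if_splits)
qed

lemma cond_concat_cond_set:
  assumes A: "partition_of M A"
  shows "cond_concat M A (\<lambda>k. cond_set M (V k) (B k)) =
    cond_set M {y. \<exists>x. (\<forall>k. x k \<in> V k) \<and> is_concat M A x y} (\<Union>k. A k \<inter> B k)"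
proof (intro set_eqI iffI)
  fix p assume "p \<in> cond_concat M A (\<lambda>k. cond_set M (V k) (B k))"
  then obtain q where q: "\<forall>k. q k \<in> cond_set M (V k) (B k)" and p: "is_concat M A q p"
    unfolding cond_concat_def by blast
  from q obtain x where x: "\<forall>k. x k \<in> V k" and "\<forall>k. AE w in M. q k w = restr (x k) (B k) w"
    unfolding cond_set_def by simp metis
  then have qx: "AE w in M. \<forall>k. q k w = restr (x k) (B k) w"
    by (simp add: AE_all_countable)
  have disj: "i = j" if "w \<in> A i" "w \<in> A j" for i j w
    using A that unfolding partition_of_def disjoint_family_on_def by blast
  define y where "y = (\<lambda>w. x (THE k. w \<in> A k) w)"
  have y: "y w = x k w" if "w \<in> A k" for k w
    using the_equality[of "\<lambda>k. w \<in> A k", OF that] disj that unfolding y_def by blast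
  have "AE w in M. p w = restr y (\<Union>k. A k \<inter> B k) w"
    using p[unfolded is_concat_def] qx AE_space
  proof eventually_elim
    case (elim w)
    then obtain k where k: "w \<in> A k" using A unfolding partition_of_def by blast
    then have "(w \<in> (\<Union>k. A k \<inter> B k)) = (w \<in> B k)" using disj by blast
    then show ?case using elim k y[OF k] by (auto simp: restr_def)
  qed
  moreover have "is_concat M A x y" using y unfolding is_concat_def by simp
  ultimately show "p \<in> cond_set M {y. \<exists>x. (\<forall>k. x k \<in> V k) \<and> is_concat M A x y} (\<Union>k. A k \<inter> B k)"
    using x unfolding cond_set_def by blast
next
  fix p assume "p \<in> cond_set M {y. \<exists>x. (\<forall>k. x k \<in> V k) \<and> is_concat M A x y} (\<Union>k. A k \<inter> B k)"
  then obtain x y where x: "\<forall>k. x k \<in> V k" and y: "is_concat M A x y"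
    and p: "AE w in M. p w = restr y (\<Union>k. A k \<inter> B k) w"
    unfolding cond_set_def by blast
  have disj: "i = j" if "w \<in> A i" "w \<in> A j" for i j w
    using A that unfolding partition_of_def disjoint_family_on_def by blast
  have "is_concat M A (\<lambda>k. restr (x k) (B k)) p"
    unfolding is_concat_def using p y[unfolded is_concat_def]
  proof eventually_elim
    case (elim w)
    show ?case
    proof (intro allI impI)
      fix k assume k: "w \<in> A k"
      then have "(w \<in> (\<Union>k. A k \<inter> B k)) = (w \<in> B k)" using disj by blast
      then show "p w = restr (x k) (B k) w" using elim k by (auto simp: restr_def)
    qed
  qed
  moreover have "\<forall>k. restr (x k) (B k) \<in> cond_set M (V k) (B k)"
    using x unfolding cond_set_def by auto
  ultimately show "p \<in> cond_concat M A (\<lambda>k. cond_set M (V k) (B k))"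
    unfolding cond_concat_def by (intro CollectI exI[of _ "\<lambda>k. restr (x k) (B k)"]) blast
qed

definition cond_le ::
  "'w measure \<Rightarrow> ('w \<Rightarrow> 'e option) set \<Rightarrow> ('w \<Rightarrow> 'e option) set \<Rightarrow> bool" where
  "cond_le M S T \<longleftrightarrow>
     (AE w in M. w \<in> cond_dom M S \<longrightarrow> w \<in> cond_dom M T) \<and> S \<subseteq> cond_restr M T (cond_dom M S)"

definition cond_Sup ::
  "'w measure \<Rightarrow> ('w \<Rightarrow> 'e) set \<Rightarrow> ('w \<Rightarrow> 'e option) set set \<Rightarrow> ('w \<Rightarrow> 'e option) set" where
  "cond_Sup M X \<S> = (THE T. T \<in> cond_Pow M X \<and> (\<forall>S\<in>\<S>. cond_le M S T) \<and>
     (\<forall>U\<in>cond_Pow M X. (\<forall>S\<in>\<S>. cond_le M S U) \<longrightarrow> cond_le M T U))"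

definition cond_Inf ::
  "'w measure \<Rightarrow> ('w \<Rightarrow> 'e) set \<Rightarrow> ('w \<Rightarrow> 'e option) set set \<Rightarrow> ('w \<Rightarrow> 'e option) set" where
  "cond_Inf M X \<S> = (THE T. T \<in> cond_Pow M X \<and> (\<forall>S\<in>\<S>. cond_le M T S) \<and>
     (\<forall>U\<in>cond_Pow M X. (\<forall>S\<in>\<S>. cond_le M U S) \<longrightarrow> cond_le M U T))"

definition cond_compl ::
  "'w measure \<Rightarrow> ('w \<Rightarrow> 'e) set \<Rightarrow> ('w \<Rightarrow> 'e option) set \<Rightarrow> ('w \<Rightarrow> 'e option) set" where
  "cond_compl M X S = (THE T. T \<in> cond_Pow M X \<and>
     cond_Inf M X {S, T} = cond_bot M \<and> cond_Sup M X {S, T} = cond_top M X)"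

definition cond_disjoint ::
  "'w measure \<Rightarrow> ('w \<Rightarrow> 'e) set \<Rightarrow> ('w \<Rightarrow> 'e option) set \<Rightarrow> ('w \<Rightarrow> 'e option) set \<Rightarrow> bool" where
  "cond_disjoint M X S T \<longleftrightarrow> cond_Inf M X {S, T} = cond_bot M"

subsection \<open>Stable measurable spaces and stable measures\<close>

definition stable_collection ::
  "'w measure \<Rightarrow> ('w \<Rightarrow> 'e) set \<Rightarrow> ('w \<Rightarrow> 'e option) set set \<Rightarrow> bool" where
  "stable_collection M X \<X> \<longleftrightarrow> \<X> \<noteq> {} \<and> \<X> \<subseteq> cond_Pow M X \<and>
     (\<forall>A S. partition_of M A \<longrightarrow> range S \<subseteq> \<X> \<longrightarrow> cond_concat M A S \<in> \<X>)"

definition stable_sigma_algebra ::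
  "'w measure \<Rightarrow> ('w \<Rightarrow> 'e) set \<Rightarrow> ('w \<Rightarrow> 'e option) set set \<Rightarrow> bool" where
  "stable_sigma_algebra M X \<X> \<longleftrightarrow> stable_collection M X \<X> \<and> cond_top M X \<in> \<X> \<and>
     (\<forall>S\<in>\<X>. cond_compl M X S \<in> \<X>) \<and>
     (\<forall>S :: nat \<Rightarrow> _. range S \<subseteq> \<X> \<longrightarrow> cond_Sup M X (range S) \<in> \<X>)"

definition stable_sigma_gen ::
  "'w measure \<Rightarrow> ('w \<Rightarrow> 'e) set \<Rightarrow> ('w \<Rightarrow> 'e option) set set \<Rightarrow> ('w \<Rightarrow> 'e option) set set" where
  "stable_sigma_gen M X \<G> = \<Inter>{\<X>. stable_sigma_algebra M X \<X> \<and> \<G> \<subseteq> \<X>}"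

definition stable_measure ::
  "'w measure \<Rightarrow> ('w \<Rightarrow> 'e) set \<Rightarrow> ('w \<Rightarrow> 'e option) set set \<Rightarrow>
   (('w \<Rightarrow> 'e option) set \<Rightarrow> 'w \<Rightarrow> ennreal) \<Rightarrow> bool" where
  "stable_measure M X \<X> \<mu> \<longleftrightarrow>
     (\<forall>S\<in>\<X>. \<mu> S \<in> borel_measurable M) \<and>
     (\<forall>A S. partition_of M A \<longrightarrow> range S \<subseteq> \<X> \<longrightarrow>
        is_concat M A (\<lambda>k. \<mu> (S k)) (\<mu> (cond_concat M A S))) \<and>
     (\<forall>S\<in>\<X>. AE w in M. w \<notin> cond_dom M S \<longrightarrow> \<mu> S w = 0) \<and>
     (\<forall>S. range S \<subseteq> \<X> \<longrightarrow> (\<forall>i j. i \<noteq> j \<longrightarrow> cond_disjoint M X (S i) (S j)) \<longrightarrow>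
        (AE w in M. \<mu> (cond_Sup M X (range S)) w = (\<Sum>k. \<mu> (S k) w)))"

definition stable_prob_space ::
  "'w measure \<Rightarrow> ('w \<Rightarrow> 'e) set \<Rightarrow> ('w \<Rightarrow> 'e option) set set \<Rightarrow>
   (('w \<Rightarrow> 'e option) set \<Rightarrow> 'w \<Rightarrow> ennreal) \<Rightarrow> bool" where
  "stable_prob_space M X \<X> \<mu> \<longleftrightarrow> stable M X \<and> stable_sigma_algebra M X \<X> \<and>
     stable_measure M X \<X> \<mu> \<and> (AE w in M. \<mu> (cond_top M X) w = 1)"

subsection \<open>Stable functions and measurability\<close>

text \<open>As for \<open>stable\<close>, the trivial partition shows that a stable function respects almost sure
  equality.\<close>

definition stable_fun ::
  "'w measure \<Rightarrow> ('w \<Rightarrow> 'a) set \<Rightarrow> ('w \<Rightarrow> 'b) set \<Rightarrow> (('w \<Rightarrow> 'a) \<Rightarrow> 'w \<Rightarrow> 'b) \<Rightarrow> bool" where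
  "stable_fun M X Y f \<longleftrightarrow> f ` X \<subseteq> Y \<and>
     (\<forall>A x y. partition_of M A \<longrightarrow> range x \<subseteq> X \<longrightarrow> is_concat M A x y \<longrightarrow>
        is_concat M A (\<lambda>k. f (x k)) (f y))"

definition cond_vimage ::
  "'w measure \<Rightarrow> ('w \<Rightarrow> 'a) set \<Rightarrow> (('w \<Rightarrow> 'a) \<Rightarrow> 'w \<Rightarrow> 'b) \<Rightarrow>
   ('w \<Rightarrow> 'b option) set \<Rightarrow> ('w \<Rightarrow> 'a option) set" where
  "cond_vimage M X f T =
     (let C = ess_Sup M {A \<in> sets M. A \<subseteq> cond_dom M T \<and> (\<exists>x\<in>X. restr (f x) A \<in> cond_restr M T A)}
      in cond_set M {x \<in> X. restr (f x) C \<in> cond_restr M T C} C)"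

definition stably_measurable ::
  "'w measure \<Rightarrow> ('w \<Rightarrow> 'a) set \<Rightarrow> ('w \<Rightarrow> 'a option) set set \<Rightarrow>
   ('w \<Rightarrow> 'b) set \<Rightarrow> ('w \<Rightarrow> 'b option) set set \<Rightarrow> (('w \<Rightarrow> 'a) \<Rightarrow> 'w \<Rightarrow> 'b) \<Rightarrow> bool" where
  "stably_measurable M X \<X> Y \<Y> f \<longleftrightarrow>
     stable_fun M X Y f \<and> (\<forall>T\<in>\<Y>. cond_vimage M X f T \<in> \<X>)"

abbreviation L0 :: "'w measure \<Rightarrow> ('w \<Rightarrow> real) set" where
  "L0 M \<equiv> borel_measurable M"

definition L0_ball :: "'w measure \<Rightarrow> ('w \<Rightarrow> real) \<Rightarrow> ('w \<Rightarrow> real) \<Rightarrow> ('w \<Rightarrow> real) set" where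
  "L0_ball M x r = {y \<in> L0 M. AE w in M. \<bar>x w - y w\<bar> < r w}"

definition stable_borel :: "'w measure \<Rightarrow> ('w \<Rightarrow> real option) set set" where
  "stable_borel M = stable_sigma_gen M (L0 M)
     {cond_set M (L0_ball M x r) (space M) | x r. x \<in> L0 M \<and> r \<in> L0 M \<and> (AE w in M. 0 < r w)}"

subsection \<open>The stable integral\<close>

definition stable_indicator ::
  "'w measure \<Rightarrow> ('w \<Rightarrow> 'e option) set \<Rightarrow> ('w \<Rightarrow> 'e) \<Rightarrow> 'w \<Rightarrow> real" where
  "stable_indicator M S x =
     indicator (ess_Sup M {A \<in> sets M. A \<subseteq> cond_dom M S \<and> restr x A \<in> cond_restr M S A})"

text \<open>\<open>r\<close> and \<open>S\<close> represent \<open>g\<close> as a stable elementary function with \<open>n + 1\<close> summands.\<close>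

definition elementary_rep ::
  "'w measure \<Rightarrow> ('w \<Rightarrow> 'e) set \<Rightarrow> ('w \<Rightarrow> 'e option) set set \<Rightarrow> nat \<Rightarrow> (nat \<Rightarrow> 'w \<Rightarrow> real) \<Rightarrow>
   (nat \<Rightarrow> ('w \<Rightarrow> 'e option) set) \<Rightarrow> (('w \<Rightarrow> 'e) \<Rightarrow> 'w \<Rightarrow> real) \<Rightarrow> bool" where
  "elementary_rep M X \<X> n r S g \<longleftrightarrow>
     (\<forall>k\<le>n. r k \<in> L0 M \<and> (AE w in M. 0 \<le> r k w) \<and> S k \<in> \<X>) \<and>
     (\<forall>i\<le>n. \<forall>j\<le>n. i \<noteq> j \<longrightarrow> cond_disjoint M X (S i) (S j)) \<and>
     cond_Sup M X (S ` {..n}) = cond_top M X \<and>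
     (\<forall>x\<in>X. AE w in M. g x w = (\<Sum>k\<le>n. r k w * stable_indicator M (S k) x w))"

definition stable_elementary ::
  "'w measure \<Rightarrow> ('w \<Rightarrow> 'e) set \<Rightarrow> ('w \<Rightarrow> 'e option) set set \<Rightarrow>
   (('w \<Rightarrow> 'e) \<Rightarrow> 'w \<Rightarrow> real) \<Rightarrow> bool" where
  "stable_elementary M X \<X> g \<longleftrightarrow> (\<exists>n r S. elementary_rep M X \<X> n r S g)"

text \<open>The integrals below are independent, up to almost sure equality, of the representation
  and of the approximating sequence; \<open>SOME\<close> picks a representative.\<close>

definition elementary_integral ::
  "'w measure \<Rightarrow> ('w \<Rightarrow> 'e) set \<Rightarrow> ('w \<Rightarrow> 'e option) set set \<Rightarrow>
   (('w \<Rightarrow> 'e option) set \<Rightarrow> 'w \<Rightarrow> ennreal) \<Rightarrow> (('w \<Rightarrow> 'e) \<Rightarrow> 'w \<Rightarrow> real) \<Rightarrow> 'w \<Rightarrow> ennreal" where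
  "elementary_integral M X \<X> \<mu> g = (SOME I. \<exists>n r S. elementary_rep M X \<X> n r S g \<and>
     (AE w in M. I w = (\<Sum>k\<le>n. ennreal (r k w) * \<mu> (S k) w)))"

definition stable_nn_integral ::
  "'w measure \<Rightarrow> ('w \<Rightarrow> 'e) set \<Rightarrow> ('w \<Rightarrow> 'e option) set set \<Rightarrow>
   (('w \<Rightarrow> 'e option) set \<Rightarrow> 'w \<Rightarrow> ennreal) \<Rightarrow> (('w \<Rightarrow> 'e) \<Rightarrow> 'w \<Rightarrow> real) \<Rightarrow> 'w \<Rightarrow> ennreal" where
  "stable_nn_integral M X \<X> \<mu> f = (SOME I. \<exists>g :: nat \<Rightarrow> _.
     (\<forall>n. stable_elementary M X \<X> (g n)) \<and>
     (\<forall>n. \<forall>x\<in>X. AE w in M. g n x w \<le> g (Suc n) x w) \<and>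
     (\<forall>x\<in>X. AE w in M. ennreal (f x w) = (SUP n. ennreal (g n x w))) \<and>
     (AE w in M. I w = (SUP n. elementary_integral M X \<X> \<mu> (g n) w)))"

definition pos_part :: "(('w \<Rightarrow> 'e) \<Rightarrow> 'w \<Rightarrow> real) \<Rightarrow> ('w \<Rightarrow> 'e) \<Rightarrow> 'w \<Rightarrow> real" where
  "pos_part f = (\<lambda>x w. max (f x w) 0)"

definition neg_part :: "(('w \<Rightarrow> 'e) \<Rightarrow> 'w \<Rightarrow> real) \<Rightarrow> ('w \<Rightarrow> 'e) \<Rightarrow> 'w \<Rightarrow> real" where
  "neg_part f = (\<lambda>x w. max (- f x w) 0)"

definition stable_integrable ::
  "'w measure \<Rightarrow> ('w \<Rightarrow> 'e) set \<Rightarrow> ('w \<Rightarrow> 'e option) set set \<Rightarrow>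
   (('w \<Rightarrow> 'e option) set \<Rightarrow> 'w \<Rightarrow> ennreal) \<Rightarrow> (('w \<Rightarrow> 'e) \<Rightarrow> 'w \<Rightarrow> real) \<Rightarrow> bool" where
  "stable_integrable M X \<X> \<mu> f \<longleftrightarrow> stably_measurable M X \<X> (L0 M) (stable_borel M) f \<and>
     (AE w in M. stable_nn_integral M X \<X> \<mu> (pos_part f) w < \<infinity>) \<and>
     (AE w in M. stable_nn_integral M X \<X> \<mu> (neg_part f) w < \<infinity>)"

text \<open>For integrable \<open>f\<close> this is the integral of the positive part minus that of the negative
  part. For a general stably measurable \<open>f\<close> the difference is taken on the event where both are
  finite, and the value is 0 elsewhere. This convention is local in \<open>w\<close>, as it has to be for
  \<open>x \<mapsto> \<integral> f\<^sub>x\<close> to be a stable function when some sections are integrable only on part of the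
  probability space.\<close>

definition stable_integral ::
  "'w measure \<Rightarrow> ('w \<Rightarrow> 'e) set \<Rightarrow> ('w \<Rightarrow> 'e option) set set \<Rightarrow>
   (('w \<Rightarrow> 'e option) set \<Rightarrow> 'w \<Rightarrow> ennreal) \<Rightarrow> (('w \<Rightarrow> 'e) \<Rightarrow> 'w \<Rightarrow> real) \<Rightarrow> 'w \<Rightarrow> real" where
  "stable_integral M X \<X> \<mu> f = (\<lambda>w.
     let p = stable_nn_integral M X \<X> \<mu> (pos_part f) w;
         q = stable_nn_integral M X \<X> \<mu> (neg_part f) w
     in if p < \<infinity> \<and> q < \<infinity> then enn2real p - enn2real q else 0)"

text \<open>\<open>P\<close> holds on a stable subset of \<open>X\<close> of full \<open>\<mu>\<close>-measure.\<close>

definition stable_AE ::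
  "'w measure \<Rightarrow> ('w \<Rightarrow> 'e) set \<Rightarrow> ('w \<Rightarrow> 'e option) set set \<Rightarrow>
   (('w \<Rightarrow> 'e option) set \<Rightarrow> 'w \<Rightarrow> ennreal) \<Rightarrow> (('w \<Rightarrow> 'e) \<Rightarrow> bool) \<Rightarrow> bool" where
  "stable_AE M X \<X> \<mu> P \<longleftrightarrow> (\<exists>V. V \<subseteq> X \<and> stable M V \<and> cond_set M V (space M) \<in> \<X> \<and>
     (AE w in M. \<mu> (cond_set M V (space M)) w = 1) \<and> (\<forall>x\<in>V. P x))"

subsection \<open>Products\<close>

definition fpair :: "('w \<Rightarrow> 'a) \<Rightarrow> ('w \<Rightarrow> 'b) \<Rightarrow> 'w \<Rightarrow> 'a \<times> 'b" where
  "fpair x y = (\<lambda>w. (x w, y w))"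

definition stable_prod :: "('w \<Rightarrow> 'a) set \<Rightarrow> ('w \<Rightarrow> 'b) set \<Rightarrow> ('w \<Rightarrow> 'a \<times> 'b) set" where
  "stable_prod X Y = {fpair x y | x y. x \<in> X \<and> y \<in> Y}"

definition stable_prod_algebra ::
  "'w measure \<Rightarrow> ('w \<Rightarrow> 'a) set \<Rightarrow> ('w \<Rightarrow> 'a option) set set \<Rightarrow>
   ('w \<Rightarrow> 'b) set \<Rightarrow> ('w \<Rightarrow> 'b option) set set \<Rightarrow> ('w \<Rightarrow> ('a \<times> 'b) option) set set" where
  "stable_prod_algebra M X \<X> Y \<Y> = stable_sigma_gen M (stable_prod X Y)
     {cond_set M (stable_prod V W) (A \<inter> B) | V A W B.
        V \<subseteq> X \<and> stable M V \<and> A \<in> sets M \<and> cond_set M V A \<in> \<X> \<and>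
        W \<subseteq> Y \<and> stable M W \<and> B \<in> sets M \<and> cond_set M W B \<in> \<Y>}"

definition is_stable_prod_measure ::
  "'w measure \<Rightarrow> ('w \<Rightarrow> 'a) set \<Rightarrow> ('w \<Rightarrow> 'a option) set set \<Rightarrow>
   (('w \<Rightarrow> 'a option) set \<Rightarrow> 'w \<Rightarrow> ennreal) \<Rightarrow>
   ('w \<Rightarrow> 'b) set \<Rightarrow> ('w \<Rightarrow> 'b option) set set \<Rightarrow>
   (('w \<Rightarrow> 'b option) set \<Rightarrow> 'w \<Rightarrow> ennreal) \<Rightarrow>
   (('w \<Rightarrow> ('a \<times> 'b) option) set \<Rightarrow> 'w \<Rightarrow> ennreal) \<Rightarrow> bool" where
  "is_stable_prod_measure M X \<X> \<mu> Y \<Y> \<nu> \<pi> \<longleftrightarrow>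
     stable_prob_space M (stable_prod X Y) (stable_prod_algebra M X \<X> Y \<Y>) \<pi> \<and>
     (\<forall>V A W B.
        V \<subseteq> X \<and> stable M V \<and> A \<in> sets M \<and> cond_set M V A \<in> \<X> \<and>
        W \<subseteq> Y \<and> stable M W \<and> B \<in> sets M \<and> cond_set M W B \<in> \<Y> \<longrightarrow>
        (AE w in M. \<pi> (cond_set M (stable_prod V W) (A \<inter> B)) w =
                    \<mu> (cond_set M V A) w * \<nu> (cond_set M W B) w))"

text \<open>The product measure is unique only up to almost sure equality of its values on the product
  algebra, hence \<open>SOME\<close> instead of \<open>THE\<close>.\<close>

definition stable_prod_measure ::
  "'w measure \<Rightarrow> ('w \<Rightarrow> 'a) set \<Rightarrow> ('w \<Rightarrow> 'a option) set set \<Rightarrow>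
   (('w \<Rightarrow> 'a option) set \<Rightarrow> 'w \<Rightarrow> ennreal) \<Rightarrow>
   ('w \<Rightarrow> 'b) set \<Rightarrow> ('w \<Rightarrow> 'b option) set set \<Rightarrow>
   (('w \<Rightarrow> 'b option) set \<Rightarrow> 'w \<Rightarrow> ennreal) \<Rightarrow>
   ('w \<Rightarrow> ('a \<times> 'b) option) set \<Rightarrow> 'w \<Rightarrow> ennreal" where
  "stable_prod_measure M X \<X> \<mu> Y \<Y> \<nu> = (SOME \<pi>. is_stable_prod_measure M X \<X> \<mu> Y \<Y> \<nu> \<pi>)"

end

(* Idea. A conditional set S of X is encoded by its graph, the set of all (x, w) such that x belongs to S
   near w; slices over x are only determined up to null sets. Boolean operations of conditional sets
   become set operations of graphs, so a stable sigma-algebra becomes an ordinary sigma-algebra on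
   X \<times> \<Omega>, a stable probability measure mu becomes the ordinary probability measure
   E \<mapsto> \<integral> mu(S) dP, stable measurability of f becomes measurability of (x, w) \<mapsto> f x w, and the stable
   integral becomes a conditional integral: the density with respect to P of the image of f dm under the
   projection to \<Omega>. The product measure is the integral over X \<times> \<Omega> of the conditional
   nu-integral of sections; a Dynkin argument on rectangles gives measurability, and since its value on
   rectangles is symmetric in the two factors, uniqueness yields both orders of integration. *)

theory Submission
  imports Defs
begin

text \<open>The obstacle is that statements hold almost surely for each fixed \<open>x\<close>, with
  a null set depending on \<open>x\<close>, while \<open>X\<close> is in general uncountable. A
  conditional integral of the section at \<open>x\<close> is a Radon-Nikodym density chosen
  separately for every \<open>x\<close>, so there is no kernel and nothing is a priori measurable in
  \<open>(x, w)\<close>. The remedy is that the \<sigma>-algebra on X \<times> \<Omega> contains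
  every set all of whose slices over \<open>x\<close> are null, and that such sets have measure
  zero. They are exactly the graphs of the least conditional set, so they come with the encoding,
  and they make any choice of versions measurable. There is also no scalar measure on
  \<open>X\<close> alone, since the values of \<mu> are random variables; the measure
  \<open>m\<close> on X \<times> \<Omega> is tied to P through its marginal on \<Omega>. Hence
  conditional densities take the place of ordinary inner integrals. Signed integrands bring a last
  complication: the positive part of the inner integral is not the inner integral of the positive
  part, so the two are compared through an identity between sums of nonnegative functions.\<close>

locale complete_prob_space = prob_space M + complete_measure M for M :: "'w measure"
begin

text \<open>Completeness of \<open>M\<close> enters here: corresponding preimages under
  \<open>f\<close> and \<open>g\<close> differ by a subset of a null set, which is itself
  measurable.\<close>

lemma AE_eq_measurable:
  assumes "f \<in> measurable M N" "AE w in M. g w = f w" "g \<in> space M \<rightarrow> space N"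
  shows "g \<in> measurable M N"
proof (rule measurableI)
  fix A assume "A \<in> sets N"
  then have "f -` A \<inter> space M \<in> sets M" using assms(1) by (rule measurable_sets[rotated])
  then show "g -` A \<inter> space M \<in> sets M"
  proof (rule in_sets_AE[rotated])
    show "AE w in M. w \<in> f -` A \<inter> space M \<longleftrightarrow> w \<in> g -` A \<inter> space M"
      using assms(2) by eventually_elim auto
  qed auto
qed (use assms(3) in auto)

subsection \<open>Essential suprema\<close>

text \<open>Exhaustion: some countable subfamily has a union of maximal measure, because the
  countably many subfamilies approaching the supremum can be merged. Adjoining a further
  \<open>B\<close> cannot raise this finite measure, so \<open>B\<close> minus the union is
  null.\<close>

lemma ess_Sup_aux:
  assumes "\<A> \<subseteq> sets M"
  obtains \<C> where "countable \<C>" "\<C> \<subseteq> \<A>" "\<And>B. B \<in> \<A> \<Longrightarrow> AE w\<in>B in M. w \<in> \<Union>\<C>"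
proof -
  let ?U = "{\<C>. countable \<C> \<and> \<C> \<subseteq> \<A>}"
  have sets: "\<Union>\<C> \<in> sets M" if "\<C> \<in> ?U" for \<C>
    using that assms by (intro sets.countable_Union) auto
  have "?U \<noteq> {}" by (auto intro: exI[of _ "{}"])
  from ennreal_SUP_countable_SUP[OF this, of "\<lambda>\<C>. emeasure M (\<Union>\<C>)"]
  obtain f :: "nat \<Rightarrow> ennreal" where f: "range f \<subseteq> (\<lambda>\<C>. emeasure M (\<Union>\<C>)) ` ?U"
    "(SUP \<C>\<in>?U. emeasure M (\<Union>\<C>)) = (SUP i. f i)" by blast
  then have "\<forall>i. \<exists>\<C>\<in>?U. f i = emeasure M (\<Union>\<C>)" by blast
  then obtain C where C: "\<And>i. C i \<in> ?U" "\<And>i. f i = emeasure M (\<Union>(C i))" by metis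
  define \<C> where "\<C> = (\<Union>i. C i)"
  have \<C>: "\<C> \<in> ?U" using C(1) unfolding \<C>_def by auto
  have max: "emeasure M (\<Union>\<D>) \<le> emeasure M (\<Union>\<C>)" if "\<D> \<in> ?U" for \<D>
  proof -
    have "emeasure M (\<Union>\<D>) \<le> (SUP i. f i)" unfolding f(2)[symmetric] using that by (rule SUP_upper)
    also have "\<dots> \<le> emeasure M (\<Union>\<C>)"
      unfolding C(2) using sets[OF \<C>] by (intro SUP_least emeasure_mono) (auto simp: \<C>_def)
    finally show ?thesis .
  qed
  have "AE w\<in>B in M. w \<in> \<Union>\<C>" if B: "B \<in> \<A>" for B
  proof -
    have Bs: "B \<in> sets M" using B assms by auto
    have "emeasure M (B - \<Union>\<C>) + emeasure M (\<Union>\<C>) = emeasure M (\<Union>(insert B \<C>))"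
      using Bs sets[OF \<C>] by (subst plus_emeasure) (auto intro!: arg_cong[where f="emeasure M"])
    also have "\<dots> \<le> emeasure M (\<Union>\<C>)" using \<C> B by (intro max) auto
    finally have "emeasure M (\<Union>\<C>) + emeasure M (B - \<Union>\<C>) \<le> emeasure M (\<Union>\<C>) + 0"
      by (simp add: add.commute)
    then have "emeasure M (B - \<Union>\<C>) = 0"
      by (subst (asm) ennreal_add_left_cancel_le) auto
    then have "B - \<Union>\<C> \<in> null_sets M" using Bs sets[OF \<C>] by auto
    from AE_not_in[OF this] show ?thesis by eventually_elim auto
  qed
  with \<C> that show thesis by blast
qed

lemma ess_Sup_props:
  assumes "\<A> \<subseteq> sets M"
  shows "ess_Sup M \<A> \<in> sets M \<and> (\<forall>B\<in>\<A>. AE w\<in>B in M. w \<in> ess_Sup M \<A>) \<and>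
     (\<forall>C\<in>sets M. (\<forall>B\<in>\<A>. AE w\<in>B in M. w \<in> C) \<longrightarrow> (AE w\<in>ess_Sup M \<A> in M. w \<in> C))"
proof -
  obtain \<C> where \<C>: "countable \<C>" "\<C> \<subseteq> \<A>" "\<And>B. B \<in> \<A> \<Longrightarrow> AE w\<in>B in M. w \<in> \<Union>\<C>"
    by (rule ess_Sup_aux[OF assms]) (rule that)
  have "AE w in M. w \<in> \<Union>\<C> \<longrightarrow> w \<in> C" if "\<forall>B\<in>\<A>. AE w\<in>B in M. w \<in> C" for C
  proof -
    have "AE w in M. \<forall>B\<in>\<C>. w \<in> B \<longrightarrow> w \<in> C"
      using \<C>(2) that by (subst AE_ball_countable[OF \<C>(1)]) auto
    then show ?thesis by eventually_elim auto
  qed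
  moreover have "\<Union>\<C> \<in> sets M" using \<C>(1,2) assms by (intro sets.countable_Union) auto
  ultimately show ?thesis
    unfolding ess_Sup_def by - (rule someI[where x = "\<Union>\<C>"], use \<C>(3) in blast)
qed

lemma ess_Sup_sets: "\<A> \<subseteq> sets M \<Longrightarrow> ess_Sup M \<A> \<in> sets M"
  and ess_Sup_upper: "\<A> \<subseteq> sets M \<Longrightarrow> B \<in> \<A> \<Longrightarrow> AE w\<in>B in M. w \<in> ess_Sup M \<A>"
  and ess_Sup_least: "\<A> \<subseteq> sets M \<Longrightarrow> C \<in> sets M \<Longrightarrow>
    (\<And>B. B \<in> \<A> \<Longrightarrow> AE w\<in>B in M. w \<in> C) \<Longrightarrow> AE w\<in>ess_Sup M \<A> in M. w \<in> C"
  by (simp_all add: ess_Sup_props[rule_format])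

lemma ess_Sup_countable:
  assumes "\<A> \<subseteq> sets M"
  obtains \<C> where "countable \<C>" "\<C> \<subseteq> \<A>" "AE w\<in>ess_Sup M \<A> in M. w \<in> \<Union>\<C>"
proof -
  obtain \<C> where \<C>: "countable \<C>" "\<C> \<subseteq> \<A>" "\<And>B. B \<in> \<A> \<Longrightarrow> AE w\<in>B in M. w \<in> \<Union>\<C>"
    by (rule ess_Sup_aux[OF assms]) (rule that)
  moreover have "\<Union>\<C> \<in> sets M" using \<C>(1,2) assms by (intro sets.countable_Union) auto
  ultimately show thesis by (intro that[of \<C>] ess_Sup_least[OF assms])
qed

end

subsection \<open>Stable sets\<close>

lemma partition_ofD:
  assumes "partition_of M A"
  shows partition_sets: "A k \<in> sets M"
    and partition_unique: "w \<in> A i \<Longrightarrow> w \<in> A j \<Longrightarrow> i = j"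
    and partition_cover: "w \<in> space M \<Longrightarrow> \<exists>k. w \<in> A k"
  using assms unfolding partition_of_def disjoint_family_on_def by blast+

lemma concat_exists:
  assumes "partition_of M A"
  obtains y where "\<And>k w. w \<in> A k \<Longrightarrow> y w = x k w"
proof (rule that)
  fix k w assume k: "w \<in> A k"
  then have "(THE k. w \<in> A k) = k" using partition_unique[OF assms] by blast
  then show "(\<lambda>w. x (THE k. w \<in> A k) w) w = x k w" by simp
qed

definition two_part :: "'w measure \<Rightarrow> 'w set \<Rightarrow> nat \<Rightarrow> 'w set" where
  "two_part M A k = (if k = 0 then A else if k = 1 then space M - A else {})"

lemma partition_two_part: "A \<in> sets M \<Longrightarrow> partition_of M (two_part M A)"
  unfolding partition_of_def two_part_def disjoint_family_on_def
  using sets.sets_into_space[of A M] by (auto split: if_splits)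

lemma stable_concat:
  "stable M V \<Longrightarrow> partition_of M A \<Longrightarrow> range x \<subseteq> V \<Longrightarrow> is_concat M A x y \<Longrightarrow> y \<in> V"
  unfolding stable_def by blast

lemma stable_if:
  assumes "stable M V" "x \<in> V" "z \<in> V" "A \<in> sets M" "AE w in M. (w \<in> A \<longrightarrow> y w = x w) \<and> (w \<notin> A \<longrightarrow> y w = z w)"
  shows "y \<in> V"
proof (rule stable_concat[OF assms(1) partition_two_part[OF assms(4)], of "\<lambda>k. if k = 0 then x else z"])
  show "is_concat M (two_part M A) (\<lambda>k. if k = 0 then x else z) y"
    unfolding is_concat_def using assms(5) by eventually_elim (auto simp: two_part_def split: if_splits)
qed (use assms in auto)

context complete_prob_space
begin

text \<open>The exhaustion argument behind all statements of the form "the essential supremum is attained".\<close>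

lemma stable_attain:
  assumes V: "stable M V" and \<A>: "\<A> \<subseteq> sets M"
    and R: "\<And>A. A \<in> \<A> \<Longrightarrow> \<exists>v\<in>V. AE w\<in>A in M. R v w"
    and loc: "\<And>A v y. partition_of M A \<Longrightarrow> range v \<subseteq> V \<Longrightarrow> is_concat M A v y \<Longrightarrow>
       AE w in M. \<forall>k. w \<in> A k \<longrightarrow> R (v k) w \<longrightarrow> R y w"
  shows "\<exists>v\<in>V. AE w\<in>ess_Sup M \<A> in M. R v w"
proof -
  obtain \<C> where \<C>: "countable \<C>" "\<C> \<subseteq> \<A>" "AE w\<in>ess_Sup M \<A> in M. w \<in> \<Union>\<C>"
    by (rule ess_Sup_countable[OF \<A>]) (rule that)
  obtain v0 where v0: "v0 \<in> V" using V unfolding stable_def by blast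
  \<comment> \<open>Inserting the empty set makes the family nonempty, so that it can be enumerated;
    on the empty set there is nothing to satisfy.\<close>
  define B where "B = from_nat_into (insert {} \<C>)"
  have B: "range B = insert {} \<C>" unfolding B_def using \<C>(1) by (intro range_from_nat_into) auto
  have Bs: "B k \<in> sets M" for k using B \<C>(2) \<A> by (metis insert_iff rangeI sets.empty_sets subset_iff)
  have "\<exists>v\<in>V. AE w in M. w \<in> B k \<longrightarrow> R v w" for k
  proof (cases "B k \<in> \<A>")
    case False
    then have "B k = {}" using B \<C>(2) by blast
    then show ?thesis using v0 by auto
  qed (rule R)
  then obtain v where v: "\<And>k. v k \<in> V" "\<And>k. AE w in M. w \<in> B k \<longrightarrow> R (v k) w" by metis
  \<comment> \<open>Index 0 is reserved for the part that the family does not cover, where the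
    default \<open>v0\<close> is used; disjointing the \<open>B k\<close> fills the remaining
    indices.\<close>
  define A where "A k = (case k of 0 \<Rightarrow> space M - (\<Union>k. B k) | Suc k \<Rightarrow> disjointed B k)" for k
  define v' where "v' k = (case k of 0 \<Rightarrow> v0 | Suc k \<Rightarrow> v k)" for k
  have sub: "B k \<subseteq> space M" for k using Bs sets.sets_into_space by blast
  have sd: "disjointed B k \<subseteq> B k" for k by (simp add: disjointed_subset)
  have dd: "disjointed B i \<inter> disjointed B j = {}" if "i \<noteq> j" for i j
    using disjoint_family_disjointed[of B] that by (auto simp: disjoint_family_on_def)
  have A: "partition_of M A"
    unfolding partition_of_def
  proof (intro conjI)
    show "range A \<subseteq> sets M"
      using Bs sets.range_disjointed_sets[of B M] by (auto simp: A_def image_subset_iff split: nat.splits)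
    show "disjoint_family A"
      unfolding disjoint_family_on_def
    proof (intro ballI impI)
      fix i j :: nat assume "i \<noteq> j"
      then show "A i \<inter> A j = {}" using sd dd by (fastforce simp: A_def split: nat.splits)
    qed
    have "(\<Union>k. A k) = A 0 \<union> (\<Union>k. A (Suc k))"
      by (subst UNIV_nat_eq) simp
    also have "\<dots> = space M" using sub by (auto simp: A_def UN_disjointed_eq)
    finally show "(\<Union>k. A k) = space M" .
  qed
  obtain y where y: "\<And>k w. w \<in> A k \<Longrightarrow> y w = v' k w" using concat_exists[OF A] by blast
  have r: "range v' \<subseteq> V" using v(1) v0 by (auto simp: v'_def split: nat.splits)
  have c: "is_concat M A v' y" using y by (simp add: is_concat_def)
  have "AE w in M. \<forall>k. w \<in> B k \<longrightarrow> R (v k) w" using v(2) by (simp add: AE_all_countable)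
  with \<C>(3) loc[OF A r c] have "AE w\<in>ess_Sup M \<A> in M. R y w"
  proof eventually_elim
    case (elim w)
    show ?case
    proof
      assume "w \<in> ess_Sup M \<A>"
      then have "w \<in> (\<Union>k. B k)" using elim B by auto
      then obtain k where k: "w \<in> disjointed B k" using UN_disjointed_eq[of B] by blast
      then show "R y w" using elim(2)[rule_format, of "Suc k"] elim(3) sd[of k] by (auto simp: A_def v'_def)
    qed
  qed
  moreover have "y \<in> V" by (rule stable_concat[OF V A r c])
  ultimately show ?thesis by blast
qed

end

subsection \<open>Conditional sets as subsets of \<open>X \<times> \<Omega>\<close>\<close>

text \<open>The same essential supremum occurs in \<open>stable_indicator\<close>, whose value at
  \<open>x\<close> is therefore the indicator of this event. Later these events become the slices of
  a graph.\<close>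

definition event :: "'w measure \<Rightarrow> ('w \<Rightarrow> 'e option) set \<Rightarrow> ('w \<Rightarrow> 'e) \<Rightarrow> 'w set" where
  "event M S x = ess_Sup M {A \<in> sets M. A \<subseteq> cond_dom M S \<and> restr x A \<in> cond_restr M S A}"

text \<open>\<open>represents M X S E\<close>: the slice of \<open>E\<close> over \<open>x\<close> is the largest event on which \<open>x\<close> belongs to \<open>S\<close>.\<close>

definition represents ::
  "'w measure \<Rightarrow> ('w \<Rightarrow> 'e) set \<Rightarrow> ('w \<Rightarrow> 'e option) set \<Rightarrow> (('w \<Rightarrow> 'e) \<times> 'w) set \<Rightarrow> bool" where
  "represents M X S E \<longleftrightarrow> S \<in> cond_Pow M X \<and> E \<subseteq> X \<times> space M \<and>
     (\<forall>x\<in>X. AE w in M. (x, w) \<in> E \<longleftrightarrow> w \<in> event M S x)"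

text \<open>The last clause is locality in \<open>x\<close>: gluing functions along a partition
  glues their slices. Among sets with measurable slices it singles out the graphs of conditional
  sets, by \<open>represents_stable_graph\<close> and \<open>represents_exists\<close>.\<close>

definition stable_graph :: "'w measure \<Rightarrow> ('w \<Rightarrow> 'e) set \<Rightarrow> (('w \<Rightarrow> 'e) \<times> 'w) set \<Rightarrow> bool" where
  "stable_graph M X E \<longleftrightarrow> E \<subseteq> X \<times> space M \<and> (\<forall>x\<in>X. Pair x -` E \<in> sets M) \<and>
     (\<forall>A x y. partition_of M A \<longrightarrow> range x \<subseteq> X \<longrightarrow> is_concat M A x y \<longrightarrow>
        (AE w in M. \<forall>k. w \<in> A k \<longrightarrow> ((y, w) \<in> E \<longleftrightarrow> (x k, w) \<in> E)))"

definition event_graph ::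
  "'w measure \<Rightarrow> ('w \<Rightarrow> 'e) set \<Rightarrow> ('w \<Rightarrow> 'e option) set \<Rightarrow> (('w \<Rightarrow> 'e) \<times> 'w) set" where
  "event_graph M X S = {(x, w). x \<in> X \<and> w \<in> event M S x}"

lemma stable_graph_concat:
  assumes "stable_graph M X E" "partition_of M A" "range x \<subseteq> X" "is_concat M A x y"
  shows "AE w in M. \<forall>k. w \<in> A k \<longrightarrow> ((y, w) \<in> E \<longleftrightarrow> (x k, w) \<in> E)"
  using assms unfolding stable_graph_def by blast

lemma cond_PowE:
  assumes "S \<in> cond_Pow M X"
  obtains V B where "S = cond_set M V B" "V \<subseteq> X" "stable M V" "B \<in> sets M"
  using assms unfolding cond_Pow_def by blast

lemma cond_set_in_cond_Pow: "V \<subseteq> X \<Longrightarrow> stable M V \<Longrightarrow> B \<in> sets M \<Longrightarrow> cond_set M V B \<in> cond_Pow M X"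
  unfolding cond_Pow_def by blast

lemma stable_nonempty: "stable M V \<Longrightarrow> V \<noteq> {}"
  unfolding stable_def by blast

lemma restr_in_cond_restr_iff:
  "restr x A \<in> cond_restr M (cond_set M V B) A \<longleftrightarrow>
    (\<exists>v\<in>V. AE w\<in>A in M. w \<in> B \<and> x w = v w)"
proof -
  have "(restr x A w = restr v (B \<inter> A) w) \<longleftrightarrow> (w \<in> A \<longrightarrow> w \<in> B \<and> x w = v w)" for v w
    by (auto simp: restr_def)
  then show ?thesis unfolding cond_restr_cond_set by (auto simp: cond_set_def)
qed

lemma cond_set_AE_cong:
  assumes "AE w in M. w \<in> A \<longleftrightarrow> w \<in> B"
  shows "cond_set M V A = cond_set M V B"
proof -
  have "(AE w in M. p w = restr x A w) \<longleftrightarrow> (AE w in M. p w = restr x B w)" for p :: "'a \<Rightarrow> 'b option" and x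
  proof (rule iffI)
    show "AE w in M. p w = restr x B w" if "AE w in M. p w = restr x A w"
      using that assms by eventually_elim (auto simp: restr_def)
    show "AE w in M. p w = restr x A w" if "AE w in M. p w = restr x B w"
      using that assms by eventually_elim (auto simp: restr_def)
  qed
  then show ?thesis unfolding cond_set_def by simp
qed

context complete_prob_space
begin

lemma event_sets: "event M S x \<in> sets M"
  unfolding event_def by (rule ess_Sup_sets) auto

lemma event_greatest:
  assumes V: "stable M V" and B: "B \<in> sets M" and A: "A \<in> sets M"
    and v: "v \<in> V" "AE w\<in>A in M. w \<in> B \<and> x w = v w"
  shows "AE w\<in>A in M. w \<in> event M (cond_set M V B) x"
proof -
  \<comment> \<open>The family defining \<open>event\<close> asks for literal inclusion in
    \<open>cond_dom\<close>, which is chosen by \<open>SOME\<close> and equals \<open>B\<close> only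
    up to a null set. Hence \<open>A\<close> is cut down to \<open>A \<inter> ?D\<close>, which
    completeness keeps measurable.\<close>
  let ?D = "cond_dom M (cond_set M V B)"
  have D: "AE w in M. w \<in> ?D \<longleftrightarrow> w \<in> B" by (rule cond_dom_cond_set[OF stable_nonempty[OF V] B])
  have AD: "A \<inter> ?D \<in> sets M"
  proof (rule in_sets_AE)
    show "AE w in M. w \<in> A \<longleftrightarrow> w \<in> A \<inter> ?D" using D v(2) by eventually_elim auto
  qed (use A sets.sets_into_space[OF A] in auto)
  have "AE w in M. w \<in> A \<inter> ?D \<longrightarrow> w \<in> event M (cond_set M V B) x"
    unfolding event_def
  proof (rule ess_Sup_upper, goal_cases)
    case 2
    have "AE w in M. w \<in> A \<inter> ?D \<longrightarrow> w \<in> B \<and> x w = v w" using v(2) by eventually_elim auto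
    then show ?case using AD v(1) by (auto simp: restr_in_cond_restr_iff)
  qed auto
  with D v(2) show ?thesis by eventually_elim auto
qed

text \<open>Agreement with \<open>x\<close> on \<open>B\<close> is a pointwise condition, so members
  of \<open>V\<close> that agree with \<open>x\<close> on smaller events can be glued into one that
  works on the whole supremum.\<close>

lemma event_attained:
  assumes V: "stable M V" and B: "B \<in> sets M"
  shows "\<exists>v\<in>V. AE w\<in>event M (cond_set M V B) x in M. w \<in> B \<and> x w = v w"
  unfolding event_def
proof (rule stable_attain[OF V])
  fix A and v :: "nat \<Rightarrow> 'w \<Rightarrow> 'a" and y
  assume "is_concat M A v y"
  then show "AE w in M. \<forall>k. w \<in> A k \<longrightarrow> w \<in> B \<and> x w = v k w \<longrightarrow> w \<in> B \<and> x w = y w"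
    unfolding is_concat_def by eventually_elim auto
qed (auto simp: restr_in_cond_restr_iff)

text \<open>The working form of \<open>represents\<close>: since the supremum is attained, one
  member of \<open>V\<close> serves for the entire event. Most later arguments use this equivalence
  instead of the essential supremum.\<close>

lemma represents_graph_iff:
  assumes r: "represents M X (cond_set M V B) E" and V: "stable M V" and B: "B \<in> sets M"
    and x: "x \<in> X" and A: "A \<in> sets M"
  shows "(AE w\<in>A in M. (x, w) \<in> E) \<longleftrightarrow> (\<exists>v\<in>V. AE w\<in>A in M. w \<in> B \<and> x w = v w)"
proof
  have e: "AE w in M. (x, w) \<in> E \<longleftrightarrow> w \<in> event M (cond_set M V B) x"
    using r x unfolding represents_def by blast
  { assume "AE w\<in>A in M. (x, w) \<in> E"
    moreover obtain v where "v \<in> V" "AE w\<in>event M (cond_set M V B) x in M. w \<in> B \<and> x w = v w"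
      using event_attained[OF V B] by blast
    note v = this
    ultimately have "AE w\<in>A in M. w \<in> B \<and> x w = v w"
      using e v(2) by eventually_elim auto
    with v(1) show "\<exists>v\<in>V. AE w\<in>A in M. w \<in> B \<and> x w = v w" by blast }
  assume "\<exists>v\<in>V. AE w\<in>A in M. w \<in> B \<and> x w = v w"
  then obtain v where v: "v \<in> V" "AE w\<in>A in M. w \<in> B \<and> x w = v w" by blast
  from event_greatest[OF V B A v] e show "AE w\<in>A in M. (x, w) \<in> E" by eventually_elim auto
qed

lemma slice_sets:
  assumes "represents M X S E" "x \<in> X"
  shows "Pair x -` E \<in> sets M"
proof (rule in_sets_AE)
  show "AE w in M. w \<in> event M S x \<longleftrightarrow> w \<in> Pair x -` E"
    using assms unfolding represents_def by auto
qed (use assms event_sets in \<open>auto simp: represents_def\<close>)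

text \<open>\<open>att\<close> bounds the slice by the event through \<open>event_greatest\<close>;
  \<open>great\<close>, applied to the member of \<open>V\<close> at which the event is attained,
  gives the reverse inclusion.\<close>

lemma representsI:
  assumes V: "V \<subseteq> X" "stable M V" and B: "B \<in> sets M" and E: "E \<subseteq> X \<times> space M"
    and s: "\<And>x. x \<in> X \<Longrightarrow> Pair x -` E \<in> sets M"
    and att: "\<And>x. x \<in> X \<Longrightarrow> \<exists>v\<in>V. AE w in M. (x, w) \<in> E \<longrightarrow> w \<in> B \<and> x w = v w"
    and great: "\<And>x v A. x \<in> X \<Longrightarrow> v \<in> V \<Longrightarrow> A \<in> sets M \<Longrightarrow>
       AE w\<in>A in M. w \<in> B \<and> x w = v w \<Longrightarrow> AE w\<in>A in M. (x, w) \<in> E"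
  shows "represents M X (cond_set M V B) E"
  unfolding represents_def
proof (intro conjI ballI)
  show "cond_set M V B \<in> cond_Pow M X" by (rule cond_set_in_cond_Pow[OF V B])
  fix x assume x: "x \<in> X"
  obtain v where v: "v \<in> V" "AE w\<in>event M (cond_set M V B) x in M. w \<in> B \<and> x w = v w"
    using event_attained[OF V(2) B] by blast
  have 1: "AE w\<in>event M (cond_set M V B) x in M. (x, w) \<in> E"
    by (rule great[OF x v(1) event_sets v(2)])
  obtain u where u: "u \<in> V" "AE w in M. (x, w) \<in> E \<longrightarrow> w \<in> B \<and> x w = u w"
    using att[OF x] by blast
  have "AE w\<in>Pair x -` E in M. w \<in> event M (cond_set M V B) x"
    by (rule event_greatest[OF V(2) B s[OF x] u(1)]) (use u(2) in simp)
  with 1 show "AE w in M. (x, w) \<in> E \<longleftrightarrow> w \<in> event M (cond_set M V B) x"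
    by eventually_elim auto
qed (rule E)

lemma represents_event_graph:
  assumes "S \<in> cond_Pow M X"
  shows "represents M X S (event_graph M X S)"
  using assms event_sets[THEN sets.sets_into_space] unfolding represents_def event_graph_def by auto

lemma represents_AE_cong:
  assumes "represents M X S E" "F \<subseteq> X \<times> space M" "\<And>x. x \<in> X \<Longrightarrow> AE w in M. (x, w) \<in> F \<longleftrightarrow> (x, w) \<in> E"
  shows "represents M X S F"
  unfolding represents_def
proof (intro conjI ballI)
  fix x assume x: "x \<in> X"
  then have "AE w in M. (x, w) \<in> E \<longleftrightarrow> w \<in> event M S x" using assms(1) unfolding represents_def by blast
  with assms(3)[OF x] show "AE w in M. (x, w) \<in> F \<longleftrightarrow> w \<in> event M S x" by eventually_elim auto
qed (use assms in \<open>auto simp: represents_def\<close>)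

lemma represents_AE_eq:
  assumes "represents M X S E" "represents M X S F" "x \<in> X"
  shows "AE w in M. (x, w) \<in> F \<longleftrightarrow> (x, w) \<in> E"
proof -
  have "AE w in M. (x, w) \<in> E \<longleftrightarrow> w \<in> event M S x" "AE w in M. (x, w) \<in> F \<longleftrightarrow> w \<in> event M S x"
    using assms unfolding represents_def by blast+
  then show ?thesis by eventually_elim auto
qed

text \<open>If two elements of \<open>X\<close> agree on \<open>A k\<close>, a member of
  \<open>V\<close> that agrees with one of them on part of \<open>A k\<close> agrees with the other
  there as well. This is applied in both directions to \<open>y\<close> and
  \<open>x k\<close>.\<close>

lemma represents_stable_graph:
  assumes X: "stable M X" and r: "represents M X S E"
  shows "stable_graph M X E"
  unfolding stable_graph_def
proof (intro conjI allI impI ballI)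
  show "E \<subseteq> X \<times> space M" using r unfolding represents_def by blast
  show "Pair x -` E \<in> sets M" if "x \<in> X" for x by (rule slice_sets[OF r that])
  fix A x y assume A: "partition_of M A" and x: "range x \<subseteq> X" and y: "is_concat M A x y"
  obtain V B where S: "S = cond_set M V B" "V \<subseteq> X" "stable M V" "B \<in> sets M"
    using r unfolding represents_def by (auto elim: cond_PowE)
  note iff = represents_graph_iff[OF r[unfolded S(1)] S(3,4)]
  have yX: "y \<in> X" by (rule stable_concat[OF X A x y])
  have main: "AE w in M. w \<in> C \<inter> A k \<longrightarrow> (z', w) \<in> E"
    if z: "z \<in> X" "z' \<in> X" "AE w in M. w \<in> A k \<longrightarrow> z w = z' w" and C: "C = Pair z -` E" for z z' k C
  proof -
    have Cs: "C \<inter> A k \<in> sets M" using slice_sets[OF r z(1)] partition_sets[OF A] C by auto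
    have "AE w in M. w \<in> C \<inter> A k \<longrightarrow> (z, w) \<in> E" using C by auto
    then obtain v where v: "v \<in> V" "AE w in M. w \<in> C \<inter> A k \<longrightarrow> w \<in> B \<and> z w = v w"
      using iff[OF z(1) Cs] by blast
    have "AE w in M. w \<in> C \<inter> A k \<longrightarrow> w \<in> B \<and> z' w = v w"
      using v(2) z(3) by eventually_elim auto
    then show ?thesis using iff[OF z(2) Cs] v(1) by blast
  qed
  have "AE w in M. w \<in> A k \<longrightarrow> ((y, w) \<in> E \<longleftrightarrow> (x k, w) \<in> E)" for k
  proof -
    have xk: "x k \<in> X" using x by auto
    have e: "AE w in M. w \<in> A k \<longrightarrow> y w = x k w" "AE w in M. w \<in> A k \<longrightarrow> x k w = y w"
      using y unfolding is_concat_def by (eventually_elim, auto)+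
    from main[OF yX xk e(1) refl] main[OF xk yX e(2) refl] show ?thesis
      by eventually_elim auto
  qed
  then show "AE w in M. \<forall>k. w \<in> A k \<longrightarrow> ((y, w) \<in> E \<longleftrightarrow> (x k, w) \<in> E)"
    by (simp add: AE_all_countable)
qed

lemma stable_graph_if:
  assumes E: "stable_graph M X E" and "x \<in> X" "z \<in> X" and A: "A \<in> sets M"
    and y: "AE w in M. (w \<in> A \<longrightarrow> y w = x w) \<and> (w \<notin> A \<longrightarrow> y w = z w)"
  shows "AE w in M. (w \<in> A \<longrightarrow> ((y, w) \<in> E \<longleftrightarrow> (x, w) \<in> E)) \<and> (w \<notin> A \<longrightarrow> ((y, w) \<in> E \<longleftrightarrow> (z, w) \<in> E))"
proof -
  let ?x = "\<lambda>k::nat. if k = 0 then x else z"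
  have "is_concat M (two_part M A) ?x y"
    unfolding is_concat_def using y by eventually_elim (auto simp: two_part_def split: if_splits)
  then have "AE w in M. \<forall>k. w \<in> two_part M A k \<longrightarrow> ((y, w) \<in> E \<longleftrightarrow> (?x k, w) \<in> E)"
    using assms(2,3) by (intro stable_graph_concat[OF E partition_two_part[OF A]]) auto
  with AE_space show ?thesis
  proof eventually_elim
    case (elim w)
    then show ?case using elim(2)[rule_format, of 0] elim(2)[rule_format, of 1] by (auto simp: two_part_def)
  qed
qed

lemma stable_graph_AE_eq:
  assumes "stable_graph M X E" "x \<in> X" "z \<in> X" "A \<in> sets M" "AE w\<in>A in M. z w = x w"
  shows "AE w\<in>A in M. ((z, w) \<in> E \<longleftrightarrow> (x, w) \<in> E)"
proof -
  have "AE w in M. (w \<in> A \<longrightarrow> z w = x w) \<and> (w \<notin> A \<longrightarrow> z w = z w)" using assms(5) by eventually_elim auto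
  from stable_graph_if[OF assms(1-4) this] show ?thesis by eventually_elim auto
qed

lemma stable_containing_slices:
  assumes X: "stable M X" and E: "stable_graph M X E" and x0: "x0 \<in> X" "AE w\<in>C in M. (x0, w) \<in> E"
  shows "stable M {x \<in> X. AE w\<in>C in M. (x, w) \<in> E}" (is "stable M ?V")
  unfolding stable_def
proof (intro conjI allI impI)
  show "?V \<noteq> {}" using x0 by blast
  fix A x y assume A: "partition_of M A" and x: "range x \<subseteq> ?V" and y: "is_concat M A x y"
  have "range x \<subseteq> X" using x by auto
  then have "AE w in M. \<forall>k. w \<in> A k \<longrightarrow> ((y, w) \<in> E \<longleftrightarrow> (x k, w) \<in> E)"
    by (rule stable_graph_concat[OF E A _ y])
  moreover have "AE w in M. \<forall>k. w \<in> C \<longrightarrow> (x k, w) \<in> E"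
    using x by (subst AE_all_countable) auto
  ultimately have "AE w\<in>C in M. (y, w) \<in> E"
    using AE_space
  proof eventually_elim
    case (elim w)
    then show ?case using partition_cover[OF A, of w] by auto
  qed
  then show "y \<in> ?V" using stable_concat[OF X A \<open>range x \<subseteq> X\<close> y] by blast
qed

text \<open>The way back from graphs to conditional sets. \<open>C\<close> is an upper bound of all
  slices that one slice, that of \<open>x0\<close>, attains; it becomes the domain, and the
  functions whose slice fills \<open>C\<close> become the stable set.\<close>

lemma represents_cond_set:
  assumes X: "stable M X" and E: "stable_graph M X E" and C: "C \<in> sets M"
    and upper: "\<And>x. x \<in> X \<Longrightarrow> AE w in M. (x, w) \<in> E \<longrightarrow> w \<in> C"
    and x0: "x0 \<in> X" "AE w\<in>C in M. (x0, w) \<in> E"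
  shows "represents M X (cond_set M {x \<in> X. AE w\<in>C in M. (x, w) \<in> E} C) E"
proof (rule representsI)
  let ?V = "{x \<in> X. AE w\<in>C in M. (x, w) \<in> E}"
  show "stable M ?V" by (rule stable_containing_slices[OF X E x0])
  show "E \<subseteq> X \<times> space M" "\<And>x. x \<in> X \<Longrightarrow> Pair x -` E \<in> sets M"
    using E unfolding stable_graph_def by auto
  fix x assume x: "x \<in> X"
  show "\<exists>v\<in>?V. AE w in M. (x, w) \<in> E \<longrightarrow> w \<in> C \<and> x w = v w"
  proof
    let ?A = "Pair x -` E"
    \<comment> \<open>Replacing \<open>x\<close> by \<open>x0\<close> off its own slice puts it into
      \<open>?V\<close> without changing it where it belongs to the graph.\<close>
    let ?v = "\<lambda>w. if w \<in> ?A then x w else x0 w"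
    have A: "?A \<in> sets M" using E x unfolding stable_graph_def by auto
    have v: "AE w in M. (w \<in> ?A \<longrightarrow> ?v w = x w) \<and> (w \<notin> ?A \<longrightarrow> ?v w = x0 w)" by auto
    from stable_graph_if[OF E x x0(1) A v] x0(2) have "AE w\<in>C in M. (?v, w) \<in> E"
      by eventually_elim auto
    with stable_if[OF X x x0(1) A v] show "?v \<in> ?V" by blast
    show "AE w in M. (x, w) \<in> E \<longrightarrow> w \<in> C \<and> x w = ?v w" using upper[OF x] by eventually_elim auto
  qed
  fix v A assume v: "v \<in> ?V" and A: "A \<in> sets M" "AE w\<in>A in M. w \<in> C \<and> x w = v w"
  have "AE w\<in>A in M. x w = v w" using A(2) by eventually_elim auto
  from stable_graph_AE_eq[OF E _ x A(1) this] v have "AE w\<in>A in M. ((x, w) \<in> E \<longleftrightarrow> (v, w) \<in> E)" by auto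
  moreover have "AE w\<in>C in M. (v, w) \<in> E" using v by auto
  ultimately show "AE w\<in>A in M. (x, w) \<in> E" using A(2) by eventually_elim auto
qed (use C in auto)

lemma stable_graph_attain:
  assumes X: "stable M X" and E: "stable_graph M X E" and \<A>: "\<A> \<subseteq> sets M"
    and R: "\<And>A. A \<in> \<A> \<Longrightarrow> \<exists>x\<in>X. AE w\<in>A in M. (x, w) \<in> E"
  shows "\<exists>x\<in>X. AE w\<in>ess_Sup M \<A> in M. (x, w) \<in> E"
proof (rule stable_attain[OF X \<A> R])
  fix A v y assume "partition_of M A" "range v \<subseteq> X" "is_concat M A v y"
  then have "AE w in M. \<forall>k. w \<in> A k \<longrightarrow> ((y, w) \<in> E \<longleftrightarrow> (v k, w) \<in> E)"
    by (rule stable_graph_concat[OF E])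
  then show "AE w in M. \<forall>k. w \<in> A k \<longrightarrow> (v k, w) \<in> E \<longrightarrow> (y, w) \<in> E" by eventually_elim auto
qed

text \<open>The domain is the essential supremum of all slices, and locality of the graph makes it
  attained by a single element.\<close>

lemma represents_exists:
  assumes X: "stable M X" and E: "stable_graph M X E"
  obtains S where "represents M X S E"
proof -
  let ?\<A> = "(\<lambda>x. Pair x -` E) ` X"
  have A: "?\<A> \<subseteq> sets M" using E unfolding stable_graph_def by auto
  have "\<exists>x\<in>X. AE w in M. w \<in> ess_Sup M ?\<A> \<longrightarrow> (x, w) \<in> E"
    by (rule stable_graph_attain[OF X E A]) auto
  then obtain x0 where "x0 \<in> X" "AE w in M. w \<in> ess_Sup M ?\<A> \<longrightarrow> (x0, w) \<in> E" by blast
  moreover have "AE w in M. (x, w) \<in> E \<longrightarrow> w \<in> ess_Sup M ?\<A>" if "x \<in> X" for x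
    using ess_Sup_upper[OF A, of "Pair x -` E"] that by auto
  ultimately show thesis by (rule that[OF represents_cond_set[OF X E ess_Sup_sets[OF A]], rotated])
qed

text \<open>A member of \<open>V\<close> that agrees with \<open>x\<close> on its slice is,
  restricted to \<open>A\<close>, an element of \<open>S\<close>, and so agrees on \<open>A\<close>
  with a member of \<open>W\<close>. Conversely the slice of every \<open>v\<close> in
  \<open>V\<close> contains \<open>A\<close>; inclusion of slices then provides a member of
  \<open>W\<close> equal to \<open>v\<close> on \<open>A\<close>. The null set may depend on
  \<open>x\<close>.\<close>

lemma cond_le_iff:
  assumes X: "stable M X" and S: "represents M X S E" and T: "represents M X T F"
  shows "cond_le M S T \<longleftrightarrow> (\<forall>x\<in>X. AE w in M. (x, w) \<in> E \<longrightarrow> (x, w) \<in> F)"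
proof -
  obtain V A where V: "S = cond_set M V A" "V \<subseteq> X" "stable M V" "A \<in> sets M"
    using S unfolding represents_def by (auto elim: cond_PowE)
  obtain W B where W: "T = cond_set M W B" "W \<subseteq> X" "stable M W" "B \<in> sets M"
    using T unfolding represents_def by (auto elim: cond_PowE)
  note iS = represents_graph_iff[OF S[unfolded V(1)] V(3,4)]
  note iT = represents_graph_iff[OF T[unfolded W(1)] W(3,4)]
  have dA: "AE w in M. w \<in> cond_dom M S \<longleftrightarrow> w \<in> A"
    unfolding V(1) by (rule cond_dom_cond_set[OF stable_nonempty[OF V(3)] V(4)])
  have dB: "AE w in M. w \<in> cond_dom M T \<longleftrightarrow> w \<in> B"
    unfolding W(1) by (rule cond_dom_cond_set[OF stable_nonempty[OF W(3)] W(4)])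
  have r: "cond_restr M T (cond_dom M S) = cond_set M W (B \<inter> A)"
    unfolding W(1) cond_restr_cond_set by (rule cond_set_AE_cong) (use dA in \<open>eventually_elim, auto\<close>)
  show ?thesis
  proof
    assume le: "cond_le M S T"
    show "\<forall>x\<in>X. AE w in M. (x, w) \<in> E \<longrightarrow> (x, w) \<in> F"
    proof
      fix x assume x: "x \<in> X"
      have Ex: "Pair x -` E \<in> sets M" by (rule slice_sets[OF S x])
      obtain v where v: "v \<in> V" "AE w\<in>Pair x -` E in M. w \<in> A \<and> x w = v w"
        using iS[OF x Ex] by auto
      have "restr v A \<in> S" unfolding V(1) cond_set_def using v(1) by auto
      then have "restr v A \<in> cond_set M W (B \<inter> A)" using le r unfolding cond_le_def by blast
      then obtain u where u: "u \<in> W" "AE w in M. restr v A w = restr u (B \<inter> A) w"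
        unfolding cond_set_def by blast
      have "AE w\<in>Pair x -` E in M. w \<in> B \<and> x w = u w"
        using u(2) v(2) by eventually_elim (auto simp: restr_def split: if_splits)
      then have "AE w\<in>Pair x -` E in M. (x, w) \<in> F" using iT[OF x Ex] u(1) by blast
      then show "AE w in M. (x, w) \<in> E \<longrightarrow> (x, w) \<in> F" by simp
    qed
  next
    assume le: "\<forall>x\<in>X. AE w in M. (x, w) \<in> E \<longrightarrow> (x, w) \<in> F"
    have *: "\<exists>u\<in>W. AE w\<in>A in M. w \<in> B \<and> v w = u w" if v: "v \<in> V" for v
    proof -
      have "AE w\<in>A in M. w \<in> A \<and> v w = v w" by auto
      then have "AE w\<in>A in M. (v, w) \<in> E" using iS[of v A] v V by blast
      moreover have "AE w in M. (v, w) \<in> E \<longrightarrow> (v, w) \<in> F" using le v V by blast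
      ultimately have "AE w\<in>A in M. (v, w) \<in> F" by eventually_elim auto
      then show ?thesis using iT[of v A] v V by blast
    qed
    obtain v0 where "v0 \<in> V" using stable_nonempty[OF V(3)] by blast
    from *[OF this] obtain u0 where "AE w\<in>A in M. w \<in> B \<and> v0 w = u0 w" by blast
    with dA dB have 1: "AE w\<in>cond_dom M S in M. w \<in> cond_dom M T" by eventually_elim auto
    have 2: "S \<subseteq> cond_set M W (B \<inter> A)"
    proof
      fix p assume "p \<in> S"
      then obtain v where v: "v \<in> V" "AE w in M. p w = restr v A w" unfolding V(1) cond_set_def by blast
      from *[OF v(1)] obtain u where u: "u \<in> W" "AE w\<in>A in M. w \<in> B \<and> v w = u w" by blast
      have "AE w in M. p w = restr u (B \<inter> A) w"
        using v(2) u(2) by eventually_elim (auto simp: restr_def)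
      with u(1) show "p \<in> cond_set M W (B \<inter> A)" unfolding cond_set_def by blast
    qed
    show "cond_le M S T" unfolding cond_le_def r using 1 2 by blast
  qed
qed

lemma cond_le_antisym:
  assumes S: "S \<in> cond_Pow M X" and T: "T \<in> cond_Pow M X" and "cond_le M S T" "cond_le M T S"
  shows "S = T"
proof -
  have "U \<subseteq> U'" if U: "U \<in> cond_Pow M X" "U' \<in> cond_Pow M X" and le: "cond_le M U U'" "cond_le M U' U" for U U'
  proof -
    obtain V A where V: "U = cond_set M V A" "V \<subseteq> X" "stable M V" "A \<in> sets M"
      using U(1) by (auto elim: cond_PowE)
    obtain W B where W: "U' = cond_set M W B" "W \<subseteq> X" "stable M W" "B \<in> sets M"
      using U(2) by (auto elim: cond_PowE)
    have dB: "AE w in M. w \<in> cond_dom M U' \<longleftrightarrow> w \<in> B"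
      unfolding W(1) by (rule cond_dom_cond_set[OF stable_nonempty[OF W(3)] W(4)])
    have "AE w\<in>cond_dom M U in M. w \<in> cond_dom M U'" "AE w\<in>cond_dom M U' in M. w \<in> cond_dom M U"
      using le unfolding cond_le_def by auto
    with dB have "AE w in M. w \<in> B \<inter> cond_dom M U \<longleftrightarrow> w \<in> B" by eventually_elim auto
    then have "cond_restr M U' (cond_dom M U) = U'"
      unfolding W(1) cond_restr_cond_set by (rule cond_set_AE_cong)
    then show ?thesis using le(1) unfolding cond_le_def by simp
  qed
  from this[OF S T assms(3,4)] this[OF T S assms(4,3)] show ?thesis by blast
qed

text \<open>Equal graphs give inequalities both ways, and the order is antisymmetric. From here on,
  equations between conditional sets are proved by exhibiting a common graph, and the
  \<open>THE\<close> in \<open>graph_measure\<close> is meaningful.\<close>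

lemma represents_unique:
  assumes X: "stable M X" and S: "represents M X S E" and T: "represents M X T E"
  shows "S = T"
  using S T cond_le_iff[OF X S T] cond_le_iff[OF X T S]
  by (intro cond_le_antisym[of S X T]) (auto simp: represents_def)

end

section \<open>Boolean operations of conditional sets as set operations on graphs\<close>

context complete_prob_space
begin

lemma stable_graph_sigma_algebra:
  assumes X: "stable M X"
  shows "sigma_algebra (X \<times> space M) {E. stable_graph M X E}"
  unfolding sigma_algebra_iff2
proof (intro conjI allI ballI impI)
  show "{E. stable_graph M X E} \<subseteq> Pow (X \<times> space M)" unfolding stable_graph_def by blast
  show "{} \<in> {E. stable_graph M X E}" unfolding stable_graph_def by auto
  show "X \<times> space M - E \<in> {E. stable_graph M X E}" if "E \<in> {E. stable_graph M X E}" for E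
    unfolding mem_Collect_eq stable_graph_def
  proof (intro conjI ballI allI impI)
    have E: "stable_graph M X E" using that by auto
    fix x assume "x \<in> X"
    moreover have "Pair x -` (X \<times> space M - E) = space M - Pair x -` E" using \<open>x \<in> X\<close> by auto
    ultimately show "Pair x -` (X \<times> space M - E) \<in> sets M"
      using E unfolding stable_graph_def by auto
  next
    have E: "stable_graph M X E" using that by auto
    fix A x y assume a: "partition_of M A" "range x \<subseteq> X" "is_concat M A x y"
    show "AE w in M. \<forall>k. w \<in> A k \<longrightarrow> ((y, w) \<in> X \<times> space M - E \<longleftrightarrow> (x k, w) \<in> X \<times> space M - E)"
      using stable_graph_concat[OF E a] by eventually_elim (use a(2) stable_concat[OF X a] in auto)
  qed auto
  show "(\<Union>i. E i) \<in> {E. stable_graph M X E}" if "range E \<subseteq> {E. stable_graph M X E}" for E :: "nat \<Rightarrow> _"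
    unfolding mem_Collect_eq stable_graph_def
  proof (intro conjI ballI allI impI)
    have E: "stable_graph M X (E i)" for i using that by auto
    show "(\<Union>i. E i) \<subseteq> X \<times> space M" using E unfolding stable_graph_def by blast
    fix x assume "x \<in> X"
    then have "(\<Union>i. Pair x -` E i) \<in> sets M" using E unfolding stable_graph_def by (intro sets.countable_UN) auto
    then show "Pair x -` (\<Union>i. E i) \<in> sets M" by (simp add: vimage_UN)
  next
    have E: "stable_graph M X (E i)" for i using that by auto
    fix A x y assume a: "partition_of M A" "range x \<subseteq> X" "is_concat M A x y"
    have "AE w in M. \<forall>i. \<forall>k. w \<in> A k \<longrightarrow> ((y, w) \<in> E i \<longleftrightarrow> (x k, w) \<in> E i)"
      by (subst AE_all_countable) (intro allI stable_graph_concat[OF E a])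
    then show "AE w in M. \<forall>k. w \<in> A k \<longrightarrow> ((y, w) \<in> (\<Union>i. E i) \<longleftrightarrow> (x k, w) \<in> (\<Union>i. E i))"
      by eventually_elim auto
  qed
qed

end

locale stable_space = complete_prob_space M for M :: "'w measure" +
  fixes X :: "('w \<Rightarrow> 'e) set"
  assumes X: "stable M X"
begin

sublocale graphs: sigma_algebra "X \<times> space M" "{E. stable_graph M X E}"
  by (rule stable_graph_sigma_algebra[OF X])

lemma represents_cond_set_top:
  assumes "A \<in> sets M"
  shows "represents M X (cond_set M X A) (X \<times> A)"
proof (rule representsI)
  fix x v B assume "x \<in> X" "AE w\<in>B in M. w \<in> A \<and> x w = v w"
  then show "AE w\<in>B in M. (x, w) \<in> X \<times> A" by auto
next
  fix x assume x: "x \<in> X"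
  then have "Pair x -` (X \<times> A) = A" by auto
  with assms show "Pair x -` (X \<times> A) \<in> sets M" by simp
qed (use assms X sets.sets_into_space in auto)

lemma represents_top: "represents M X (cond_top M X) (X \<times> space M)"
  unfolding cond_top_def by (rule represents_cond_set_top) auto

lemma represents_bot: "represents M X (cond_bot M) {}"
proof -
  have "cond_bot M = cond_set M X {}"
    using stable_nonempty[OF X] unfolding cond_bot_def cond_set_def restr_def by auto
  then show ?thesis using represents_cond_set_top[of "{}"] by simp
qed

lemma stable_graph_of: "represents M X S E \<Longrightarrow> stable_graph M X E"
  by (rule represents_stable_graph[OF X])

lemma represents_ex: "stable_graph M X E \<Longrightarrow> \<exists>S. represents M X S E"
  using represents_exists[OF X] by blast

lemma represents_in_cond_Pow: "represents M X S E \<Longrightarrow> S \<in> cond_Pow M X"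
  unfolding represents_def by blast

text \<open>The union of the graphs is again a stable graph, hence represents some \<open>T\<close>;
  \<open>cond_le_iff\<close> makes \<open>T\<close> the least upper bound, as for each
  \<open>x\<close> only countably many null sets have to be united. The index set \<open>I\<close>
  covers both sequences and the finite families of elementary functions.\<close>

lemma represents_cond_Sup:
  fixes S :: "nat \<Rightarrow> _"
  assumes S: "\<And>k. k \<in> I \<Longrightarrow> represents M X (S k) (E k)"
  shows "represents M X (cond_Sup M X (S ` I)) (\<Union>k\<in>I. E k)"
proof -
  have "(\<Union>k\<in>I. E k) \<in> {E. stable_graph M X E}"
    using S stable_graph_of by (intro graphs.countable_UN') auto
  then obtain T where T: "represents M X T (\<Union>k\<in>I. E k)" using represents_ex by blast
  have up: "cond_le M (S k) T" if "k \<in> I" for k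
    unfolding cond_le_iff[OF X S[OF that] T] using that by auto
  have least: "cond_le M T U" if U: "U \<in> cond_Pow M X" "\<And>k. k \<in> I \<Longrightarrow> cond_le M (S k) U" for U
    unfolding cond_le_iff[OF X T represents_event_graph[OF U(1)]]
  proof
    fix x assume x: "x \<in> X"
    have "AE w in M. (x, w) \<in> E k \<longrightarrow> (x, w) \<in> event_graph M X U" if "k \<in> I" for k
      using U(2)[OF that] cond_le_iff[OF X S[OF that] represents_event_graph[OF U(1)]] x by blast
    then have "AE w in M. \<forall>k\<in>I. (x, w) \<in> E k \<longrightarrow> (x, w) \<in> event_graph M X U"
      by (subst AE_ball_countable) auto
    then show "AE w in M. (x, w) \<in> (\<Union>k\<in>I. E k) \<longrightarrow> (x, w) \<in> event_graph M X U"
      by eventually_elim auto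
  qed
  have "cond_Sup M X (S ` I) = T"
    unfolding cond_Sup_def
  proof (rule the_equality)
    fix T' assume T': "T' \<in> cond_Pow M X \<and> (\<forall>S\<in>S ` I. cond_le M S T') \<and>
      (\<forall>U\<in>cond_Pow M X. (\<forall>S\<in>S ` I. cond_le M S U) \<longrightarrow> cond_le M T' U)"
    then show "T' = T" using up least represents_in_cond_Pow[OF T] by (intro cond_le_antisym[of T' X T]) auto
  qed (use up least represents_in_cond_Pow[OF T] in auto)
  with T show ?thesis by simp
qed

lemma represents_cond_Sup_pair:
  assumes "represents M X S E" "represents M X T F"
  shows "represents M X (cond_Sup M X {S, T}) (E \<union> F)"
  using represents_cond_Sup[of "{0, 1}" "\<lambda>k. if k = 0 then S else T" "\<lambda>k. if k = 0 then E else F"] assms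
  by (auto simp: insert_commute Un_commute)

lemma represents_cond_Inf_pair:
  assumes S: "represents M X S E" and T: "represents M X T F"
  shows "represents M X (cond_Inf M X {S, T}) (E \<inter> F)"
proof -
  have "E \<inter> F \<in> {E. stable_graph M X E}"
    using S T stable_graph_of by (intro graphs.Int) auto
  then obtain U where U: "represents M X U (E \<inter> F)" using represents_ex by blast
  have low: "cond_le M U S" "cond_le M U T"
    unfolding cond_le_iff[OF X U S] cond_le_iff[OF X U T] by auto
  have great: "cond_le M R U" if R: "R \<in> cond_Pow M X" "cond_le M R S" "cond_le M R T" for R
    unfolding cond_le_iff[OF X represents_event_graph[OF R(1)] U]
  proof
    fix x assume x: "x \<in> X"
    have "AE w in M. (x, w) \<in> event_graph M X R \<longrightarrow> (x, w) \<in> E"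
      "AE w in M. (x, w) \<in> event_graph M X R \<longrightarrow> (x, w) \<in> F"
      using R(2,3) x unfolding cond_le_iff[OF X represents_event_graph[OF R(1)] S]
        cond_le_iff[OF X represents_event_graph[OF R(1)] T] by blast+
    then show "AE w in M. (x, w) \<in> event_graph M X R \<longrightarrow> (x, w) \<in> E \<inter> F"
      by eventually_elim auto
  qed
  have "cond_Inf M X {S, T} = U"
    unfolding cond_Inf_def
  proof (rule the_equality)
    fix U' assume U': "U' \<in> cond_Pow M X \<and> (\<forall>S\<in>{S, T}. cond_le M U' S) \<and>
      (\<forall>R\<in>cond_Pow M X. (\<forall>S\<in>{S, T}. cond_le M R S) \<longrightarrow> cond_le M R U')"
    then show "U' = U" using low great represents_in_cond_Pow[OF U] by (intro cond_le_antisym[of U' X U]) auto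
  qed (use low great represents_in_cond_Pow[OF U] in auto)
  with U show ?thesis by simp
qed

text \<open>For the uniqueness in \<open>THE\<close>: if \<open>U\<close> meets \<open>S\<close> in
  bottom and joins with it to top, then over every \<open>x\<close> its slice is almost surely the
  complement of the slice of \<open>E\<close>, so \<open>U\<close> has the same graph as
  \<open>T\<close>.\<close>

lemma represents_cond_compl:
  assumes S: "represents M X S E"
  shows "represents M X (cond_compl M X S) (X \<times> space M - E)"
proof -
  have E: "E \<subseteq> X \<times> space M" using S unfolding represents_def by blast
  have "X \<times> space M - E \<in> {E. stable_graph M X E}"
    using S stable_graph_of by (intro graphs.compl_sets) auto
  then obtain T where T: "represents M X T (X \<times> space M - E)" using represents_ex by blast
  have 1: "cond_Inf M X {S, T} = cond_bot M"
    using represents_cond_Inf_pair[OF S T] by (intro represents_unique[OF X _ represents_bot]) (simp add: Diff_Int_distrib)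
  have 2: "cond_Sup M X {S, T} = cond_top M X"
    using represents_cond_Sup_pair[OF S T] E
    by (intro represents_unique[OF X _ represents_top]) (simp add: Un_absorb1)
  have "cond_compl M X S = T"
    unfolding cond_compl_def
  proof (rule the_equality)
    fix U assume U: "U \<in> cond_Pow M X \<and> cond_Inf M X {S, U} = cond_bot M \<and> cond_Sup M X {S, U} = cond_top M X"
    let ?F = "event_graph M X U"
    have F: "represents M X U ?F" using U by (intro represents_event_graph) auto
    have i: "represents M X (cond_bot M) (E \<inter> ?F)" "represents M X (cond_top M X) (E \<union> ?F)"
      using U represents_cond_Inf_pair[OF S F] represents_cond_Sup_pair[OF S F] by simp_all
    have "represents M X U (X \<times> space M - E)"
    proof (rule represents_AE_cong[OF F])
      fix x assume x: "x \<in> X"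
      from represents_AE_eq[OF represents_bot i(1) x] represents_AE_eq[OF represents_top i(2) x] AE_space
      show "AE w in M. (x, w) \<in> X \<times> space M - E \<longleftrightarrow> (x, w) \<in> ?F"
        by eventually_elim (use x in auto)
    qed auto
    then show "U = T" using T by (rule represents_unique[OF X])
  qed (use 1 2 represents_in_cond_Pow[OF T] in auto)
  with T show ?thesis by simp
qed

lemma cond_disjoint_iff:
  assumes S: "represents M X S E" and T: "represents M X T F"
  shows "cond_disjoint M X S T \<longleftrightarrow> (\<forall>x\<in>X. AE w in M. (x, w) \<notin> E \<inter> F)"
proof
  assume "cond_disjoint M X S T"
  then have i: "represents M X (cond_bot M) (E \<inter> F)"
    using represents_cond_Inf_pair[OF S T] unfolding cond_disjoint_def by simp
  show "\<forall>x\<in>X. AE w in M. (x, w) \<notin> E \<inter> F"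
    using represents_AE_eq[OF represents_bot i] by auto
next
  assume "\<forall>x\<in>X. AE w in M. (x, w) \<notin> E \<inter> F"
  then have "represents M X (cond_Inf M X {S, T}) {}"
    by (intro represents_AE_cong[OF represents_cond_Inf_pair[OF S T]]) auto
  then show "cond_disjoint M X S T"
    unfolding cond_disjoint_def using represents_bot by (rule represents_unique[OF X])
qed

text \<open>Members of the concatenation are gluings of members of the \<open>V k\<close>, so above
  \<open>A k\<close> only the condition of \<open>E k\<close> remains.\<close>

lemma represents_cond_concat:
  assumes A: "partition_of M A" and S: "\<And>k. represents M X (S k) (E k)"
  shows "represents M X (cond_concat M A S) (\<Union>k. E k \<inter> X \<times> A k)"
proof -
  have "\<forall>k. \<exists>V B. S k = cond_set M V B \<and> V \<subseteq> X \<and> stable M V \<and> B \<in> sets M"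
    using S represents_in_cond_Pow by (metis cond_PowE)
  then obtain V B where VB: "\<And>k. S k = cond_set M (V k) (B k)" "\<And>k. V k \<subseteq> X" "\<And>k. stable M (V k)" "\<And>k. B k \<in> sets M"
    by metis
  let ?V = "{y. \<exists>x. (\<forall>k. x k \<in> V k) \<and> is_concat M A x y}" and ?B = "\<Union>k. A k \<inter> B k"
  note iff = represents_graph_iff[OF S[unfolded VB(1)] VB(3,4)]
  have eq: "cond_concat M A S = cond_set M ?V ?B"
    using cond_concat_cond_set[OF A, of V B] VB(1) by presburger
  have disj: "i = j" if "w \<in> A i" "w \<in> A j" for i j w by (rule partition_unique[OF A that])
  show ?thesis
    unfolding eq
  proof (rule representsI)
    show "?V \<subseteq> X"
    proof
      fix y assume "y \<in> ?V"
      then obtain x where x: "\<And>k. x k \<in> V k" "is_concat M A x y" by blast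
      show "y \<in> X" by (rule stable_concat[OF X A _ x(2)]) (use x(1) VB(2) in blast)
    qed
    show "stable M ?V"
      unfolding stable_def
    proof (intro conjI allI impI)
      have "\<forall>k. \<exists>v. v \<in> V k" using stable_nonempty[OF VB(3)] by blast
      then obtain v where v: "\<And>k. v k \<in> V k" by metis
      obtain y where "\<And>k w. w \<in> A k \<Longrightarrow> y w = v k w" using concat_exists[OF A] by blast
      then have "y \<in> ?V" using v by (auto simp: is_concat_def)
      then show "?V \<noteq> {}" by blast
      fix C z y assume C: "partition_of M C" and z: "range z \<subseteq> ?V" and y: "is_concat M C z y"
      have "\<forall>j. \<exists>x. (\<forall>k. x k \<in> V k) \<and> is_concat M A x (z j)" using z by blast
      then obtain x where x: "\<And>j k. x j k \<in> V k" "\<And>j. is_concat M A (x j) (z j)" by metis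
      \<comment> \<open>The order of two gluings is exchanged: for fixed \<open>k\<close> the
        components \<open>x j k\<close> are glued along \<open>C\<close> first, which stays in
        \<open>V k\<close>; the results are then glued along \<open>A\<close>.\<close>
      have "\<exists>u. \<forall>j w. w \<in> C j \<longrightarrow> u w = x j k w" for k
        by (rule concat_exists[OF C, of "\<lambda>j. x j k"]) blast
      then obtain u where u: "\<And>k j w. w \<in> C j \<Longrightarrow> u k w = x j k w" by metis
      have "u k \<in> V k" for k
        by (rule stable_concat[OF VB(3) C, of "\<lambda>j. x j k"]) (use x(1) u in \<open>auto simp: is_concat_def\<close>)
      moreover have "AE w in M. \<forall>j k. w \<in> A k \<longrightarrow> z j w = x j k w"
        using x(2) unfolding is_concat_def by (simp add: AE_all_countable)
      then have "is_concat M A u y"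
        using y AE_space unfolding is_concat_def
      proof eventually_elim
        case (elim w)
        then obtain j where "w \<in> C j" using partition_cover[OF C] by blast
        show ?case
        proof (intro allI impI)
          fix k assume "w \<in> A k"
          then have "z j w = x j k w" using elim(1) by blast
          moreover have "y w = z j w" using elim(2) \<open>w \<in> C j\<close> by blast
          ultimately show "y w = u k w" using u[OF \<open>w \<in> C j\<close>] by simp
        qed
      qed
      ultimately show "y \<in> ?V" by blast
    qed
    show Bs: "?B \<in> sets M" using VB(4) partition_sets[OF A] by (intro sets.countable_UN) auto
    show "(\<Union>k. E k \<inter> X \<times> A k) \<subseteq> X \<times> space M"
      using S unfolding represents_def by blast
    fix x assume x: "x \<in> X"
    have Ek: "Pair x -` E k \<inter> A k \<in> sets M" for k
      using slice_sets[OF S x] partition_sets[OF A] by auto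
    have sl: "Pair x -` (\<Union>k. E k \<inter> X \<times> A k) = (\<Union>k. Pair x -` E k \<inter> A k)" using x by auto
    show "Pair x -` (\<Union>k. E k \<inter> X \<times> A k) \<in> sets M" unfolding sl using Ek by (intro sets.countable_UN) auto
    have "\<exists>v\<in>V k. AE w in M. w \<in> Pair x -` E k \<inter> A k \<longrightarrow> w \<in> B k \<and> x w = v w" for k
      by (subst iff[symmetric, OF x Ek]) auto
    then obtain v where v: "\<And>k. v k \<in> V k" "\<And>k. AE w in M. w \<in> Pair x -` E k \<inter> A k \<longrightarrow> w \<in> B k \<and> x w = v k w"
      by metis
    have vv: "AE w in M. \<forall>k. w \<in> Pair x -` E k \<inter> A k \<longrightarrow> w \<in> B k \<and> x w = v k w"
      using v(2) by (simp add: AE_all_countable)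
    obtain y where y: "\<And>k w. w \<in> A k \<Longrightarrow> y w = v k w" using concat_exists[OF A] by blast
    have "y \<in> ?V" using v(1) y by (auto simp: is_concat_def)
    moreover have "AE w in M. (x, w) \<in> (\<Union>k. E k \<inter> X \<times> A k) \<longrightarrow> w \<in> ?B \<and> x w = y w"
      using vv by eventually_elim (use y in auto)
    ultimately show "\<exists>v\<in>?V. AE w in M. (x, w) \<in> (\<Union>k. E k \<inter> X \<times> A k) \<longrightarrow> w \<in> ?B \<and> x w = v w" by blast
    fix z D assume z: "z \<in> ?V" and D: "D \<in> sets M" "AE w\<in>D in M. w \<in> ?B \<and> x w = z w"
    obtain u where u: "\<And>k. u k \<in> V k" "is_concat M A u z" using z by blast
    have "AE w in M. w \<in> D \<inter> A k \<longrightarrow> (x, w) \<in> E k" for k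
    proof (subst iff[OF x])
      show "D \<inter> A k \<in> sets M" using D partition_sets[OF A] by auto
      have "AE w in M. w \<in> D \<inter> A k \<longrightarrow> w \<in> B k \<and> x w = u k w"
        using D(2) u(2)[unfolded is_concat_def] by eventually_elim (use disj in auto)
      then show "\<exists>v\<in>V k. AE w in M. w \<in> D \<inter> A k \<longrightarrow> w \<in> B k \<and> x w = v w" using u(1) by blast
    qed
    then have "AE w in M. \<forall>k. w \<in> D \<inter> A k \<longrightarrow> (x, w) \<in> E k" by (simp add: AE_all_countable)
    with D(2) show "AE w\<in>D in M. (x, w) \<in> (\<Union>k. E k \<inter> X \<times> A k)"
      by eventually_elim (use x in auto)
  qed
qed

end

subsection \<open>Stable \<open>\<sigma>\<close>-algebras\<close>

definition graph_algebra ::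
  "'w measure \<Rightarrow> ('w \<Rightarrow> 'e) set \<Rightarrow> ('w \<Rightarrow> 'e option) set set \<Rightarrow> (('w \<Rightarrow> 'e) \<times> 'w) set set" where
  "graph_algebra M X \<X> = {E. \<exists>S\<in>\<X>. represents M X S E}"

context stable_space
begin

text \<open>The converse passage, used to bound generated stable \<sigma>-algebras from above in
  good-sets arguments. Complements and countable suprema come from the set operations; closure under
  concatenation comes from the cylinders over the events of a partition.\<close>

lemma stable_sigma_algebra_represented:
  assumes S: "sigma_algebra (X \<times> space M) \<S>" and g: "\<And>E. E \<in> \<S> \<Longrightarrow> stable_graph M X E"
    and c: "\<And>A. A \<in> sets M \<Longrightarrow> X \<times> A \<in> \<S>"
  shows "stable_sigma_algebra M X {S. \<exists>E\<in>\<S>. represents M X S E}" (is "stable_sigma_algebra M X ?\<X>")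
  unfolding stable_sigma_algebra_def stable_collection_def
proof (intro conjI allI impI ballI)
  interpret S: sigma_algebra "X \<times> space M" \<S> by (rule S)
  show top: "cond_top M X \<in> ?\<X>" using represents_top c[OF sets.top] by blast
  then show "?\<X> \<noteq> {}" by blast
  show "?\<X> \<subseteq> cond_Pow M X" using represents_in_cond_Pow by blast
  show "cond_compl M X S \<in> ?\<X>" if "S \<in> ?\<X>" for S
    using that represents_cond_compl S.compl_sets by blast
  show "cond_Sup M X (range S) \<in> ?\<X>" if "range S \<subseteq> ?\<X>" for S :: "nat \<Rightarrow> _"
  proof -
    have "\<forall>k. \<exists>E. E \<in> \<S> \<and> represents M X (S k) E" using that by blast
    then obtain E where E: "\<And>k. E k \<in> \<S>" "\<And>k. represents M X (S k) (E k)" by metis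
    have "(\<Union>k. E k) \<in> \<S>" using E(1) by auto
    then show ?thesis using represents_cond_Sup[of UNIV S E] E(2) by blast
  qed
  show "cond_concat M A S \<in> ?\<X>" if "partition_of M A" "range S \<subseteq> ?\<X>" for A S
  proof -
    have "\<forall>k. \<exists>E. E \<in> \<S> \<and> represents M X (S k) E" using that by blast
    then obtain E where E: "\<And>k. E k \<in> \<S>" "\<And>k. represents M X (S k) (E k)" by metis
    have "(\<Union>k. E k \<inter> X \<times> A k) \<in> \<S>"
      using E(1) c partition_sets[OF that(1)] by (intro S.countable_UN) auto
    then show ?thesis using represents_cond_concat[OF that(1), of S E] E(2) by blast
  qed
qed

end

locale stable_algebra = stable_space M X for M :: "'w measure" and X :: "('w \<Rightarrow> 'e) set" +
  fixes \<X> :: "('w \<Rightarrow> 'e option) set set"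
  assumes \<X>: "stable_sigma_algebra M X \<X>"
begin

lemma in_cond_Pow: "S \<in> \<X> \<Longrightarrow> S \<in> cond_Pow M X"
  using \<X> unfolding stable_sigma_algebra_def stable_collection_def by blast

lemma compl_in: "S \<in> \<X> \<Longrightarrow> cond_compl M X S \<in> \<X>"
  and Sup_in: "range (T :: nat \<Rightarrow> _) \<subseteq> \<X> \<Longrightarrow> cond_Sup M X (range T) \<in> \<X>"
  and top_in: "cond_top M X \<in> \<X>"
  and concat_in: "partition_of M A \<Longrightarrow> range T \<subseteq> \<X> \<Longrightarrow> cond_concat M A T \<in> \<X>"
  using \<X> unfolding stable_sigma_algebra_def stable_collection_def by blast+

lemma bot_in: "cond_bot M \<in> \<X>"
proof -
  have "cond_compl M X (cond_top M X) = cond_bot M"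
    using represents_cond_compl[OF represents_top] by (intro represents_unique[OF X _ represents_bot]) simp
  with compl_in[OF top_in] show ?thesis by simp
qed

lemma graph_algebraD: "E \<in> graph_algebra M X \<X> \<Longrightarrow> \<exists>S\<in>\<X>. represents M X S E"
  unfolding graph_algebra_def by blast

lemma graph_algebraI: "S \<in> \<X> \<Longrightarrow> represents M X S E \<Longrightarrow> E \<in> graph_algebra M X \<X>"
  unfolding graph_algebra_def by blast

lemma graph_algebra_represents_in: "E \<in> graph_algebra M X \<X> \<Longrightarrow> represents M X S E \<Longrightarrow> S \<in> \<X>"
  using represents_unique[OF X] unfolding graph_algebra_def by blast

lemma graph_algebra_stable_graph: "E \<in> graph_algebra M X \<X> \<Longrightarrow> stable_graph M X E"
  using stable_graph_of unfolding graph_algebra_def by blast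

lemma graph_algebra_subset: "graph_algebra M X \<X> \<subseteq> Pow (X \<times> space M)"
  unfolding graph_algebra_def represents_def by blast

lemma sigma_algebra_graph_algebra: "sigma_algebra (X \<times> space M) (graph_algebra M X \<X>)"
  unfolding sigma_algebra_iff2
proof (intro conjI allI ballI impI)
  show "{} \<in> graph_algebra M X \<X>" by (rule graph_algebraI[OF bot_in represents_bot])
  show "X \<times> space M - E \<in> graph_algebra M X \<X>" if "E \<in> graph_algebra M X \<X>" for E
    using graph_algebraD[OF that] graph_algebraI[OF compl_in represents_cond_compl] by blast
  show "(\<Union>i. E i) \<in> graph_algebra M X \<X>" if "range E \<subseteq> graph_algebra M X \<X>" for E :: "nat \<Rightarrow> _"
  proof -
    have "\<forall>i. \<exists>S. S \<in> \<X> \<and> represents M X S (E i)" using that graph_algebraD by blast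
    then obtain S where S: "\<And>i. S i \<in> \<X>" "\<And>i. represents M X (S i) (E i)" by metis
    show ?thesis using S by (intro graph_algebraI[OF Sup_in[of S]] represents_cond_Sup) auto
  qed
qed (rule graph_algebra_subset)

text \<open>The cylinder is the graph of the concatenation of top on \<open>A\<close> with bottom
  off \<open>A\<close>. In this form closure under concatenation survives in the graph
  algebra.\<close>

lemma graph_algebra_cylinder:
  assumes A: "A \<in> sets M"
  shows "X \<times> A \<in> graph_algebra M X \<X>"
proof -
  let ?S = "\<lambda>k::nat. if k = 0 then cond_top M X else cond_bot M"
  let ?E = "\<lambda>k::nat. if k = 0 then X \<times> space M else {}"
  have "represents M X (cond_concat M (two_part M A) ?S) (\<Union>k. ?E k \<inter> X \<times> two_part M A k)"
    using represents_top represents_bot by (intro represents_cond_concat partition_two_part A) auto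
  also have "(\<Union>k. ?E k \<inter> X \<times> two_part M A k) = X \<times> A"
    using sets.sets_into_space[OF A] by (auto simp: two_part_def split: if_splits)
  finally show ?thesis
    using top_in bot_in by (intro graph_algebraI[OF concat_in[OF partition_two_part[OF A]]]) auto
qed

lemma graph_algebra_AE_cong:
  assumes "E \<in> graph_algebra M X \<X>" "F \<subseteq> X \<times> space M" "\<And>x. x \<in> X \<Longrightarrow> AE w in M. (x, w) \<in> F \<longleftrightarrow> (x, w) \<in> E"
  shows "F \<in> graph_algebra M X \<X>"
  using assms represents_AE_cong unfolding graph_algebra_def by blast

lemma graph_algebra_null:
  assumes "E \<subseteq> X \<times> space M" "\<And>x. x \<in> X \<Longrightarrow> AE w in M. (x, w) \<notin> E"
  shows "E \<in> graph_algebra M X \<X>"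
  by (rule graph_algebra_AE_cong[OF graph_algebraI[OF bot_in represents_bot]]) (use assms in auto)

end

subsection \<open>Conditional integrals\<close>

text \<open>\<open>X\<close> is here a mere set of labels, so that the same integration theory
  applies to both factors and to their product. \<open>null_in_sets\<close> speaks of slices over
  each label separately.\<close>

locale fibred_algebra = complete_prob_space M for M :: "'w measure" +
  fixes X :: "'x set" and m :: "('x \<times> 'w) measure"
  assumes space_m: "space m = X \<times> space M"
    and slice: "E \<in> sets m \<Longrightarrow> x \<in> X \<Longrightarrow> Pair x -` E \<in> sets M"
    and null_in_sets: "E \<subseteq> X \<times> space M \<Longrightarrow> (\<And>x. x \<in> X \<Longrightarrow> AE w in M. (x, w) \<notin> E) \<Longrightarrow> E \<in> sets m"
    and cylinder: "A \<in> sets M \<Longrightarrow> X \<times> A \<in> sets m"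
begin

lemma snd_measurable[measurable]: "snd \<in> measurable m M"
proof (rule measurableI)
  fix A assume A: "A \<in> sets M"
  have "snd -` A \<inter> space m = X \<times> A" using sets.sets_into_space[OF A] by (auto simp: space_m)
  then show "snd -` A \<inter> space m \<in> sets m" using cylinder[OF A] by simp
qed (auto simp: space_m)

lemma Pair_measurable: "x \<in> X \<Longrightarrow> Pair x \<in> measurable M m"
proof (rule measurableI)
  fix E assume E: "E \<in> sets m" and x: "x \<in> X"
  have "Pair x -` E \<inter> space M = Pair x -` E" using sets.sets_into_space[OF slice[OF E x]] by auto
  then show "Pair x -` E \<inter> space M \<in> sets M" using slice[OF E x] by simp
qed (auto simp: space_m)

lemma section_measurable: "f \<in> measurable m N \<Longrightarrow> x \<in> X \<Longrightarrow> (\<lambda>w. f (x, w)) \<in> measurable M N"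
  using measurable_compose[OF Pair_measurable] .

lemma AE_cong_sets:
  assumes "E \<in> sets m" "F \<subseteq> X \<times> space M" "\<And>x. x \<in> X \<Longrightarrow> AE w in M. (x, w) \<in> F \<longleftrightarrow> (x, w) \<in> E"
  shows "F \<in> sets m"
proof -
  have "F - E \<in> sets m" "E - F \<in> sets m"
    using assms(2) sets.sets_into_space[OF assms(1)]
    by (intro null_in_sets; use assms(3) in \<open>force simp: space_m elim: eventually_mono\<close>)+
  then have "E \<union> (F - E) - (E - F) \<in> sets m" using assms(1) by (intro sets.Diff[OF sets.Un])
  also have "E \<union> (F - E) - (E - F) = F" by auto
  finally show ?thesis .
qed

text \<open>The tool that makes arbitrary choices harmless: if \<open>g\<close> comes from picking a
  version for each \<open>x\<close>, it suffices to find one measurable \<open>f\<close> agreeing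
  with it almost surely over every \<open>x\<close>.\<close>

lemma AE_cong_measurable:
  assumes f: "f \<in> measurable m N" and g: "\<And>x. x \<in> X \<Longrightarrow> AE w in M. g (x, w) = f (x, w)"
    and sp: "g \<in> space m \<rightarrow> space N"
  shows "g \<in> measurable m N"
proof (rule measurableI)
  fix A assume A: "A \<in> sets N"
  show "g -` A \<inter> space m \<in> sets m"
  proof (rule AE_cong_sets[OF measurable_sets[OF f A]])
    fix x assume x: "x \<in> X"
    show "AE w in M. (x, w) \<in> g -` A \<inter> space m \<longleftrightarrow> (x, w) \<in> f -` A \<inter> space m"
      using g[OF x] by eventually_elim auto
  qed (auto simp: space_m)
qed (use sp in auto)

end

text \<open>The conditional expectation of a nonnegative \<open>g\<close> given the projection to
  \<Omega>, written as a density. It may take the value \<infinity>, so no integrability of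
  \<open>g\<close> is built in.\<close>

definition cint :: "'w measure \<Rightarrow> ('x \<times> 'w) measure \<Rightarrow> ('x \<times> 'w \<Rightarrow> ennreal) \<Rightarrow> 'w \<Rightarrow> ennreal" where
  "cint M m g = RN_deriv M (distr (density m g) M snd)"

locale fibred_space = fibred_algebra M X m for M :: "'w measure" and X :: "'x set" and m +
  assumes emeasure_null: "E \<subseteq> X \<times> space M \<Longrightarrow> (\<And>x. x \<in> X \<Longrightarrow> AE w in M. (x, w) \<notin> E) \<Longrightarrow> emeasure m E = 0"
    and emeasure_cylinder: "A \<in> sets M \<Longrightarrow> emeasure m (X \<times> A) = emeasure M A"
begin

text \<open>The exceptional set has only null slices, so it is measurable and null although it
  collects null sets over uncountably many \<open>x\<close>.\<close>

lemma AE_fibres: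
  assumes "\<And>x. x \<in> X \<Longrightarrow> AE w in M. P (x, w)"
  shows "AE p in m. P p"
proof (rule AE_I)
  let ?N = "{p \<in> space m. \<not> P p}"
  have "AE w in M. (x, w) \<notin> ?N" if "x \<in> X" for x using assms[OF that] by eventually_elim auto
  then show "emeasure m ?N = 0" "?N \<in> sets m"
    by (intro emeasure_null null_in_sets; auto simp: space_m)+
qed auto

lemma distr_snd: "distr m M snd = M"
proof (rule measure_eqI)
  fix A assume "A \<in> sets (distr m M snd)"
  then have A: "A \<in> sets M" by simp
  have "snd -` A \<inter> space m = X \<times> A" using sets.sets_into_space[OF A] by (auto simp: space_m)
  then show "emeasure (distr m M snd) A = emeasure M A" using A by (simp add: emeasure_distr emeasure_cylinder)
qed simp

lemma borel_measurable_cint[measurable]: "cint M m g \<in> borel_measurable M"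
  unfolding cint_def by simp

text \<open>Existence of the density: a null set of \<Omega> has a null cylinder because the
  marginal of \<open>m\<close> is P, which gives absolute continuity for every nonnegative
  \<open>g\<close>.\<close>

lemma density_cint:
  assumes g[measurable]: "g \<in> borel_measurable m"
  shows "density M (cint M m g) = distr (density m g) M snd"
  unfolding cint_def
proof (rule density_RN_deriv)
  show "absolutely_continuous M (distr (density m g) M snd)"
    unfolding absolutely_continuous_def
  proof
    fix A assume A: "A \<in> null_sets M"
    then have As: "A \<in> sets M" by auto
    have eq: "snd -` A \<inter> space m = X \<times> A" using sets.sets_into_space[OF As] by (auto simp: space_m)
    have "X \<times> A \<in> null_sets m" using emeasure_cylinder[OF As] null_setsD1[OF A] by (intro null_setsI cylinder[OF As]) simp
    then have "AE p in m. p \<notin> X \<times> A" by (rule AE_not_in)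
    then have "AE p in m. g p * indicator (X \<times> A) p = 0" by eventually_elim simp
    from nn_integral_cong_AE[OF this] have "emeasure (density m g) (X \<times> A) = 0"
      using cylinder[OF As] by (simp add: emeasure_density)
    then show "A \<in> null_sets (distr (density m g) M snd)"
      using As by (auto simp: emeasure_distr eq)
  qed
qed simp

lemma nn_integral_cint:
  assumes g[measurable]: "g \<in> borel_measurable m" and u[measurable]: "u \<in> borel_measurable M"
  shows "(\<integral>\<^sup>+p. g p * u (snd p) \<partial>m) = (\<integral>\<^sup>+w. cint M m g w * u w \<partial>M)"
proof -
  have "(\<integral>\<^sup>+w. cint M m g w * u w \<partial>M) = (\<integral>\<^sup>+w. u w \<partial>density M (cint M m g))"
    by (subst nn_integral_density) auto
  also have "\<dots> = (\<integral>\<^sup>+p. u (snd p) \<partial>density m g)"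
    unfolding density_cint[OF g] by (subst nn_integral_distr) auto
  also have "\<dots> = (\<integral>\<^sup>+p. g p * u (snd p) \<partial>m)"
    by (subst nn_integral_density) auto
  finally show ?thesis by simp
qed

lemma nn_integral_eq_cint:
  "g \<in> borel_measurable m \<Longrightarrow> (\<integral>\<^sup>+p. g p \<partial>m) = (\<integral>\<^sup>+w. cint M m g w \<partial>M)"
  using nn_integral_cint[of g "\<lambda>_. 1"] by simp

text \<open>A density with respect to P is determined almost surely by its integrals over the
  events. The calculus of \<open>cint\<close> below is largely obtained by this test against
  indicators.\<close>

lemma cint_unique:
  assumes g[measurable]: "g \<in> borel_measurable m" and I[measurable]: "I \<in> borel_measurable M"
    and eq: "\<And>A. A \<in> sets M \<Longrightarrow> (\<integral>\<^sup>+p. g p * indicator A (snd p) \<partial>m) = (\<integral>\<^sup>+w. I w * indicator A w \<partial>M)"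
  shows "AE w in M. cint M m g w = I w"
proof (rule density_unique)
  show "density M (cint M m g) = density M I"
  proof (rule measure_eqI)
    fix A assume "A \<in> sets (density M (cint M m g))"
    then have A[measurable]: "A \<in> sets M" by simp
    show "emeasure (density M (cint M m g)) A = emeasure (density M I) A"
      using eq[OF A] nn_integral_cint[of g "indicator A"] by (simp add: emeasure_density)
  qed simp
qed auto

lemma cint_cong_AE:
  assumes [measurable]: "f \<in> borel_measurable m" "g \<in> borel_measurable m" and "AE p in m. f p = g p"
  shows "AE w in M. cint M m f w = cint M m g w"
proof (rule cint_unique)
  fix A assume [measurable]: "A \<in> sets M"
  have "(\<integral>\<^sup>+p. f p * indicator A (snd p) \<partial>m) = (\<integral>\<^sup>+p. g p * indicator A (snd p) \<partial>m)"
    using assms(3) by (intro nn_integral_cong_AE) auto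
  then show "(\<integral>\<^sup>+p. f p * indicator A (snd p) \<partial>m) = (\<integral>\<^sup>+w. cint M m g w * indicator A w \<partial>M)"
    by (simp add: nn_integral_cint)
qed auto

lemma cint_add:
  assumes [measurable]: "f \<in> borel_measurable m" "g \<in> borel_measurable m"
  shows "AE w in M. cint M m (\<lambda>p. f p + g p) w = cint M m f w + cint M m g w"
  by (rule cint_unique) (auto simp: distrib_right nn_integral_add nn_integral_cint)

lemma cint_mult:
  assumes [measurable]: "f \<in> borel_measurable m" "u \<in> borel_measurable M"
  shows "AE w in M. cint M m (\<lambda>p. u (snd p) * f p) w = u w * cint M m f w"
proof (rule cint_unique)
  fix A assume [measurable]: "A \<in> sets M"
  have "(\<integral>\<^sup>+p. f p * (u (snd p) * indicator A (snd p)) \<partial>m) = (\<integral>\<^sup>+w. cint M m f w * (u w * indicator A w) \<partial>M)"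
    by (rule nn_integral_cint) auto
  then show "(\<integral>\<^sup>+p. u (snd p) * f p * indicator A (snd p) \<partial>m) = (\<integral>\<^sup>+w. u w * cint M m f w * indicator A w \<partial>M)"
    by (simp add: ac_simps)
qed auto

lemma cint_mono:
  assumes [measurable]: "f \<in> borel_measurable m" "g \<in> borel_measurable m" and le: "AE p in m. f p \<le> g p"
  shows "AE w in M. cint M m f w \<le> cint M m g w"
proof -
  \<comment> \<open>Monotonicity is reduced to additivity; where \<open>f p\<close> is infinite both
    sides are infinite.\<close>
  have "AE p in m. g p = f p + (g p - f p)"
    using le by eventually_elim (auto simp: add_diff_inverse_ennreal)
  then have "AE w in M. cint M m g w = cint M m (\<lambda>p. f p + (g p - f p)) w" by (rule cint_cong_AE[rotated 2]) auto
  moreover have "AE w in M. cint M m (\<lambda>p. f p + (g p - f p)) w = cint M m f w + cint M m (\<lambda>p. g p - f p) w"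
    by (rule cint_add) auto
  ultimately show ?thesis by eventually_elim auto
qed

lemma cint_SUP:
  fixes f :: "nat \<Rightarrow> _"
  assumes [measurable]: "\<And>i. f i \<in> borel_measurable m" and inc: "\<And>i. AE p in m. f i p \<le> f (Suc i) p"
  shows "AE w in M. cint M m (\<lambda>p. SUP i. f i p) w = (SUP i. cint M m (f i) w)"
proof (rule cint_unique)
  fix A assume [measurable]: "A \<in> sets M"
  have "AE w in M. cint M m (f i) w \<le> cint M m (f (Suc i)) w" for i
    using inc by (intro cint_mono) auto
  then have inc': "AE w in M. cint M m (f i) w * indicator A w \<le> cint M m (f (Suc i)) w * indicator A w" for i
    by (rule eventually_mono) (rule mult_right_mono, auto)
  have inc2: "AE p in m. f i p * indicator A (snd p) \<le> f (Suc i) p * indicator A (snd p)" for i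
    using inc by (rule eventually_mono) (rule mult_right_mono, auto)
  have "(\<integral>\<^sup>+p. (SUP i. f i p) * indicator A (snd p) \<partial>m) = (\<integral>\<^sup>+p. (SUP i. f i p * indicator A (snd p)) \<partial>m)"
    by (simp add: SUP_mult_right_ennreal)
  also have "\<dots> = (SUP i. \<integral>\<^sup>+p. f i p * indicator A (snd p) \<partial>m)"
    by (rule nn_integral_monotone_convergence_SUP_AE)
      (use inc2 in auto)
  also have "\<dots> = (SUP i. \<integral>\<^sup>+w. cint M m (f i) w * indicator A w \<partial>M)"
    by (simp add: nn_integral_cint)
  also have "\<dots> = (\<integral>\<^sup>+w. (SUP i. cint M m (f i) w * indicator A w) \<partial>M)"
    by (rule nn_integral_monotone_convergence_SUP_AE[symmetric])
      (use inc' in auto)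
  also have "\<dots> = (\<integral>\<^sup>+w. (SUP i. cint M m (f i) w) * indicator A w \<partial>M)"
    by (simp add: SUP_mult_right_ennreal)
  finally show "(\<integral>\<^sup>+p. (SUP i. f i p) * indicator A (snd p) \<partial>m) = (\<integral>\<^sup>+w. (SUP i. cint M m (f i) w) * indicator A w \<partial>M)" .
qed auto

lemma cint_suminf:
  fixes f :: "nat \<Rightarrow> _"
  assumes [measurable]: "\<And>i. f i \<in> borel_measurable m"
  shows "AE w in M. cint M m (\<lambda>p. \<Sum>i. f i p) w = (\<Sum>i. cint M m (f i) w)"
proof (rule cint_unique)
  fix A assume [measurable]: "A \<in> sets M"
  have "(\<integral>\<^sup>+p. (\<Sum>i. f i p) * indicator A (snd p) \<partial>m) = (\<Sum>i. \<integral>\<^sup>+p. f i p * indicator A (snd p) \<partial>m)"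
    by (subst nn_integral_suminf[symmetric]) auto
  also have "\<dots> = (\<Sum>i. \<integral>\<^sup>+w. cint M m (f i) w * indicator A w \<partial>M)"
    by (simp add: nn_integral_cint)
  also have "\<dots> = (\<integral>\<^sup>+w. (\<Sum>i. cint M m (f i) w) * indicator A w \<partial>M)"
    by (subst nn_integral_suminf[symmetric]) auto
  finally show "(\<integral>\<^sup>+p. (\<Sum>i. f i p) * indicator A (snd p) \<partial>m) = (\<integral>\<^sup>+w. (\<Sum>i. cint M m (f i) w) * indicator A w \<partial>M)" .
qed auto

lemma cint_zero: "AE w in M. cint M m (\<lambda>_. 0) w = 0"
  by (rule cint_unique) auto

lemma cint_sum:
  assumes "finite I" and [measurable]: "\<And>i. i \<in> I \<Longrightarrow> f i \<in> borel_measurable m"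
  shows "AE w in M. cint M m (\<lambda>p. \<Sum>i\<in>I. f i p) w = (\<Sum>i\<in>I. cint M m (f i) w)"
  using assms
proof (induction I rule: finite_induct)
  case empty
  show ?case using cint_zero by simp
next
  case (insert i I)
  then have "AE w in M. cint M m (\<lambda>p. f i p + (\<Sum>i\<in>I. f i p)) w = cint M m (f i) w + cint M m (\<lambda>p. \<Sum>i\<in>I. f i p) w"
    by (intro cint_add) auto
  moreover have "AE w in M. cint M m (\<lambda>p. \<Sum>i\<in>I. f i p) w = (\<Sum>i\<in>I. cint M m (f i) w)" using insert by auto
  ultimately show ?case by eventually_elim (use insert in auto)
qed

lemma cint_base:
  assumes [measurable]: "u \<in> borel_measurable M"
  shows "AE w in M. cint M m (\<lambda>p. u (snd p)) w = u w"
proof (rule cint_unique)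
  fix A assume [measurable]: "A \<in> sets M"
  have "(\<integral>\<^sup>+p. u (snd p) * indicator A (snd p) \<partial>m) = (\<integral>\<^sup>+w. u w * indicator A w \<partial>distr m M snd)"
    by (subst nn_integral_distr) auto
  then show "(\<integral>\<^sup>+p. u (snd p) * indicator A (snd p) \<partial>m) = (\<integral>\<^sup>+w. u w * indicator A w \<partial>M)"
    by (simp add: distr_snd)
qed auto

text \<open>Localisation: on the event where the conditional integral is at most \<open>n\<close>,
  the total integral of \<open>g\<close> is at most \<open>n\<close> because P is a probability, so
  \<open>g\<close> is finite almost everywhere above it. These events exhaust \<Omega> almost
  surely.\<close>

lemma AE_finite_of_cint:
  assumes [measurable]: "g \<in> borel_measurable m" and fin: "AE w in M. cint M m g w < \<infinity>"
  shows "AE p in m. g p < \<infinity>"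
proof -
  let ?E = "\<lambda>n::nat. {w \<in> space M. cint M m g w \<le> of_nat n}"
  have "AE p in m. snd p \<in> ?E n \<longrightarrow> g p < \<infinity>" for n
  proof -
    have "(\<integral>\<^sup>+p. g p * indicator (?E n) (snd p) \<partial>m) = (\<integral>\<^sup>+w. cint M m g w * indicator (?E n) w \<partial>M)"
      by (rule nn_integral_cint) auto
    also have "\<dots> \<le> (\<integral>\<^sup>+w. of_nat n \<partial>M)"
      by (intro nn_integral_mono) (auto split: split_indicator)
    also have "\<dots> < \<infinity>" by (simp add: emeasure_space_1 of_nat_less_top)
    finally have "AE p in m. g p * indicator (?E n) (snd p) \<noteq> \<infinity>"
      by (intro nn_integral_noteq_infinite) auto
    then show ?thesis by eventually_elim (auto simp: less_top[symmetric])
  qed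
  then have "AE p in m. \<forall>n. snd p \<in> ?E n \<longrightarrow> g p < \<infinity>" by (subst AE_all_countable) blast
  moreover have "AE w in distr m M snd. cint M m g w < \<infinity>" unfolding distr_snd by (rule fin)
  then have "AE p in m. cint M m g (snd p) < \<infinity>" by (rule AE_distrD[rotated]) simp
  ultimately show ?thesis
    using AE_space
  proof eventually_elim
    case (elim p)
    obtain n :: nat where "cint M m g (snd p) < of_nat n"
      using elim(2) ennreal_Ex_less_of_nat by (auto simp: less_top)
    then have "snd p \<in> ?E n" using elim(3) by (auto simp: space_m)
    with elim(1) show ?case by blast
  qed
qed

end

subsection \<open>Stable measures as measures on \<open>X \<times> \<Omega>\<close>\<close>

definition graph_measure ::
  "'w measure \<Rightarrow> ('w \<Rightarrow> 'e) set \<Rightarrow> ('w \<Rightarrow> 'e option) set set \<Rightarrow>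
   (('w \<Rightarrow> 'e option) set \<Rightarrow> 'w \<Rightarrow> ennreal) \<Rightarrow> (('w \<Rightarrow> 'e) \<times> 'w) measure" where
  "graph_measure M X \<X> \<mu> = measure_of (X \<times> space M) (graph_algebra M X \<X>)
     (\<lambda>E. \<integral>\<^sup>+w. \<mu> (THE S. represents M X S E) w \<partial>M)"

context stable_space
begin

lemma the_represents: "represents M X S E \<Longrightarrow> (THE S. represents M X S E) = S"
  by (rule the_equality) (auto dest: represents_unique[OF X])

lemma represents_dom:
  assumes S: "represents M X S E"
  shows "x \<in> X \<Longrightarrow> AE w in M. (x, w) \<in> E \<longrightarrow> w \<in> cond_dom M S"
    and "\<exists>x\<in>X. AE w in M. w \<in> cond_dom M S \<longleftrightarrow> (x, w) \<in> E"
proof -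
  obtain V B where V: "S = cond_set M V B" "V \<subseteq> X" "stable M V" "B \<in> sets M"
    using S unfolding represents_def by (auto elim: cond_PowE)
  note iff = represents_graph_iff[OF S[unfolded V(1)] V(3,4)]
  have d: "AE w in M. w \<in> cond_dom M S \<longleftrightarrow> w \<in> B"
    unfolding V(1) by (rule cond_dom_cond_set[OF stable_nonempty[OF V(3)] V(4)])
  show 1: "AE w in M. (x, w) \<in> E \<longrightarrow> w \<in> cond_dom M S" if x: "x \<in> X" for x
  proof -
    have "AE w\<in>Pair x -` E in M. (x, w) \<in> E" by auto
    then obtain v where "AE w\<in>Pair x -` E in M. w \<in> B \<and> x w = v w"
      using iff[OF x slice_sets[OF S x]] by blast
    with d show ?thesis by eventually_elim auto
  qed
  obtain v where v: "v \<in> V" using stable_nonempty[OF V(3)] by blast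
  have "\<exists>u\<in>V. AE w\<in>B in M. w \<in> B \<and> v w = u w" using v by auto
  then have "AE w\<in>B in M. (v, w) \<in> E" using iff[of v B] v V by blast
  moreover have "AE w in M. (v, w) \<in> E \<longrightarrow> w \<in> cond_dom M S" using 1 v V by blast
  ultimately have "AE w in M. w \<in> cond_dom M S \<longleftrightarrow> (v, w) \<in> E" using d by eventually_elim auto
  then show "\<exists>x\<in>X. AE w in M. w \<in> cond_dom M S \<longleftrightarrow> (x, w) \<in> E" using v V by blast
qed

end

locale stable_prob = stable_algebra M X \<X> for M :: "'w measure" and X :: "('w \<Rightarrow> 'e) set" and \<X> +
  fixes \<mu> :: "('w \<Rightarrow> 'e option) set \<Rightarrow> 'w \<Rightarrow> ennreal"
  assumes \<mu>: "stable_measure M X \<X> \<mu>" and \<mu>_top: "AE w in M. \<mu> (cond_top M X) w = 1"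
begin

abbreviation m where "m \<equiv> graph_measure M X \<X> \<mu>"

lemma \<mu>_measurable[measurable (raw)]: "S \<in> \<X> \<Longrightarrow> \<mu> S \<in> borel_measurable M"
  and \<mu>_concat: "partition_of M A \<Longrightarrow> range T \<subseteq> \<X> \<Longrightarrow> is_concat M A (\<lambda>k. \<mu> (T k)) (\<mu> (cond_concat M A T))"
  and \<mu>_dom: "S \<in> \<X> \<Longrightarrow> AE w in M. w \<notin> cond_dom M S \<longrightarrow> \<mu> S w = 0"
  and \<mu>_Sup: "range T \<subseteq> \<X> \<Longrightarrow> (\<And>i j. i \<noteq> j \<Longrightarrow> cond_disjoint M X (T i) (T j)) \<Longrightarrow>
     AE w in M. \<mu> (cond_Sup M X (range T)) w = (\<Sum>k. \<mu> (T k) w)"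
  using \<mu> unfolding stable_measure_def by blast+

lemma \<mu>_bot: "AE w in M. \<mu> (cond_bot M) w = 0"
proof -
  obtain x :: "'w \<Rightarrow> 'e" where "AE w in M. w \<in> cond_dom M (cond_bot M :: ('w \<Rightarrow> 'e option) set) \<longleftrightarrow> (x, w) \<in> {}"
    using represents_dom(2)[OF represents_bot] by blast
  with \<mu>_dom[OF bot_in] show ?thesis by eventually_elim auto
qed

text \<open>Stability of \<mu>, applied to the concatenation of \<open>S\<close> on \<open>A\<close>
  with bottom off \<open>A\<close>, localises the value of \<mu> to \<open>A\<close>. It is what
  relates \<mu> to integrals over cylinders.\<close>

lemma \<mu>_restrict:
  assumes S: "S \<in> \<X>" "represents M X S E" and A: "A \<in> sets M"
  obtains T where "T \<in> \<X>" "represents M X T (E \<inter> X \<times> A)" "AE w in M. \<mu> T w = \<mu> S w * indicator A w"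
proof -
  let ?T = "\<lambda>k::nat. if k = 0 then S else cond_bot M"
  let ?A = "two_part M A"
  have p: "partition_of M ?A" by (rule partition_two_part[OF A])
  have T: "range ?T \<subseteq> \<X>" using S bot_in by auto
  have "represents M X (cond_concat M ?A ?T) (\<Union>k. (if k = 0 then E else {}) \<inter> X \<times> ?A k)"
    using S represents_bot by (intro represents_cond_concat p) auto
  also have "(\<Union>k. (if k = 0 then E else {}) \<inter> X \<times> ?A k) = E \<inter> X \<times> A"
    by (auto simp: two_part_def split: if_splits)
  finally have r: "represents M X (cond_concat M ?A ?T) (E \<inter> X \<times> A)" .
  have "AE w in M. \<mu> (cond_concat M ?A ?T) w = \<mu> S w * indicator A w"
    using \<mu>_concat[OF p T, unfolded is_concat_def] \<mu>_bot AE_space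
  proof eventually_elim
    case (elim w)
    have "w \<in> A \<Longrightarrow> \<mu> (cond_concat M ?A ?T) w = \<mu> S w"
      using elim(1)[rule_format, of 0] by (simp add: two_part_def)
    moreover have "w \<notin> A \<Longrightarrow> \<mu> (cond_concat M ?A ?T) w = 0"
      using elim(1)[rule_format, of 1] elim(2,3) by (simp add: two_part_def)
    ultimately show ?case by (simp add: indicator_def)
  qed
  from that[OF concat_in[OF p T] r this] show thesis .
qed

lemma space_graph_measure: "space m = X \<times> space M"
  unfolding graph_measure_def by (rule space_measure_of[OF graph_algebra_subset])

lemma sets_graph_measure: "sets m = graph_algebra M X \<X>"
proof -
  interpret G: sigma_algebra "X \<times> space M" "graph_algebra M X \<X>" by (rule sigma_algebra_graph_algebra)
  show ?thesis unfolding graph_measure_def by (rule G.sets_measure_of_eq)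
qed

text \<open>Disjoint graphs represent disjoint conditional sets, so (M2) followed by exchange of sum
  and integral over \<Omega> gives countable additivity.\<close>

lemma emeasure_graph_measure:
  assumes S: "S \<in> \<X>" "represents M X S E"
  shows "emeasure m E = (\<integral>\<^sup>+w. \<mu> S w \<partial>M)"
proof -
  let ?f = "\<lambda>E. \<integral>\<^sup>+w. \<mu> (THE S. represents M X S E) w \<partial>M"
  interpret G: sigma_algebra "X \<times> space M" "graph_algebra M X \<X>" by (rule sigma_algebra_graph_algebra)
  have "emeasure m E = ?f E"
    unfolding graph_measure_def
  proof (rule emeasure_measure_of_sigma[OF sigma_algebra_graph_algebra])
    have "(\<integral>\<^sup>+w. \<mu> (cond_bot M) w \<partial>M) = 0" using \<mu>_bot bot_in by (subst nn_integral_0_iff_AE) auto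
    then show "positive (graph_algebra M X \<X>) ?f"
      unfolding positive_def by (simp add: the_represents[OF represents_bot])
    show "countably_additive (graph_algebra M X \<X>) ?f"
      unfolding countably_additive_def
    proof (intro allI impI)
      fix E :: "nat \<Rightarrow> _" assume E: "range E \<subseteq> graph_algebra M X \<X>" "disjoint_family E"
      have "\<forall>i. \<exists>S. S \<in> \<X> \<and> represents M X S (E i)" using E graph_algebraD by blast
      then obtain S where S: "\<And>i. S i \<in> \<X>" "\<And>i. represents M X (S i) (E i)" by metis
      have r: "represents M X (cond_Sup M X (range S)) (\<Union>i. E i)" using S by (intro represents_cond_Sup) auto
      have "cond_disjoint M X (S i) (S j)" if "i \<noteq> j" for i j
        unfolding cond_disjoint_iff[OF S(2) S(2)] using E(2) that by (auto simp: disjoint_family_on_def)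
      then have "AE w in M. \<mu> (cond_Sup M X (range S)) w = (\<Sum>k. \<mu> (S k) w)"
        using S(1) by (intro \<mu>_Sup) auto
      then have "(\<integral>\<^sup>+w. \<mu> (cond_Sup M X (range S)) w \<partial>M) = (\<integral>\<^sup>+w. (\<Sum>k. \<mu> (S k) w) \<partial>M)"
        by (rule nn_integral_cong_AE)
      also have "\<dots> = (\<Sum>k. \<integral>\<^sup>+w. \<mu> (S k) w \<partial>M)" using S(1) by (intro nn_integral_suminf) auto
      finally show "(\<Sum>i. ?f (E i)) = ?f (\<Union>i. E i)"
        by (simp add: the_represents[OF r] the_represents[OF S(2)])
    qed
    show "E \<in> graph_algebra M X \<X>" by (rule graph_algebraI[OF S])
  qed
  then show ?thesis by (simp add: the_represents[OF S(2)])
qed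

sublocale fibred_space M X m
proof (unfold_locales)
  show "space m = X \<times> space M" by (rule space_graph_measure)
  show "Pair x -` E \<in> sets M" if "E \<in> sets m" "x \<in> X" for E x
    using that unfolding sets_graph_measure by (auto dest: graph_algebra_stable_graph simp: stable_graph_def)
  show "E \<in> sets m" if "E \<subseteq> X \<times> space M" "\<And>x. x \<in> X \<Longrightarrow> AE w in M. (x, w) \<notin> E" for E
    unfolding sets_graph_measure using that by (rule graph_algebra_null)
  show "X \<times> A \<in> sets m" if "A \<in> sets M" for A
    unfolding sets_graph_measure using that by (rule graph_algebra_cylinder)
  show "emeasure m E = 0" if "E \<subseteq> X \<times> space M" "\<And>x. x \<in> X \<Longrightarrow> AE w in M. (x, w) \<notin> E" for E
  proof -
    have "represents M X (cond_bot M) E"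
      by (rule represents_AE_cong[OF represents_bot]) (use that in auto)
    then have "emeasure m E = (\<integral>\<^sup>+w. \<mu> (cond_bot M) w \<partial>M)" by (rule emeasure_graph_measure[OF bot_in])
    also have "\<dots> = 0" using \<mu>_bot bot_in by (subst nn_integral_0_iff_AE) auto
    finally show ?thesis .
  qed
  show "emeasure m (X \<times> A) = emeasure M A" if A: "A \<in> sets M" for A
  proof -
    obtain T where T: "T \<in> \<X>" "represents M X T (X \<times> space M \<inter> X \<times> A)"
      "AE w in M. \<mu> T w = \<mu> (cond_top M X) w * indicator A w"
      by (rule \<mu>_restrict[OF top_in represents_top A])
    have "X \<times> space M \<inter> X \<times> A = X \<times> A" using sets.sets_into_space[OF A] by auto
    then have "emeasure m (X \<times> A) = (\<integral>\<^sup>+w. \<mu> T w \<partial>M)" using emeasure_graph_measure T by simp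
    also have "\<dots> = (\<integral>\<^sup>+w. indicator A w \<partial>M)"
      by (rule nn_integral_cong_AE) (use T(3) \<mu>_top in \<open>eventually_elim, auto\<close>)
    finally show ?thesis using A by simp
  qed
qed

text \<open>Integrating \<mu> over \<Omega> loses nothing: the part of \<open>E\<close> above an
  event \<open>A\<close> has measure equal to the integral of \<open>\<mu> S\<close> over
  \<open>A\<close>, so conditioning recovers \<open>\<mu> S\<close> almost surely.\<close>

lemma cint_indicator:
  assumes S: "S \<in> \<X>" "represents M X S E"
  shows "AE w in M. cint M m (indicator E) w = \<mu> S w"
proof (rule cint_unique)
  have E[measurable]: "E \<in> sets m" unfolding sets_graph_measure by (rule graph_algebraI[OF S])
  show "indicator E \<in> borel_measurable m" "\<mu> S \<in> borel_measurable M" using S by auto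
  fix A assume A: "A \<in> sets M"
  obtain T where T: "T \<in> \<X>" "represents M X T (E \<inter> X \<times> A)" "AE w in M. \<mu> T w = \<mu> S w * indicator A w"
    by (rule \<mu>_restrict[OF S A])
  have "(\<integral>\<^sup>+p. indicator E p * indicator A (snd p) \<partial>m) = (\<integral>\<^sup>+p. indicator (E \<inter> X \<times> A) p \<partial>m)"
    using sets.sets_into_space[OF E] by (intro nn_integral_cong) (auto simp: space_m indicator_def)
  also have "\<dots> = emeasure m (E \<inter> X \<times> A)" using cylinder[OF A] by simp
  also have "\<dots> = (\<integral>\<^sup>+w. \<mu> T w \<partial>M)" by (rule emeasure_graph_measure[OF T(1,2)])
  also have "\<dots> = (\<integral>\<^sup>+w. \<mu> S w * indicator A w \<partial>M)" by (rule nn_integral_cong_AE[OF T(3)])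
  finally show "(\<integral>\<^sup>+p. indicator E p * indicator A (snd p) \<partial>m) = (\<integral>\<^sup>+w. \<mu> S w * indicator A w \<partial>M)" .
qed

end

section \<open>Stable probability measures obtained from measures on graphs\<close>

lemma (in complete_prob_space) stable_probI:
  "stable_prob_space M X \<X> \<mu> \<Longrightarrow> stable_prob M X \<X> \<mu>"
  unfolding stable_prob_space_def by unfold_locales auto

text \<open>The converse of \<open>graph_measure\<close>, needed for the existence of the product
  measure: conditioning an ordinary measure on the graph algebra yields a stable one. Each axiom is
  a rule for \<open>cint\<close>, and \<open>event_graph\<close> serves as the chosen graph of
  \<open>S\<close>.\<close>

lemma (in stable_algebra) stable_prob_space_of_measure:
  assumes fib: "fibred_space M X m" and sets: "sets m = graph_algebra M X \<X>"
  shows "stable_prob_space M X \<X> (\<lambda>S. cint M m (indicator (event_graph M X S)))"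
proof -
  interpret fibred_space M X m by (rule fib)
  let ?\<mu> = "\<lambda>S. cint M m (indicator (event_graph M X S))"
  have E[measurable]: "event_graph M X S \<in> sets m" if "S \<in> \<X>" for S
    unfolding sets using graph_algebraI represents_event_graph in_cond_Pow that by blast
  have cong: "AE w in M. cint M m (indicator (event_graph M X S)) w = cint M m (indicator E) w"
    if "S \<in> \<X>" "represents M X S E" for S E
  proof (rule cint_cong_AE)
    have [measurable]: "E \<in> sets m" unfolding sets using that by (rule graph_algebraI)
    show "indicator (event_graph M X S) \<in> borel_measurable m" "indicator E \<in> borel_measurable m"
      using E[OF that(1)] by auto
    show "AE p in m. indicator (event_graph M X S) p = (indicator E p :: ennreal)"
    proof (rule AE_fibres)
      fix x assume "x \<in> X"
      from represents_AE_eq[OF that(2) represents_event_graph[OF in_cond_Pow[OF that(1)]] this]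
      show "AE w in M. indicator (event_graph M X S) (x, w) = (indicator E (x, w) :: ennreal)"
        by eventually_elim (auto simp: indicator_def)
    qed
  qed
  show ?thesis
    unfolding stable_prob_space_def stable_measure_def
  proof (intro conjI allI impI ballI X \<X>)
    show "?\<mu> S \<in> borel_measurable M" for S by simp
    show "AE w in M. ?\<mu> (cond_top M X) w = 1"
    proof -
      have "AE w in M. cint M m (\<lambda>p. 1) w = 1" using cint_base[of "\<lambda>_. 1"] by simp
      moreover have "AE w in M. cint M m (indicator (X \<times> space M)) w = cint M m (\<lambda>p. 1) w"
        using cylinder[OF sets.top] by (intro cint_cong_AE AE_I2) (auto simp: space_m)
      ultimately show ?thesis using cong[OF top_in represents_top] by eventually_elim auto
    qed
    show "AE w in M. w \<notin> cond_dom M S \<longrightarrow> ?\<mu> S w = 0" if S: "S \<in> \<X>" for S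
    proof -
      have r: "represents M X S (event_graph M X S)" by (rule represents_event_graph[OF in_cond_Pow[OF S]])
      obtain x where x: "x \<in> X" "AE w in M. w \<in> cond_dom M S \<longleftrightarrow> (x, w) \<in> event_graph M X S"
        using represents_dom(2)[OF r] by blast
      \<comment> \<open>A measurable version of the domain of \<open>S\<close>. The graph lies above
        \<open>A\<close> up to null slices, so its indicator may be multiplied by that of
        \<open>A\<close>, which leaves \<open>cint\<close> as a factor.\<close>
      define A where "A = Pair x -` event_graph M X S"
      have A[measurable]: "A \<in> sets M" unfolding A_def by (rule slice_sets[OF r x(1)])
      have dA: "AE w in M. w \<in> cond_dom M S \<longleftrightarrow> w \<in> A" using x(2) unfolding A_def by simp
      have "AE w in M. cint M m (indicator (event_graph M X S)) w =
          cint M m (\<lambda>p. indicator A (snd p) * indicator (event_graph M X S) p) w"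
      proof (rule cint_cong_AE)
        show "AE p in m. indicator (event_graph M X S) p = (indicator A (snd p) * indicator (event_graph M X S) p :: ennreal)"
        proof (rule AE_fibres)
          fix y assume "y \<in> X"
          from represents_dom(1)[OF r this] dA
          show "AE w in M. indicator (event_graph M X S) (y, w) =
            (indicator A (snd (y, w)) * indicator (event_graph M X S) (y, w) :: ennreal)"
            by eventually_elim (auto simp: indicator_def)
        qed
      qed (use E[OF S] in auto)
      moreover have "AE w in M. cint M m (\<lambda>p. indicator A (snd p) * indicator (event_graph M X S) p) w =
          indicator A w * cint M m (indicator (event_graph M X S)) w"
        using E[OF S] by (intro cint_mult) auto
      ultimately show ?thesis using dA by eventually_elim (auto simp: indicator_def split: if_splits)
    qed
    show "is_concat M A (\<lambda>k. ?\<mu> (S k)) (?\<mu> (cond_concat M A S))"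
      if A: "partition_of M A" and S: "range S \<subseteq> \<X>" for A S
    proof -
      let ?E = "\<lambda>k. event_graph M X (S k)"
      let ?F = "\<Union>k. ?E k \<inter> X \<times> A k"
      have Sk: "S k \<in> \<X>" "represents M X (S k) (?E k)" for k
        using S by (auto intro!: represents_event_graph in_cond_Pow)
      have As[measurable]: "A k \<in> sets M" for k by (rule partition_sets[OF A])
      have F: "represents M X (cond_concat M A S) ?F" by (rule represents_cond_concat[OF A Sk(2)])
      have Fm[measurable]: "?F \<in> sets m" unfolding sets by (rule graph_algebraI[OF concat_in[OF A S] F])
      have "AE w in M. w \<in> A k \<longrightarrow> ?\<mu> (cond_concat M A S) w = ?\<mu> (S k) w" for k
      proof -
        \<comment> \<open>Above \<open>A k\<close> the disjointness of the partition leaves only the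
          \<open>k\<close>-th piece. Multiplying by the indicator of \<open>A k\<close> then
          compares the two conditional integrals on that event.\<close>
        have "p \<in> ?F \<longleftrightarrow> p \<in> ?E k" if "snd p \<in> A k" "p \<in> space m" for p
        proof
          assume "p \<in> ?F"
          then obtain j where "p \<in> ?E j" "snd p \<in> A j" by auto
          with partition_unique[OF A, of "snd p" k j] that show "p \<in> ?E k" by simp
        next
          assume "p \<in> ?E k"
          moreover have "p \<in> X \<times> A k" using that by (cases p) (auto simp: space_m)
          ultimately show "p \<in> ?F" by blast
        qed
        then have pt: "indicator (A k) (snd p) * indicator ?F p = (indicator (A k) (snd p) * indicator (?E k) p :: ennreal)"
          if "p \<in> space m" for p
          using that by (cases "snd p \<in> A k") (auto simp: indicator_def)
        have [measurable]: "?E k \<in> sets m" by (rule E[OF Sk(1)])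
        have "AE w in M. cint M m (\<lambda>p. indicator (A k) (snd p) * indicator ?F p) w =
          cint M m (\<lambda>p. indicator (A k) (snd p) * indicator (?E k) p) w"
        proof (rule cint_cong_AE)
          show "AE p in m. indicator (A k) (snd p) * indicator ?F p = (indicator (A k) (snd p) * indicator (?E k) p :: ennreal)"
            by (rule AE_I2) (rule pt)
        qed measurable
        moreover have "AE w in M. cint M m (\<lambda>p. indicator (A k) (snd p) * indicator ?F p) w = indicator (A k) w * cint M m (indicator ?F) w"
          by (intro cint_mult) auto
        moreover have "AE w in M. cint M m (\<lambda>p. indicator (A k) (snd p) * indicator (?E k) p) w = indicator (A k) w * cint M m (indicator (?E k)) w"
          using E[OF Sk(1)] by (intro cint_mult) auto
        ultimately show ?thesis using cong[OF concat_in[OF A S] F] by eventually_elim auto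
      qed
      then show ?thesis unfolding is_concat_def by (simp add: AE_all_countable)
    qed
    show "AE w in M. ?\<mu> (cond_Sup M X (range S)) w = (\<Sum>k. ?\<mu> (S k) w)"
      if S: "range S \<subseteq> \<X>" and disj: "\<forall>i j. i \<noteq> j \<longrightarrow> cond_disjoint M X (S i) (S j)" for S :: "nat \<Rightarrow> _"
    proof -
      let ?E = "\<lambda>k. event_graph M X (S k)"
      have Sk: "S k \<in> \<X>" "represents M X (S k) (?E k)" for k
        using S by (auto intro!: represents_event_graph in_cond_Pow)
      have F: "represents M X (cond_Sup M X (range S)) (\<Union>k. ?E k)" by (rule represents_cond_Sup[OF Sk(2)])
      have "AE w in M. cint M m (indicator (\<Union>k. ?E k)) w = cint M m (\<lambda>p. \<Sum>k. indicator (?E k) p) w"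
      proof (rule cint_cong_AE)
        show "AE p in m. indicator (\<Union>k. ?E k) p = (\<Sum>k. indicator (?E k) p :: ennreal)"
        proof (rule AE_fibres)
          fix x assume x: "x \<in> X"
          have "AE w in M. i \<noteq> j \<longrightarrow> (x, w) \<notin> ?E i \<inter> ?E j" for i j
          proof (cases "i = j")
            case False
            with disj have "cond_disjoint M X (S i) (S j)" by blast
            then show ?thesis unfolding cond_disjoint_iff[OF Sk(2) Sk(2)] using x by auto
          qed simp
          then have "AE w in M. \<forall>i j. i \<noteq> j \<longrightarrow> (x, w) \<notin> ?E i \<inter> ?E j" by (simp add: AE_all_countable)
          then show "AE w in M. indicator (\<Union>k. ?E k) (x, w) = (\<Sum>k. indicator (?E k) (x, w) :: ennreal)"
          proof eventually_elim
            case (elim w)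
            \<comment> \<open>Disjointness is known only at the point \<open>(x, w)\<close>, hence
              the intersection with this singleton before the indicators are summed.\<close>
            then have "disjoint_family (\<lambda>k. ?E k \<inter> {(x, w)})" by (auto simp: disjoint_family_on_def)
            then have "(\<Sum>k. indicator (?E k \<inter> {(x, w)}) (x, w) :: ennreal) =
                indicator (\<Union>k. ?E k \<inter> {(x, w)}) (x, w)"
              by (rule suminf_indicator)
            moreover have "indicator (B \<inter> {p}) p = (indicator B p :: ennreal)" for B and p :: "('w \<Rightarrow> 'e) \<times> 'w"
              by (simp add: indicator_def)
            moreover have "(\<Union>k. ?E k \<inter> {(x, w)}) = (\<Union>k. ?E k) \<inter> {(x, w)}" by blast
            ultimately show ?case by simp
          qed
        qed
      qed (use E[OF Sk(1)] in auto)
      moreover have "AE w in M. cint M m (\<lambda>p. \<Sum>k. indicator (?E k) p) w = (\<Sum>k. cint M m (indicator (?E k)) w)"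
        using E[OF Sk(1)] by (intro cint_suminf) auto
      ultimately show ?thesis using cong[OF Sup_in[OF S] F] by eventually_elim auto
    qed
  qed
qed

subsection \<open>Stably measurable functions\<close>

context complete_prob_space
begin

lemma stable_L0: "stable M (L0 M)"
  unfolding stable_def
proof (intro conjI allI impI)
  show "L0 M \<noteq> {}" using borel_measurable_const by blast
  fix A x y assume A: "partition_of M A" and x: "range x \<subseteq> L0 M" and y: "is_concat M A x y"
  obtain z where z: "\<And>k w. w \<in> A k \<Longrightarrow> z w = x k w" using concat_exists[OF A] by blast
  have "z \<in> L0 M"
  proof (rule measurableI)
    fix B :: "real set" assume B: "B \<in> sets borel"
    have "z -` B \<inter> space M = (\<Union>k. (x k -` B \<inter> space M) \<inter> A k)"
      using z partition_cover[OF A] by (auto, metis)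
    also have "\<dots> \<in> sets M"
      using x B partition_sets[OF A] by (intro sets.countable_UN) (auto intro!: measurable_sets[OF _ B])
    finally show "z -` B \<inter> space M \<in> sets M" .
  qed auto
  moreover have "AE w in M. y w = z w"
    using y[unfolded is_concat_def] AE_space
  proof eventually_elim
    case (elim w)
    then obtain k where "w \<in> A k" using partition_cover[OF A] by blast
    with elim z show ?case by auto
  qed
  ultimately show "y \<in> L0 M" by (rule AE_eq_measurable) auto
qed

lemma represents_ball:
  assumes x[measurable]: "x \<in> L0 M" and r[measurable]: "r \<in> L0 M" and pos: "AE w in M. 0 < r w"
  shows "represents M (L0 M) (cond_set M (L0_ball M x r) (space M))
    {(y, w). y \<in> L0 M \<and> w \<in> space M \<and> \<bar>x w - y w\<bar> < r w}" (is "represents _ _ _ ?E")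
proof (rule representsI)
  have x_in: "x \<in> L0_ball M x r" using pos x unfolding L0_ball_def by auto
  show "L0_ball M x r \<subseteq> L0 M" unfolding L0_ball_def by auto
  show "stable M (L0_ball M x r)"
    unfolding stable_def
  proof (intro conjI allI impI)
    show "L0_ball M x r \<noteq> {}" using x_in by blast
    fix A z y assume A: "partition_of M A" and z: "range z \<subseteq> L0_ball M x r" and y: "is_concat M A z y"
    have "range z \<subseteq> L0 M" using z unfolding L0_ball_def by blast
    from stable_concat[OF stable_L0 A this y] have yL: "y \<in> L0 M" .
    have "AE w in M. \<forall>k. \<bar>x w - z k w\<bar> < r w"
      unfolding AE_all_countable using z unfolding L0_ball_def by blast
    with y[unfolded is_concat_def] AE_space have "AE w in M. \<bar>x w - y w\<bar> < r w"
    proof eventually_elim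
      case (elim w)
      then obtain k where "w \<in> A k" using partition_cover[OF A] by blast
      with elim show ?case by auto
    qed
    with yL show "y \<in> L0_ball M x r" unfolding L0_ball_def by blast
  qed
  show "?E \<subseteq> L0 M \<times> space M" by auto
  fix y assume y[measurable]: "y \<in> L0 M"
  have "Pair y -` ?E = {w \<in> space M. \<bar>x w - y w\<bar> < r w}" using y by auto
  then show "Pair y -` ?E \<in> sets M" by simp
  \<comment> \<open>Where \<open>y\<close> leaves the ball it is replaced by the centre, which lies
    in the ball because the radius is positive.\<close>
  let ?v = "\<lambda>w. if \<bar>x w - y w\<bar> < r w then y w else x w"
  have "AE w in M. \<bar>x w - ?v w\<bar> < r w" using pos by eventually_elim auto
  then have "?v \<in> L0_ball M x r" unfolding L0_ball_def by simp
  then show "\<exists>v\<in>L0_ball M x r. AE w in M. (y, w) \<in> ?E \<longrightarrow> w \<in> space M \<and> y w = v w"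
    by (intro bexI[of _ ?v]) auto
  fix v A assume v: "v \<in> L0_ball M x r" and "A \<in> sets M" "AE w\<in>A in M. w \<in> space M \<and> y w = v w"
  then have "AE w\<in>A in M. w \<in> space M \<and> y w = v w" "AE w in M. \<bar>x w - v w\<bar> < r w"
    unfolding L0_ball_def by auto
  then show "AE w\<in>A in M. (y, w) \<in> ?E"
    by eventually_elim (use y in auto)
qed auto

end

context stable_space
begin

lemma vimage_stable_graph:
  assumes f: "stable_fun M X Y f" and F: "stable_graph M Y F"
  shows "stable_graph M X {(x, w). x \<in> X \<and> w \<in> space M \<and> (f x, w) \<in> F}" (is "stable_graph M X ?E")
  unfolding stable_graph_def
proof (intro conjI ballI allI impI)
  have fX: "f x \<in> Y" if "x \<in> X" for x using f that unfolding stable_fun_def by blast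
  fix x assume x: "x \<in> X"
  have "Pair x -` ?E = Pair (f x) -` F" using F x unfolding stable_graph_def by auto
  then show "Pair x -` ?E \<in> sets M" using F fX[OF x] unfolding stable_graph_def by simp
next
  fix A x y assume A: "partition_of M A" and x: "range x \<subseteq> X" and y: "is_concat M A x y"
  have "is_concat M A (\<lambda>k. f (x k)) (f y)" "range (\<lambda>k. f (x k)) \<subseteq> Y"
    using f A x y unfolding stable_fun_def by blast+
  from stable_graph_concat[OF F A this(2,1)] AE_space
  show "AE w in M. \<forall>k. w \<in> A k \<longrightarrow> ((y, w) \<in> ?E \<longleftrightarrow> (x k, w) \<in> ?E)"
    by eventually_elim (use x stable_concat[OF X A x y] in auto)
qed auto

text \<open>The event \<open>?C\<close> is the largest slice of the pulled-back graph, and the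
  preimage is built from the elements attaining it. This is just the conditional set that
  \<open>represents_cond_set\<close> assigns to that graph.\<close>

lemma represents_cond_vimage:
  assumes Y: "stable M Y" and f: "stable_fun M X Y f" and T: "represents M Y T F"
  shows "represents M X (cond_vimage M X f T) {(x, w). x \<in> X \<and> w \<in> space M \<and> (f x, w) \<in> F}"
    (is "represents M X _ ?E")
proof -
  interpret Y: stable_space M Y using Y by unfold_locales
  obtain W B where W: "T = cond_set M W B" "W \<subseteq> Y" "stable M W" "B \<in> sets M"
    using T unfolding represents_def by (auto elim: cond_PowE)
  have fX: "f x \<in> Y" if "x \<in> X" for x using f that unfolding stable_fun_def by blast
  have E: "stable_graph M X ?E" by (rule vimage_stable_graph[OF f Y.stable_graph_of[OF T]])
  have iff: "restr (f x) A \<in> cond_restr M T A \<longleftrightarrow> (AE w\<in>A in M. (x, w) \<in> ?E)"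
    if x: "x \<in> X" and A: "A \<in> sets M" for x A
  proof -
    have "restr (f x) A \<in> cond_restr M T A \<longleftrightarrow> (AE w\<in>A in M. (f x, w) \<in> F)"
      unfolding W(1) restr_in_cond_restr_iff
      by (rule represents_graph_iff[OF T[unfolded W(1)] W(3,4) fX[OF x] A, symmetric])
    also have "\<dots> \<longleftrightarrow> (AE w\<in>A in M. (x, w) \<in> ?E)"
      using x sets.sets_into_space[OF A] by (intro AE_cong) auto
    finally show ?thesis .
  qed
  let ?\<A> = "{A \<in> sets M. A \<subseteq> cond_dom M T \<and> (\<exists>x\<in>X. restr (f x) A \<in> cond_restr M T A)}"
  let ?C = "ess_Sup M ?\<A>"
  have \<A>: "?\<A> \<subseteq> sets M" by auto
  have C: "?C \<in> sets M" by (rule ess_Sup_sets[OF \<A>])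
  have "\<exists>x\<in>X. AE w\<in>?C in M. (x, w) \<in> ?E"
    by (rule stable_graph_attain[OF X E \<A>]) (use iff in blast)
  then obtain x0 where x0: "x0 \<in> X" "AE w\<in>?C in M. (x0, w) \<in> ?E" by blast
  have upper: "AE w in M. (x, w) \<in> ?E \<longrightarrow> w \<in> ?C" if x: "x \<in> X" for x
  proof -
    \<comment> \<open>As with \<open>event\<close>, the family defining \<open>?C\<close> demands
      literal inclusion in the chosen domain; the intersection removes only a null set.\<close>
    let ?A = "Pair x -` ?E \<inter> cond_dom M T"
    have ps: "Pair x -` ?E \<in> sets M" using E x unfolding stable_graph_def by blast
    have d: "AE w in M. (x, w) \<in> ?E \<longrightarrow> w \<in> cond_dom M T"
      using Y.represents_dom(1)[OF T fX[OF x]] by eventually_elim auto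
    have A: "?A \<in> sets M"
    proof (rule in_sets_AE[OF _ ps])
      show "AE w in M. w \<in> Pair x -` ?E \<longleftrightarrow> w \<in> ?A" using d by eventually_elim auto
    qed auto
    have "restr (f x) ?A \<in> cond_restr M T ?A" unfolding iff[OF x A] by auto
    then have "?A \<in> ?\<A>" using A x by blast
    from ess_Sup_upper[OF \<A> this] d show ?thesis by eventually_elim auto
  qed
  have "cond_vimage M X f T = cond_set M {x \<in> X. AE w\<in>?C in M. (x, w) \<in> ?E} ?C"
    unfolding cond_vimage_def Let_def using iff[OF _ C] by (intro arg_cong2[where f="cond_set M"]) auto
  then show ?thesis using represents_cond_set[OF X E C upper x0] by simp
qed

end

context stable_prob
begin

text \<open>Measurability over X \<times> \<Omega> already contains locality: the sublevel sets of
  \<open>f\<close> at rational levels are stable graphs, only countably many null sets arise, and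
  rational levels separate real values.\<close>

lemma measurable_concat:
  fixes f :: "('w \<Rightarrow> 'e) \<Rightarrow> 'w \<Rightarrow> real"
  assumes f[measurable]: "case_prod f \<in> borel_measurable m"
    and A: "partition_of M A" and x: "range x \<subseteq> X" and y: "is_concat M A x y"
  shows "is_concat M A (\<lambda>k. f (x k)) (f y)"
proof -
  define E where "E q = {p \<in> space m. case_prod f p < real_of_rat q}" for q
  have "E q \<in> sets m" for q unfolding E_def by measurable
  then have "stable_graph M X (E q)" for q
    unfolding sets_graph_measure by (rule graph_algebra_stable_graph)
  from stable_graph_concat[OF this A x y]
  have "AE w in M. \<forall>q. \<forall>k. w \<in> A k \<longrightarrow> ((y, w) \<in> E q \<longleftrightarrow> (x k, w) \<in> E q)"
    by (subst AE_all_countable) blast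
  then show ?thesis
    unfolding is_concat_def using AE_space
  proof eventually_elim
    case (elim w)
    show ?case
    proof (intro allI impI)
      fix k assume k: "w \<in> A k"
      have *: "f y w < real_of_rat q \<longleftrightarrow> f (x k) w < real_of_rat q" for q
        using elim k x stable_concat[OF X A x y] by (auto simp: E_def space_graph_measure)
      show "f y w = f (x k) w"
      proof (rule ccontr)
        assume "f y w \<noteq> f (x k) w"
        then consider "f y w < f (x k) w" | "f (x k) w < f y w" by linarith
        then show False
        proof cases
          case 1
          then obtain q where "f y w < real_of_rat q" "real_of_rat q < f (x k) w" using of_rat_dense by blast
          with *[of q] show False by simp
        next
          case 2
          then obtain q where "f (x k) w < real_of_rat q" "real_of_rat q < f y w" using of_rat_dense by blast
          with *[of q] show False by simp
        qed
      qed
    qed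
  qed
qed

lemma stable_fun_L0:
  assumes f: "case_prod f \<in> borel_measurable m"
  shows "stable_fun M X (L0 M) f"
  unfolding stable_fun_def
proof (intro conjI allI impI)
  show "f ` X \<subseteq> L0 M" using section_measurable[OF f] by auto
qed (rule measurable_concat[OF f])

text \<open>Balls with constant centre and radius suffice, since preimages of half-lines are
  countable unions of preimages of such balls.\<close>

lemma stably_measurableD:
  assumes f: "stably_measurable M X \<X> (L0 M) (stable_borel M) f"
  shows "case_prod f \<in> borel_measurable m"
proof (rule borel_measurableI_less)
  have ball: "{(x, w). x \<in> X \<and> w \<in> space M \<and> \<bar>c - f x w\<bar> < r} \<in> sets m" if "0 < r" for c r :: real
  proof -
    let ?T = "cond_set M (L0_ball M (\<lambda>_. c) (\<lambda>_. r)) (space M)"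
    have "?T \<in> {cond_set M (L0_ball M x r) (space M) | x r. x \<in> L0 M \<and> r \<in> L0 M \<and> (AE w in M. 0 < r w)}"
      by (intro CollectI exI[of _ "\<lambda>_. c"] exI[of _ "\<lambda>_. r"]) (use that in auto)
    then have "?T \<in> stable_borel M"
      unfolding stable_borel_def stable_sigma_gen_def by blast
    then have "cond_vimage M X f ?T \<in> \<X>" and sf: "stable_fun M X (L0 M) f"
      using f unfolding stably_measurable_def by auto
    moreover have "represents M X (cond_vimage M X f ?T)
      {(x, w). x \<in> X \<and> w \<in> space M \<and> (f x, w) \<in> {(y, w). y \<in> L0 M \<and> w \<in> space M \<and> \<bar>c - y w\<bar> < r}}"
      using that by (intro represents_cond_vimage[OF stable_L0 sf] represents_ball) auto
    moreover have "{(x, w). x \<in> X \<and> w \<in> space M \<and> (f x, w) \<in> {(y, w). y \<in> L0 M \<and> w \<in> space M \<and> \<bar>c - y w\<bar> < r}} =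
      {(x, w). x \<in> X \<and> w \<in> space M \<and> \<bar>c - f x w\<bar> < r}"
      using sf unfolding stable_fun_def by auto
    ultimately show ?thesis unfolding sets_graph_measure by (auto intro: graph_algebraI)
  qed
  fix a :: real
  \<comment> \<open>The ball with centre \<open>a - (n + 1)\<close> and radius \<open>n + 1\<close>
    is the interval from \<open>a - 2 (n + 1)\<close> to \<open>a\<close>; these intervals exhaust
    the half-line below \<open>a\<close>.\<close>
  have "{p \<in> space m. case_prod f p < a} =
    (\<Union>n. {(x, w). x \<in> X \<and> w \<in> space M \<and> \<bar>a - real (Suc n) - f x w\<bar> < real (Suc n)})"
  proof (intro set_eqI iffI)
    fix p assume p: "p \<in> {p \<in> space m. case_prod f p < a}"
    obtain n :: nat where "a - case_prod f p < real n" using reals_Archimedean2 by blast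
    then show "p \<in> (\<Union>n. {(x, w). x \<in> X \<and> w \<in> space M \<and> \<bar>a - real (Suc n) - f x w\<bar> < real (Suc n)})"
      using p by (cases p) (auto simp: space_graph_measure abs_less_iff intro!: exI[of _ n])
  qed (auto simp: space_graph_measure)
  also have "\<dots> \<in> sets m" using ball by (intro sets.countable_UN) auto
  finally show "{p \<in> space m. case_prod f p < a} \<in> sets m" .
qed

text \<open>Good sets: the stable graphs over \<open>L0 M\<close> whose pullback lies in the graph
  algebra form a \<sigma>-algebra containing the cylinders. The balls belong to it even with random
  centre and radius, because these are functions of \<open>snd p\<close>. Hence every member of
  \<open>stable_borel\<close> has such a graph.\<close>

lemma stably_measurableI:
  assumes f[measurable]: "case_prod f \<in> borel_measurable m"
  shows "stably_measurable M X \<X> (L0 M) (stable_borel M) f"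
  unfolding stably_measurable_def
proof (intro conjI ballI)
  show sf: "stable_fun M X (L0 M) f" by (rule stable_fun_L0[OF f])
  interpret L: stable_space M "L0 M" by unfold_locales (rule stable_L0)
  interpret G: sigma_algebra "X \<times> space M" "graph_algebra M X \<X>" by (rule sigma_algebra_graph_algebra)
  let ?v = "\<lambda>F. {(x, w). x \<in> X \<and> w \<in> space M \<and> (f x, w) \<in> F}"
  let ?S = "{F. stable_graph M (L0 M) F \<and> ?v F \<in> graph_algebra M X \<X>}"
  have fX: "f x \<in> L0 M" if "x \<in> X" for x using sf that unfolding stable_fun_def by blast
  have "sigma_algebra (L0 M \<times> space M) ?S"
    unfolding sigma_algebra_iff2
  proof (intro conjI ballI allI impI)
    show "?S \<subseteq> Pow (L0 M \<times> space M)" unfolding stable_graph_def by blast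
    show "{} \<in> ?S" using L.graphs.empty_sets by simp
    show "L0 M \<times> space M - F \<in> ?S" if "F \<in> ?S" for F
    proof -
      have "?v (L0 M \<times> space M - F) = X \<times> space M - ?v F" using fX by auto
      then show ?thesis using that L.graphs.compl_sets[of F] G.compl_sets[of "?v F"] by auto
    qed
    show "(\<Union>i. F i) \<in> ?S" if F: "range F \<subseteq> ?S" for F :: "nat \<Rightarrow> _"
    proof -
      have "?v (\<Union>i. F i) = (\<Union>i. ?v (F i))" by auto
      moreover have "(\<Union>i. ?v (F i)) \<in> graph_algebra M X \<X>" using F by (intro G.countable_UN) auto
      moreover have "(\<Union>i. F i) \<in> {F. stable_graph M (L0 M) F}" using F by (intro L.graphs.countable_UN) auto
      ultimately show ?thesis by simp
    qed
  qed
  then have "stable_sigma_algebra M (L0 M) {S. \<exists>F\<in>?S. represents M (L0 M) S F}"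
  proof (rule L.stable_sigma_algebra_represented)
    show "L0 M \<times> A \<in> ?S" if A: "A \<in> sets M" for A
    proof -
      have "?v (L0 M \<times> A) = X \<times> A" using fX sets.sets_into_space[OF A] by auto
      then show ?thesis
        using L.stable_graph_of[OF L.represents_cond_set_top[OF A]] graph_algebra_cylinder[OF A] by auto
    qed
  qed auto
  moreover have "{cond_set M (L0_ball M x r) (space M) | x r. x \<in> L0 M \<and> r \<in> L0 M \<and> (AE w in M. 0 < r w)} \<subseteq>
    {S. \<exists>F\<in>?S. represents M (L0 M) S F}"
  proof safe
    fix x r assume [measurable]: "x \<in> L0 M" "r \<in> L0 M" and r: "AE w in M. 0 < r w"
    let ?F = "{(y, w). y \<in> L0 M \<and> w \<in> space M \<and> \<bar>x w - y w\<bar> < r w}"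
    have rep: "represents M (L0 M) (cond_set M (L0_ball M x r) (space M)) ?F"
      by (rule represents_ball) (use r in auto)
    have "?v ?F = {p \<in> space m. \<bar>x (snd p) - case_prod f p\<bar> < r (snd p)}"
      using fX by (auto simp: space_graph_measure)
    also have "\<dots> \<in> sets m" by measurable
    finally have "?F \<in> ?S" using L.stable_graph_of[OF rep] unfolding sets_graph_measure by blast
    then show "\<exists>F\<in>?S. represents M (L0 M) (cond_set M (L0_ball M x r) (space M)) F" using rep by blast
  qed
  ultimately have sub: "stable_borel M \<subseteq> {S. \<exists>F\<in>?S. represents M (L0 M) S F}"
    unfolding stable_borel_def stable_sigma_gen_def by blast
  fix T assume "T \<in> stable_borel M"
  then obtain F where F: "F \<in> ?S" "represents M (L0 M) T F" using sub by blast
  have "?v F \<in> graph_algebra M X \<X>" using F by blast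
  then show "cond_vimage M X f T \<in> \<X>"
    by (rule graph_algebra_represents_in) (rule represents_cond_vimage[OF stable_L0 sf F(2)])
qed

subsection \<open>The stable integral as a conditional integral\<close>

lemma space_m_nonempty: "space m \<noteq> {}"
  using stable_nonempty[OF X] not_empty by (auto simp: space_graph_measure)

lemma measurable_case_prod_ennreal:
  "case_prod g \<in> borel_measurable m \<Longrightarrow> (\<lambda>(x, w). ennreal (g x w)) \<in> borel_measurable m"
  using measurable_compose[OF _ measurable_ennreal] by (simp add: case_prod_unfold)

text \<open>The right-hand sum refers to the representation, the conditional integral only to
  \<open>g\<close>. The elementary integral is thereby independent of the representation, which
  tames its \<open>SOME\<close>.\<close>

lemma elementary_repD:
  assumes g: "elementary_rep M X \<X> n r S g"
  shows "case_prod g \<in> borel_measurable m"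
    and "AE w in M. cint M m (\<lambda>(x, w). ennreal (g x w)) w = (\<Sum>k\<le>n. ennreal (r k w) * \<mu> (S k) w)"
proof -
  have r[measurable]: "r k \<in> borel_measurable M" and rpos: "AE w in M. 0 \<le> r k w" and S: "S k \<in> \<X>" if "k \<le> n" for k
    using g that unfolding elementary_rep_def by auto
  let ?E = "\<lambda>k. event_graph M X (S k)"
  have rep: "represents M X (S k) (?E k)" if "k \<le> n" for k by (rule represents_event_graph[OF in_cond_Pow[OF S[OF that]]])
  have E: "?E k \<in> sets m" if "k \<le> n" for k
    unfolding sets_graph_measure using graph_algebraI[OF S rep] that by blast
  define G where "G p = (\<Sum>k\<le>n. r k (snd p) * indicator (?E k) p)" for p
  have Gm[measurable]: "G \<in> borel_measurable m"
    unfolding G_def[abs_def] using r E by (intro borel_measurable_sum borel_measurable_times) auto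
  have gG: "AE w in M. case_prod g (x, w) = G (x, w)" if x: "x \<in> X" for x
  proof -
    have "AE w in M. g x w = (\<Sum>k\<le>n. r k w * stable_indicator M (S k) x w)"
      using g x unfolding elementary_rep_def by blast
    then show ?thesis
      by eventually_elim (use x in \<open>simp add: G_def stable_indicator_def event_graph_def event_def indicator_def\<close>)
  qed
  show gm[measurable]: "case_prod g \<in> borel_measurable m" by (rule AE_cong_measurable[OF Gm gG]) auto
  have "AE w in M. cint M m (\<lambda>(x, w). ennreal (g x w)) w = cint M m (\<lambda>p. \<Sum>k\<le>n. ennreal (r k (snd p)) * indicator (?E k) p) w"
  proof (rule cint_cong_AE)
    show "AE p in m. (case p of (x, w) \<Rightarrow> ennreal (g x w)) = (\<Sum>k\<le>n. ennreal (r k (snd p)) * indicator (?E k) p)"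
    proof (rule AE_fibres)
      fix x assume x: "x \<in> X"
      have "AE w in M. \<forall>k\<in>{..n}. 0 \<le> r k w" using rpos by (subst AE_ball_countable) auto
      with gG[OF x] show "AE w in M. (case (x, w) of (x, w) \<Rightarrow> ennreal (g x w)) =
        (\<Sum>k\<le>n. ennreal (r k (snd (x, w))) * indicator (?E k) (x, w))"
      proof eventually_elim
        case (elim w)
        have "ennreal (\<Sum>k\<le>n. r k w * indicator (?E k) (x, w)) = (\<Sum>k\<le>n. ennreal (r k w * indicator (?E k) (x, w)))"
          using elim by (intro sum_ennreal[symmetric]) auto
        also have "\<dots> = (\<Sum>k\<le>n. ennreal (r k w) * indicator (?E k) (x, w))"
          by (intro sum.cong) (auto simp: indicator_def)
        finally show ?case using elim by (simp add: G_def)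
      qed
    qed
    show "(\<lambda>p. \<Sum>k\<le>n. ennreal (r k (snd p)) * indicator (?E k) p) \<in> borel_measurable m"
      using r E by (intro borel_measurable_sum borel_measurable_times_ennreal) auto
  qed (rule measurable_case_prod_ennreal[OF gm])
  moreover have "AE w in M. cint M m (\<lambda>p. \<Sum>k\<le>n. ennreal (r k (snd p)) * indicator (?E k) p) w =
    (\<Sum>k\<le>n. cint M m (\<lambda>p. ennreal (r k (snd p)) * indicator (?E k) p) w)"
    using r E by (intro cint_sum borel_measurable_times_ennreal) auto
  moreover have "AE w in M. \<forall>k\<in>{..n}. cint M m (\<lambda>p. ennreal (r k (snd p)) * indicator (?E k) p) w = ennreal (r k w) * \<mu> (S k) w"
  proof (subst AE_ball_countable, simp, intro ballI)
    fix k assume "k \<in> {..n}"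
    then have k: "k \<le> n" by simp
    have "AE w in M. cint M m (\<lambda>p. ennreal (r k (snd p)) * indicator (?E k) p) w = ennreal (r k w) * cint M m (indicator (?E k)) w"
      using r[OF k] E[OF k] by (intro cint_mult) auto
    with cint_indicator[OF S[OF k] rep[OF k]]
    show "AE w in M. cint M m (\<lambda>p. ennreal (r k (snd p)) * indicator (?E k) p) w = ennreal (r k w) * \<mu> (S k) w"
      by eventually_elim auto
  qed
  ultimately show "AE w in M. cint M m (\<lambda>(x, w). ennreal (g x w)) w = (\<Sum>k\<le>n. ennreal (r k w) * \<mu> (S k) w)"
    by eventually_elim auto
qed

lemma elementary_integral_eq_cint:
  assumes "stable_elementary M X \<X> g"
  shows "case_prod g \<in> borel_measurable m"
    and "AE w in M. elementary_integral M X \<X> \<mu> g w = cint M m (\<lambda>(x, w). ennreal (g x w)) w"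
proof -
  obtain n r S where g: "elementary_rep M X \<X> n r S g" using assms unfolding stable_elementary_def by blast
  then show "case_prod g \<in> borel_measurable m" by (rule elementary_repD)
  have "\<exists>I n r S. elementary_rep M X \<X> n r S g \<and> (AE w in M. I w = (\<Sum>k\<le>n. ennreal (r k w) * \<mu> (S k) w))"
    using g by (intro exI[of _ "\<lambda>w. \<Sum>k\<le>n. ennreal (r k w) * \<mu> (S k) w"] exI[of _ n] exI[of _ r] exI[of _ S]) auto
  then have "\<exists>n r S. elementary_rep M X \<X> n r S g \<and>
    (AE w in M. elementary_integral M X \<X> \<mu> g w = (\<Sum>k\<le>n. ennreal (r k w) * \<mu> (S k) w))"
    unfolding elementary_integral_def by (rule someI_ex)
  then obtain n r S where *: "elementary_rep M X \<X> n r S g"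
    "AE w in M. elementary_integral M X \<X> \<mu> g w = (\<Sum>k\<le>n. ennreal (r k w) * \<mu> (S k) w)" by blast
  from *(2) elementary_repD(2)[OF *(1)]
  show "AE w in M. elementary_integral M X \<X> \<mu> g w = cint M m (\<lambda>(x, w). ennreal (g x w)) w"
    by eventually_elim auto
qed

text \<open>The level sets of an ordinary simple function are graphs of pairwise disjoint
  conditional sets covering \<open>X\<close>, and its values serve as coefficients constant on
  \<Omega>.\<close>

lemma simple_stable_elementary:
  assumes U: "simple_function m U"
  shows "stable_elementary M X \<X> (\<lambda>x w. enn2real (U (x, w)))"
proof -
  let ?R = "U ` space m"
  have fin: "finite ?R" using U by (rule simple_functionD)
  obtain h where h: "bij_betw h {0..<card ?R} ?R" using ex_bij_betw_nat_finite[OF fin] by blast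
  \<comment> \<open>An elementary representation has \<open>n + 1\<close> summands, so the set of
    values must be nonempty; this holds as the space is nonempty.\<close>
  obtain n where n: "card ?R = Suc n"
    using fin space_m_nonempty by (metis card_0_eq image_is_empty not0_implies_Suc)
  then have h: "inj_on h {..n}" "h ` {..n} = ?R"
    using h by (auto simp: bij_betw_def atLeast0LessThan lessThan_Suc_atMost)
  let ?E = "\<lambda>k. U -` {h k} \<inter> space m"
  have E: "?E k \<in> sets m" for k using U by (rule simple_functionD)
  then have "\<forall>k. \<exists>S. S \<in> \<X> \<and> represents M X S (?E k)" unfolding sets_graph_measure using graph_algebraD by blast
  then obtain S where S: "\<And>k. S k \<in> \<X>" "\<And>k. represents M X (S k) (?E k)" by metis
  have "elementary_rep M X \<X> n (\<lambda>k _. enn2real (h k)) S (\<lambda>x w. enn2real (U (x, w)))"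
    unfolding elementary_rep_def
  proof (intro conjI allI impI ballI)
    show "cond_disjoint M X (S i) (S j)" if "i \<le> n" "j \<le> n" "i \<noteq> j" for i j
      unfolding cond_disjoint_iff[OF S(2) S(2)] using h(1) that by (auto dest: inj_onD)
    have "(\<Union>k\<le>n. ?E k) = X \<times> space M"
      unfolding space_graph_measure[symmetric] using h(2) by blast
    then have "represents M X (cond_Sup M X (S ` {..n})) (X \<times> space M)"
      using represents_cond_Sup[of "{..n}" S ?E] S(2) by simp
    then show "cond_Sup M X (S ` {..n}) = cond_top M X" by (rule represents_unique[OF X _ represents_top])
    fix x assume x: "x \<in> X"
    have "AE w in M. \<forall>k. (x, w) \<in> ?E k \<longleftrightarrow> w \<in> event M (S k) x"
      unfolding AE_all_countable using S(2) x unfolding represents_def by blast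
    then show "AE w in M. enn2real (U (x, w)) = (\<Sum>k\<le>n. enn2real (h k) * stable_indicator M (S k) x w)"
      using AE_space
    proof eventually_elim
      case (elim w)
      have p: "(x, w) \<in> space m" using elim x by (simp add: space_graph_measure)
      then have "U (x, w) \<in> h ` {..n}" using h(2) by blast
      then obtain k where k: "k \<le> n" "U (x, w) = h k" by auto
      have "enn2real (h j) * stable_indicator M (S j) x w = (if j = k then enn2real (h k) else 0)" if "j \<le> n" for j
      proof -
        have "w \<in> event M (S j) x \<longleftrightarrow> j = k"
          using elim(1) p k that h(1) by (auto dest: inj_onD)
        then show ?thesis by (simp add: stable_indicator_def event_def indicator_def)
      qed
      then have "(\<Sum>j\<le>n. enn2real (h j) * stable_indicator M (S j) x w) = (\<Sum>j\<le>n. if j = k then enn2real (h k) else 0)"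
        by (intro sum.cong) auto
      also have "\<dots> = enn2real (h k)" using k by simp
      finally show ?case using k by simp
    qed
  qed (use S in auto)
  then show ?thesis unfolding stable_elementary_def by blast
qed

text \<open>Ordinary simple functions provide one admissible sequence, so \<open>SOME\<close>
  returns an integral. Whichever sequence it used, the elementary integrals are conditional
  integrals, and monotone convergence leads to the same limit. The sequence increases only almost
  surely over each \<open>x\<close>, which is why \<open>cint_SUP\<close> asks for no more than
  almost everywhere increase.\<close>

lemma stable_nn_integral_eq_cint:
  assumes f[measurable]: "case_prod f \<in> borel_measurable m"
  shows "AE w in M. stable_nn_integral M X \<X> \<mu> f w = cint M m (\<lambda>(x, w). ennreal (f x w)) w"
proof -
  let ?P = "\<lambda>g I. (\<forall>n. stable_elementary M X \<X> (g n)) \<and>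
     (\<forall>n. \<forall>x\<in>X. AE w in M. g n x w \<le> g (Suc n) x w) \<and>
     (\<forall>x\<in>X. AE w in M. ennreal (f x w) = (SUP n. ennreal (g n x w))) \<and>
     (AE w in M. I w = (SUP n. elementary_integral M X \<X> \<mu> (g n) w))"
  have "(\<lambda>p. ennreal (case_prod f p)) \<in> borel_measurable m" by measurable
  from borel_measurable_implies_simple_function_sequence'[OF this]
  obtain U where U: "\<And>i. simple_function m (U i)" "incseq U" "\<And>i x. U i x < top"
    "\<And>x. (SUP i. U i x) = ennreal (case_prod f x)" by metis
  define g where "g i x w = enn2real (U i (x, w))" for i x w
  have eg: "ennreal (g i x w) = U i (x, w)" for i x w using U(3) by (simp add: g_def)
  have "?P g (\<lambda>w. SUP n. elementary_integral M X \<X> \<mu> (g n) w)"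
  proof (intro conjI allI ballI)
    show "stable_elementary M X \<X> (g n)" for n
      unfolding g_def[abs_def] by (rule simple_stable_elementary[OF U(1)])
    show "AE w in M. g n x w \<le> g (Suc n) x w" for n x
      using incseq_SucD[OF U(2)] U(3) unfolding g_def by (intro AE_I2 enn2real_mono) (auto simp: le_fun_def)
    show "AE w in M. ennreal (f x w) = (SUP n. ennreal (g n x w))" for x
      unfolding eg U(4) by simp
  qed auto
  then have "\<exists>I. \<exists>g. ?P g I" by (intro exI)
  from someI_ex[OF this] have "\<exists>g. ?P g (stable_nn_integral M X \<X> \<mu> f)"
    unfolding stable_nn_integral_def .
  then obtain g where g: "?P g (stable_nn_integral M X \<X> \<mu> f)" by blast
  have gm[measurable]: "case_prod (g n) \<in> borel_measurable m" for n
    using g elementary_integral_eq_cint(1) by blast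
  have "AE w in M. \<forall>n. elementary_integral M X \<X> \<mu> (g n) w = cint M m (\<lambda>(x, w). ennreal (g n x w)) w"
    unfolding AE_all_countable using g elementary_integral_eq_cint(2) by blast
  moreover have "AE w in M. cint M m (\<lambda>p. SUP n. case p of (x, w) \<Rightarrow> ennreal (g n x w)) w =
    (SUP n. cint M m (\<lambda>(x, w). ennreal (g n x w)) w)"
  proof (rule cint_SUP)
    fix n
    show "AE p in m. (case p of (x, w) \<Rightarrow> ennreal (g n x w)) \<le> (case p of (x, w) \<Rightarrow> ennreal (g (Suc n) x w))"
    proof (rule AE_fibres)
      fix x assume "x \<in> X"
      then have "AE w in M. g n x w \<le> g (Suc n) x w" using g by blast
      then show "AE w in M. (case (x, w) of (x, w) \<Rightarrow> ennreal (g n x w)) \<le> (case (x, w) of (x, w) \<Rightarrow> ennreal (g (Suc n) x w))"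
        by eventually_elim (simp add: ennreal_leI)
    qed
  qed (rule measurable_case_prod_ennreal[OF gm])
  moreover have "AE w in M. cint M m (\<lambda>(x, w). ennreal (f x w)) w = cint M m (\<lambda>p. SUP n. case p of (x, w) \<Rightarrow> ennreal (g n x w)) w"
  proof (rule cint_cong_AE)
    show "AE p in m. (case p of (x, w) \<Rightarrow> ennreal (f x w)) = (SUP n. case p of (x, w) \<Rightarrow> ennreal (g n x w))"
      by (rule AE_fibres) (use g in simp)
  qed (intro borel_measurable_SUP measurable_case_prod_ennreal gm f countableI_type)+
  moreover have "AE w in M. stable_nn_integral M X \<X> \<mu> f w = (SUP n. elementary_integral M X \<X> \<mu> (g n) w)"
    using g by blast
  ultimately show ?thesis by eventually_elim auto
qed

end

subsection \<open>The product measure and Fubini's theorem over \<open>\<Omega>\<close>\<close>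

text \<open>A fibred product: \<open>(x, w)\<close> and \<open>(y, w)\<close> are combined only
  above the same \<open>w\<close>. The pairing \<open>pr\<close> is a parameter so that the same
  product can also be read with its factors exchanged.\<close>

locale fubini = A: fibred_space M X mX + B: fibred_space M Y mY
  for M :: "'w measure" and X :: "'x set" and mX and Y :: "'y set" and mY +
  fixes pr :: "'x \<Rightarrow> 'y \<Rightarrow> 'z"
begin

definition Z :: "'z set" where "Z = {pr x y | x y. x \<in> X \<and> y \<in> Y}"

text \<open>Slices are prescribed only up to null sets, so \<open>S\<close> and \<open>T\<close>
  admit many rectangles \<open>E\<close>. This places all sets with null slices among the
  generators.\<close>

definition rect :: "('x \<times> 'w) set \<Rightarrow> ('y \<times> 'w) set \<Rightarrow> ('z \<times> 'w) set \<Rightarrow> bool" where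
  "rect S T E \<longleftrightarrow> S \<in> sets mX \<and> T \<in> sets mY \<and> E \<subseteq> Z \<times> space M \<and>
     (\<forall>x\<in>X. \<forall>y\<in>Y. AE w in M. (pr x y, w) \<in> E \<longleftrightarrow> (x, w) \<in> S \<and> (y, w) \<in> T)"

definition rects :: "('z \<times> 'w) set set" where "rects = {E. \<exists>S T. rect S T E}"

definition sZ :: "('z \<times> 'w) measure" where "sZ = sigma (Z \<times> space M) rects"

text \<open>The conditional integral over \<open>Y\<close> of the section at \<open>x\<close>,
  viewed as a function on X \<times> \<Omega>. For each \<open>x\<close> it is an unrelated choice
  of density, so its joint measurability needs a proof.\<close>

definition kint :: "('z \<times> 'w \<Rightarrow> ennreal) \<Rightarrow> 'x \<times> 'w \<Rightarrow> ennreal" where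
  "kint h p = cint M mY (\<lambda>q. h (pr (fst p) (fst q), snd q)) (snd p)"

lemma rects_subset: "rects \<subseteq> Pow (Z \<times> space M)"
  unfolding rects_def rect_def by blast

lemma space_sZ: "space sZ = Z \<times> space M" and sets_sZ: "sets sZ = sigma_sets (Z \<times> space M) rects"
  unfolding sZ_def using rects_subset by (simp_all add: space_measure_of_conv)

lemma in_Z: "x \<in> X \<Longrightarrow> y \<in> Y \<Longrightarrow> pr x y \<in> Z"
  unfolding Z_def by blast

text \<open>The section of a rectangle at \<open>x\<close> is, up to null slices, \<open>T\<close>
  intersected with the cylinder over the slice of \<open>S\<close> at \<open>x\<close>.\<close>

lemma pr_measurable:
  assumes x: "x \<in> X"
  shows "(\<lambda>q. (pr x (fst q), snd q)) \<in> measurable mY sZ"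
  unfolding sZ_def
proof (rule measurable_measure_of[OF rects_subset])
  show "(\<lambda>q. (pr x (fst q), snd q)) \<in> space mY \<rightarrow> Z \<times> space M" using in_Z[OF x] by (auto simp: B.space_m)
  fix E assume "E \<in> rects"
  then obtain S T where E: "rect S T E" unfolding rects_def by blast
  have "T \<inter> Y \<times> (Pair x -` S) \<in> sets mY"
    using E B.cylinder[OF A.slice[OF _ x]] unfolding rect_def by auto
  then show "(\<lambda>q. (pr x (fst q), snd q)) -` E \<inter> space mY \<in> sets mY"
  proof (rule B.AE_cong_sets)
    fix y assume y: "y \<in> Y"
    then have "AE w in M. (pr x y, w) \<in> E \<longleftrightarrow> (x, w) \<in> S \<and> (y, w) \<in> T" using E x unfolding rect_def by blast
    then show "AE w in M. (y, w) \<in> (\<lambda>q. (pr x (fst q), snd q)) -` E \<inter> space mY \<longleftrightarrow> (y, w) \<in> T \<inter> Y \<times> Pair x -` S"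
      using AE_space by eventually_elim (use y in \<open>auto simp: B.space_m\<close>)
  qed (auto simp: B.space_m)
qed

lemma section_borel: "h \<in> borel_measurable sZ \<Longrightarrow> x \<in> X \<Longrightarrow> (\<lambda>q. h (pr x (fst q), snd q)) \<in> borel_measurable mY"
  using measurable_compose[OF pr_measurable] .

lemma kint_add:
  assumes "x \<in> X" "f \<in> borel_measurable sZ" "g \<in> borel_measurable sZ"
  shows "AE w in M. kint (\<lambda>p. f p + g p) (x, w) = kint f (x, w) + kint g (x, w)"
  unfolding kint_def fst_conv snd_conv by (intro B.cint_add section_borel assms)

lemma kint_mult:
  assumes "x \<in> X" "f \<in> borel_measurable sZ" "u \<in> borel_measurable M"
  shows "AE w in M. kint (\<lambda>p. u (snd p) * f p) (x, w) = u w * kint f (x, w)"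
  unfolding kint_def fst_conv snd_conv using B.cint_mult[OF section_borel[OF assms(2,1)] assms(3)] by simp

lemma kint_SUP:
  fixes f :: "nat \<Rightarrow> _"
  assumes "x \<in> X" "\<And>i. f i \<in> borel_measurable sZ" "incseq f"
  shows "AE w in M. kint (\<lambda>p. SUP i. f i p) (x, w) = (SUP i. kint (f i) (x, w))"
  unfolding kint_def fst_conv snd_conv
  by (intro B.cint_SUP section_borel assms AE_I2) (use assms(3) in \<open>auto simp: incseq_Suc_iff le_fun_def\<close>)

lemma kint_suminf:
  fixes f :: "nat \<Rightarrow> _"
  assumes "x \<in> X" "\<And>i. f i \<in> borel_measurable sZ"
  shows "AE w in M. kint (\<lambda>p. \<Sum>i. f i p) (x, w) = (\<Sum>i. kint (f i) (x, w))"
  unfolding kint_def fst_conv snd_conv by (intro B.cint_suminf section_borel assms)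

lemma kint_mono:
  assumes "x \<in> X" "f \<in> borel_measurable sZ" "g \<in> borel_measurable sZ" "\<And>p. p \<in> Z \<times> space M \<Longrightarrow> f p \<le> g p"
  shows "AE w in M. kint f (x, w) \<le> kint g (x, w)"
  unfolding kint_def fst_conv snd_conv
  by (intro B.cint_mono section_borel assms AE_I2) (use in_Z assms(1) in \<open>auto simp: B.space_m\<close>)

lemma kint_cong:
  assumes "x \<in> X" "f \<in> borel_measurable sZ" "g \<in> borel_measurable sZ" "\<And>p. p \<in> Z \<times> space M \<Longrightarrow> f p = g p"
  shows "AE w in M. kint f (x, w) = kint g (x, w)"
  unfolding kint_def fst_conv snd_conv
  by (intro B.cint_cong_AE section_borel assms AE_I2) (use in_Z assms(1) in \<open>auto simp: B.space_m\<close>)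

lemma kint_one: "AE w in M. kint (\<lambda>p. 1) (x, w) = 1"
  unfolding kint_def fst_conv snd_conv using B.cint_base[of "\<lambda>_. 1"] by simp

lemma rect_in_sets: "rect S T E \<Longrightarrow> E \<in> sets sZ"
  unfolding sets_sZ rects_def by blast

text \<open>For fixed \<open>x\<close> the slice of \<open>S\<close> is an event of \<Omega>, so its
  indicator leaves the conditional integral over \<open>Y\<close> as a factor.\<close>

lemma kint_rect:
  assumes E: "rect S T E" and x: "x \<in> X"
  shows "AE w in M. kint (indicator E) (x, w) = cint M mY (indicator T) w * indicator S (x, w)"
proof -
  have S[measurable]: "Pair x -` S \<in> sets M" and T[measurable]: "T \<in> sets mY" and Em[measurable]: "E \<in> sets sZ"
    using E A.slice[OF _ x] rect_in_sets unfolding rect_def by auto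
  have "AE w in M. kint (indicator E) (x, w) = cint M mY (\<lambda>q. indicator (Pair x -` S) (snd q) * indicator T q) w"
    unfolding kint_def fst_conv snd_conv
  proof (rule B.cint_cong_AE)
    show "(\<lambda>q. indicator E (pr x (fst q), snd q)) \<in> borel_measurable mY"
      by (rule section_borel[OF _ x]) measurable
    show "AE q in mY. indicator E (pr x (fst q), snd q) = (indicator (Pair x -` S) (snd q) * indicator T q :: ennreal)"
    proof (rule B.AE_fibres)
      fix y assume "y \<in> Y"
      then have "AE w in M. (pr x y, w) \<in> E \<longleftrightarrow> (x, w) \<in> S \<and> (y, w) \<in> T" using E x unfolding rect_def by blast
      then show "AE w in M. indicator E (pr x (fst (y, w)), snd (y, w)) =
          (indicator (Pair x -` S) (snd (y, w)) * indicator T (y, w) :: ennreal)"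
        by eventually_elim (auto simp: indicator_def)
    qed
  qed measurable
  moreover have "AE w in M. cint M mY (\<lambda>q. indicator (Pair x -` S) (snd q) * indicator T q) w =
      indicator (Pair x -` S) w * cint M mY (indicator T) w"
    by (intro B.cint_mult) auto
  ultimately show ?thesis by eventually_elim (auto simp: indicator_def)
qed

lemma Int_stable_rects: "Int_stable rects"
proof (rule Int_stableI)
  fix E F assume "E \<in> rects" "F \<in> rects"
  then obtain S T S' T' where E: "rect S T E" and F: "rect S' T' F" unfolding rects_def by blast
  have "rect (S \<inter> S') (T \<inter> T') (E \<inter> F)"
    unfolding rect_def
  proof (intro conjI ballI)
    fix x y assume xy: "x \<in> X" "y \<in> Y"
    have "AE w in M. (pr x y, w) \<in> E \<longleftrightarrow> (x, w) \<in> S \<and> (y, w) \<in> T"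
      "AE w in M. (pr x y, w) \<in> F \<longleftrightarrow> (x, w) \<in> S' \<and> (y, w) \<in> T'"
      using E F xy unfolding rect_def by blast+
    then show "AE w in M. (pr x y, w) \<in> E \<inter> F \<longleftrightarrow> (x, w) \<in> S \<inter> S' \<and> (y, w) \<in> T \<inter> T'"
      by eventually_elim auto
  qed (use E F in \<open>auto simp: rect_def\<close>)
  then show "E \<inter> F \<in> rects" unfolding rects_def by blast
qed

text \<open>In every case of the induction the chosen densities are compared, for each
  \<open>x\<close> separately, with an expression already known to be measurable;
  \<open>A.AE_cong_measurable\<close> absorbs the null sets depending on \<open>x\<close>.\<close>

lemma kint_indicator_measurable:
  assumes "E \<in> sets sZ"
  shows "kint (indicator E) \<in> borel_measurable mX"
  using Int_stable_rects rects_subset assms[unfolded sets_sZ]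
proof (induction rule: sigma_sets_induct_disjoint)
  case (basic E)
  then obtain S T where E: "rect S T E" unfolding rects_def by blast
  have S[measurable]: "S \<in> sets mX" using E unfolding rect_def by blast
  show ?case
  proof (rule A.AE_cong_measurable)
    show "AE w in M. kint (indicator E) (x, w) = (\<lambda>p. cint M mY (indicator T) (snd p) * indicator S p) (x, w)" if "x \<in> X" for x
      using kint_rect[OF E that] by simp
  qed (auto)
next
  case empty
  show ?case
  proof (rule A.AE_cong_measurable)
    show "AE w in M. kint (indicator {}) (x, w) = (\<lambda>p. 0) (x, w)" if "x \<in> X" for x
      using B.cint_zero by (simp add: kint_def)
  qed auto
next
  case (compl E)
  have [measurable]: "E \<in> sets sZ" using compl unfolding sets_sZ by simp
  note [measurable] = compl(2)
  show ?case
  proof (rule A.AE_cong_measurable)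
    fix x assume x: "x \<in> X"
    have [measurable]: "Z \<times> space M - E \<in> sets sZ" using sets.compl_sets[of E sZ] by (simp add: space_sZ)
    have "AE w in M. kint (\<lambda>p. indicator E p + indicator (Z \<times> space M - E) p) (x, w) = kint (\<lambda>p. 1) (x, w)"
    proof (rule kint_cong[OF x])
      show "indicator E p + indicator (Z \<times> space M - E) p = (1::ennreal)" if "p \<in> Z \<times> space M" for p
        using that by (simp add: indicator_def)
    qed measurable
    moreover have "AE w in M. kint (\<lambda>p. indicator E p + indicator (Z \<times> space M - E) p) (x, w) =
      kint (indicator E) (x, w) + kint (indicator (Z \<times> space M - E)) (x, w)"
      by (intro kint_add x) auto
    ultimately show "AE w in M. kint (indicator (Z \<times> space M - E)) (x, w) = (\<lambda>p. 1 - kint (indicator E) p) (x, w)"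
      using kint_one[of x]
    proof eventually_elim
      case (elim w)
      then have e: "kint (indicator E) (x, w) + kint (indicator (Z \<times> space M - E)) (x, w) = 1" by simp
      \<comment> \<open>The total conditional mass is 1, so the subtracted term is finite and
        cancellation in \<open>ennreal\<close> is legitimate.\<close>
      then have "kint (indicator E) (x, w) \<le> 1" by (metis le_iff_add)
      then have "kint (indicator E) (x, w) \<noteq> top" by (auto simp: top_unique)
      then have "(kint (indicator E) (x, w) + kint (indicator (Z \<times> space M - E)) (x, w)) - kint (indicator E) (x, w)
          = kint (indicator (Z \<times> space M - E)) (x, w)"
        by (simp add: ennreal_add_diff_cancel_left)
      then show ?case unfolding e by simp
    qed
  qed auto
next
  case (union E)
  have [measurable]: "E i \<in> sets sZ" for i using union unfolding sets_sZ by auto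
  note [measurable] = union(3)
  show ?case
  proof (rule A.AE_cong_measurable)
    fix x assume x: "x \<in> X"
    have "AE w in M. kint (indicator (\<Union>i. E i)) (x, w) = kint (\<lambda>p. \<Sum>i. indicator (E i) p) (x, w)"
      using union(1) by (intro kint_cong x) (auto simp: suminf_indicator)
    moreover have "AE w in M. kint (\<lambda>p. \<Sum>i. indicator (E i) p) (x, w) = (\<Sum>i. kint (indicator (E i)) (x, w))"
      by (intro kint_suminf x) auto
    ultimately show "AE w in M. kint (indicator (\<Union>i. E i)) (x, w) = (\<lambda>p. \<Sum>i. kint (indicator (E i)) p) (x, w)"
      by eventually_elim auto
  qed auto
qed

definition mZ :: "('z \<times> 'w) measure" where
  "mZ = measure_of (Z \<times> space M) (sigma_sets (Z \<times> space M) rects) (\<lambda>E. \<integral>\<^sup>+p. kint (indicator E) p \<partial>mX)"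

lemma sets_mZ: "sets mZ = sets sZ" and space_mZ: "space mZ = Z \<times> space M"
proof -
  interpret S: sigma_algebra "Z \<times> space M" "sigma_sets (Z \<times> space M) rects"
    by (rule sigma_algebra_sigma_sets[OF rects_subset])
  show "sets mZ = sets sZ" unfolding mZ_def sets_sZ by (rule S.sets_measure_of_eq)
  show "space mZ = Z \<times> space M" unfolding mZ_def by (rule S.space_measure_of_eq)
qed

lemma measurable_mZ: "measurable mZ N = measurable sZ N"
  by (rule measurable_cong_sets) (simp_all add: sets_mZ)

lemma emeasure_mZ:
  assumes E: "E \<in> sets sZ"
  shows "emeasure mZ E = (\<integral>\<^sup>+p. kint (indicator E) p \<partial>mX)"
  unfolding mZ_def
proof (rule emeasure_measure_of_sigma[OF sigma_algebra_sigma_sets[OF rects_subset]])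
  let ?f = "\<lambda>E. \<integral>\<^sup>+p. kint (indicator E) p \<partial>mX"
  have "?f {} = (\<integral>\<^sup>+p. 0 \<partial>mX)"
  proof (rule nn_integral_cong_AE, rule A.AE_fibres)
    fix x
    show "AE w in M. kint (indicator {}) (x, w) = 0" using B.cint_zero by (simp add: kint_def)
  qed
  then show "positive (sigma_sets (Z \<times> space M) rects) ?f" by (simp add: positive_def)
  show "countably_additive (sigma_sets (Z \<times> space M) rects) ?f"
    unfolding countably_additive_def
  proof (intro allI impI)
    fix E :: "nat \<Rightarrow> _" assume E: "range E \<subseteq> sigma_sets (Z \<times> space M) rects" "disjoint_family E"
    have Em[measurable]: "E i \<in> sets sZ" for i using E unfolding sets_sZ by auto
    have "(\<integral>\<^sup>+p. kint (indicator (\<Union>i. E i)) p \<partial>mX) = (\<integral>\<^sup>+p. (\<Sum>i. kint (indicator (E i)) p) \<partial>mX)"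
    proof (rule nn_integral_cong_AE, rule A.AE_fibres)
      fix x assume x: "x \<in> X"
      have "AE w in M. kint (indicator (\<Union>i. E i)) (x, w) = kint (\<lambda>p. \<Sum>i. indicator (E i) p) (x, w)"
        using E(2) by (intro kint_cong x) (auto simp: suminf_indicator)
      moreover have "AE w in M. kint (\<lambda>p. \<Sum>i. indicator (E i) p) (x, w) = (\<Sum>i. kint (indicator (E i)) (x, w))"
        by (intro kint_suminf x) auto
      ultimately show "AE w in M. kint (indicator (\<Union>i. E i)) (x, w) = (\<Sum>i. kint (indicator (E i)) (x, w))"
        by eventually_elim auto
    qed
    also have "\<dots> = (\<Sum>i. ?f (E i))"
      using kint_indicator_measurable[OF Em] by (rule nn_integral_suminf)
    finally show "(\<Sum>i. ?f (E i)) = ?f (\<Union>i. E i)" by simp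
  qed
qed (use E in \<open>simp add: sets_sZ\<close>)

lemma emeasure_rect:
  assumes E: "rect S T E"
  shows "emeasure mZ E = (\<integral>\<^sup>+w. cint M mX (indicator S) w * cint M mY (indicator T) w \<partial>M)"
proof -
  have S: "S \<in> sets mX" using E unfolding rect_def by blast
  have "emeasure mZ E = (\<integral>\<^sup>+p. kint (indicator E) p \<partial>mX)" by (rule emeasure_mZ[OF rect_in_sets[OF E]])
  also have "\<dots> = (\<integral>\<^sup>+p. indicator S p * cint M mY (indicator T) (snd p) \<partial>mX)"
    by (rule nn_integral_cong_AE, rule A.AE_fibres) (use kint_rect[OF E] in \<open>simp add: mult.commute\<close>)
  also have "\<dots> = (\<integral>\<^sup>+w. cint M mX (indicator S) w * cint M mY (indicator T) w \<partial>M)"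
    using S by (intro A.nn_integral_cint) auto
  finally show ?thesis .
qed

lemma rect_cylinder: "A \<in> sets M \<Longrightarrow> rect (X \<times> A) (Y \<times> space M) (Z \<times> A)"
  using A.cylinder B.cylinder[OF sets.top] sets.sets_into_space[of A M] in_Z by (auto simp: rect_def)

text \<open>Every set with null slices is a rectangle with empty sides; this yields both null-set
  axioms of \<open>fibred_space\<close> for the product.\<close>

lemma rect_null:
  "E \<subseteq> Z \<times> space M \<Longrightarrow> (\<And>z. z \<in> Z \<Longrightarrow> AE w in M. (z, w) \<notin> E) \<Longrightarrow> rect {} {} E"
  using in_Z by (auto simp: rect_def)

lemma cint_indicator_top:
  assumes "A \<in> sets M"
  shows "AE w in M. cint M mX (indicator (X \<times> A)) w = indicator A w"
    and "AE w in M. cint M mY (indicator (Y \<times> A)) w = indicator A w"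
proof -
  have "AE w in M. cint M mX (indicator (X \<times> A)) w = cint M mX (\<lambda>p. indicator A (snd p)) w"
    using A.cylinder[OF assms] assms by (intro A.cint_cong_AE AE_I2) (auto simp: A.space_m indicator_def)
  with A.cint_base[of "indicator A"] assms show "AE w in M. cint M mX (indicator (X \<times> A)) w = indicator A w"
    by auto
  have "AE w in M. cint M mY (indicator (Y \<times> A)) w = cint M mY (\<lambda>p. indicator A (snd p)) w"
    using B.cylinder[OF assms] assms by (intro B.cint_cong_AE AE_I2) (auto simp: B.space_m indicator_def)
  with B.cint_base[of "indicator A"] assms show "AE w in M. cint M mY (indicator (Y \<times> A)) w = indicator A w"
    by auto
qed

sublocale C: fibred_space M Z mZ
proof unfold_locales
  show "space mZ = Z \<times> space M" by (rule space_mZ)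
  show "Pair z -` E \<in> sets M" if "E \<in> sets mZ" "z \<in> Z" for E z
  proof -
    obtain x y where z: "z = pr x y" "x \<in> X" "y \<in> Y" using \<open>z \<in> Z\<close> unfolding Z_def by blast
    have E: "E \<in> sets sZ" using that sets_mZ by simp
    \<comment> \<open>The slice of \<open>E\<close> at \<open>pr x y\<close> is a section taken
      twice: at \<open>x\<close>, which leads to the space over \<open>Y\<close>, and then at
      \<open>y\<close>.\<close>
    have "(\<lambda>w. (pr x (fst (y, w)), snd (y, w))) \<in> measurable M sZ"
      by (rule measurable_compose[OF B.Pair_measurable[OF z(3)] pr_measurable[OF z(2)]])
    from measurable_sets[OF this E] have "Pair z -` E \<inter> space M \<in> sets M" by (simp add: z)
    moreover have "Pair z -` E \<inter> space M = Pair z -` E" using sets.sets_into_space[OF E] by (auto simp: space_sZ)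
    ultimately show ?thesis by simp
  qed
  show "E \<in> sets mZ" if "E \<subseteq> Z \<times> space M" "\<And>x. x \<in> Z \<Longrightarrow> AE w in M. (x, w) \<notin> E" for E
    using rect_in_sets[OF rect_null[OF that]] sets_mZ by simp
  show "Z \<times> A \<in> sets mZ" if "A \<in> sets M" for A
    using rect_in_sets[OF rect_cylinder[OF that]] sets_mZ by simp
  show "emeasure mZ E = 0" if "E \<subseteq> Z \<times> space M" "\<And>x. x \<in> Z \<Longrightarrow> AE w in M. (x, w) \<notin> E" for E
  proof -
    have "AE w in M. cint M mX (indicator {}) w = 0" using A.cint_zero by (simp add: indicator_def[abs_def])
    then have "(\<integral>\<^sup>+w. cint M mX (indicator {}) w * cint M mY (indicator {}) w \<partial>M) = (\<integral>\<^sup>+w. 0 \<partial>M)"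
      by (intro nn_integral_cong_AE) auto
    then show ?thesis using emeasure_rect[OF rect_null[OF that]] by simp
  qed
  show "emeasure mZ (Z \<times> A) = emeasure M A" if A: "A \<in> sets M" for A
  proof -
    have "(\<integral>\<^sup>+w. cint M mX (indicator (X \<times> A)) w * cint M mY (indicator (Y \<times> space M)) w \<partial>M) = (\<integral>\<^sup>+w. indicator A w \<partial>M)"
      by (rule nn_integral_cong_AE)
        (use cint_indicator_top(1)[OF A] cint_indicator_top(2)[OF sets.top] AE_space in \<open>eventually_elim, auto\<close>)
    then show ?thesis using emeasure_rect[OF rect_cylinder[OF A]] A by simp
  qed
qed

text \<open>Rectangles generate the \<sigma>-algebra and are closed under intersection, and the
  whole space is itself a rectangle of finite measure. This serves to identify the iterated measures
  with the one coming from the stable product measure.\<close>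

lemma mZ_unique:
  assumes sets: "sets N = sets sZ"
    and rect: "\<And>S T E. rect S T E \<Longrightarrow> emeasure N E = (\<integral>\<^sup>+w. cint M mX (indicator S) w * cint M mY (indicator T) w \<partial>M)"
  shows "N = mZ"
proof (rule measure_eqI_generator_eq[OF Int_stable_rects rects_subset, of _ _ "\<lambda>_. Z \<times> space M"])
  show "emeasure N E = emeasure mZ E" if "E \<in> rects" for E
    using that rect emeasure_rect unfolding rects_def by auto
  show "sets N = sigma_sets (Z \<times> space M) rects" "sets mZ = sigma_sets (Z \<times> space M) rects"
    using sets sets_mZ sets_sZ by auto
  have r: "rect (X \<times> space M) (Y \<times> space M) (Z \<times> space M)" by (rule rect_cylinder) simp
  then show "range (\<lambda>_::nat. Z \<times> space M) \<subseteq> rects" unfolding rects_def by auto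
  show "emeasure N (Z \<times> space M) \<noteq> \<infinity>"
    using rect[OF r] emeasure_rect[OF r] C.emeasure_cylinder[of "space M"] A.emeasure_space_1 by simp
qed auto

lemma fubini_nn:
  assumes "h \<in> borel_measurable sZ"
  shows "kint h \<in> borel_measurable mX \<and> (\<integral>\<^sup>+p. h p \<partial>mZ) = (\<integral>\<^sup>+p. kint h p \<partial>mX)"
  using assms
proof (induction rule: borel_measurable_induct)
  case (cong f g)
  have eq: "AE w in M. kint f (x, w) = kint g (x, w)" if "x \<in> X" for x
    by (rule kint_cong[OF that cong(1,2)]) (use cong(3) in \<open>auto simp: space_sZ\<close>)
  have "kint f \<in> borel_measurable mX"
    by (rule A.AE_cong_measurable[OF conjunct1[OF cong(4)] eq]) auto
  moreover have "(\<integral>\<^sup>+p. f p \<partial>mZ) = (\<integral>\<^sup>+p. g p \<partial>mZ)"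
    by (rule nn_integral_cong) (use cong(3) in \<open>auto simp: space_sZ space_mZ\<close>)
  moreover have "(\<integral>\<^sup>+p. kint f p \<partial>mX) = (\<integral>\<^sup>+p. kint g p \<partial>mX)"
    by (rule nn_integral_cong_AE, rule A.AE_fibres[OF eq])
  ultimately show ?case using cong(4) by simp
next
  case (set E)
  then show ?case using kint_indicator_measurable[OF set] emeasure_mZ[OF set] sets_mZ by simp
next
  case (mult u c)
  have eq: "AE w in M. kint (\<lambda>p. c * u p) (x, w) = c * kint u (x, w)" if "x \<in> X" for x
    using kint_mult[OF that mult(2), of "\<lambda>_. c"] by simp
  have m[measurable]: "kint u \<in> borel_measurable mX" using mult by blast
  have "kint (\<lambda>p. c * u p) \<in> borel_measurable mX"
    by (rule A.AE_cong_measurable[of "\<lambda>p. c * kint u p"]) (use eq in auto)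
  moreover have "(\<integral>\<^sup>+p. kint (\<lambda>p. c * u p) p \<partial>mX) = (\<integral>\<^sup>+p. c * kint u p \<partial>mX)"
    by (rule nn_integral_cong_AE, rule A.AE_fibres[OF eq])
  moreover have "(\<integral>\<^sup>+p. c * u p \<partial>mZ) = c * (\<integral>\<^sup>+p. u p \<partial>mZ)"
    using mult(2) by (intro nn_integral_cmult) (simp add: measurable_mZ)
  ultimately show ?case using mult(4) by (simp add: nn_integral_cmult)
next
  case (add u v)
  have eq: "AE w in M. kint (\<lambda>p. v p + u p) (x, w) = kint v (x, w) + kint u (x, w)" if "x \<in> X" for x
    by (rule kint_add[OF that]) (use add in auto)
  have m[measurable]: "kint u \<in> borel_measurable mX" "kint v \<in> borel_measurable mX" using add by blast+
  have "kint (\<lambda>p. v p + u p) \<in> borel_measurable mX"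
    by (rule A.AE_cong_measurable[of "\<lambda>p. kint v p + kint u p"]) (use eq in auto)
  moreover have "(\<integral>\<^sup>+p. kint (\<lambda>p. v p + u p) p \<partial>mX) = (\<integral>\<^sup>+p. kint v p + kint u p \<partial>mX)"
    by (rule nn_integral_cong_AE, rule A.AE_fibres[OF eq])
  moreover have "(\<integral>\<^sup>+p. v p + u p \<partial>mZ) = (\<integral>\<^sup>+p. v p \<partial>mZ) + (\<integral>\<^sup>+p. u p \<partial>mZ)"
    using add by (intro nn_integral_add) (simp_all add: measurable_mZ)
  ultimately show ?case using add by (simp add: nn_integral_add)
next
  case (seq U)
  have inc: "incseq U" using seq by blast
  have um: "U i \<in> borel_measurable sZ" for i using seq by blast
  have m[measurable]: "kint (U i) \<in> borel_measurable mX" for i using seq by blast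
  have eq: "AE w in M. kint (\<lambda>p. SUP i. U i p) (x, w) = (SUP i. kint (U i) (x, w))" if "x \<in> X" for x
    by (rule kint_SUP[OF that um inc])
  have "kint (\<lambda>p. SUP i. U i p) \<in> borel_measurable mX"
    by (rule A.AE_cong_measurable[of "\<lambda>p. SUP i. kint (U i) p"]) (use eq in auto)
  moreover have "(\<integral>\<^sup>+p. kint (\<lambda>p. SUP i. U i p) p \<partial>mX) = (\<integral>\<^sup>+p. (SUP i. kint (U i) p) \<partial>mX)"
    by (rule nn_integral_cong_AE, rule A.AE_fibres[OF eq])
  moreover have "(\<integral>\<^sup>+p. (SUP i. kint (U i) p) \<partial>mX) = (SUP i. \<integral>\<^sup>+p. kint (U i) p \<partial>mX)"
  proof (rule nn_integral_monotone_convergence_SUP_AE)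
    fix i
    show "AE p in mX. kint (U i) p \<le> kint (U (Suc i)) p"
      by (rule A.AE_fibres, rule kint_mono) (use um incseq_SucD[OF inc] in \<open>auto simp: le_fun_def\<close>)
  qed auto
  moreover have "(\<integral>\<^sup>+p. (SUP i. U i p) \<partial>mZ) = (SUP i. \<integral>\<^sup>+p. U i p \<partial>mZ)"
    by (rule nn_integral_monotone_convergence_SUP[OF inc]) (use um in \<open>simp add: measurable_mZ\<close>)
  moreover have "(SUP i. \<integral>\<^sup>+p. U i p \<partial>mZ) = (SUP i. \<integral>\<^sup>+p. kint (U i) p \<partial>mX)"
    using seq by simp
  ultimately show ?case by (simp add: image_comp)
qed

lemma kint_measurable[measurable]: "h \<in> borel_measurable mZ \<Longrightarrow> kint h \<in> borel_measurable mX"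
  using fubini_nn by (simp add: measurable_mZ)

text \<open>The tower property. Tested on an event \<open>A\<close>, its indicator depends only on
  \<open>w\<close> and can be moved inside \<open>kint\<close>; what remains is the unconditional
  Fubini identity.\<close>

lemma cint_kint:
  assumes h[measurable]: "h \<in> borel_measurable mZ"
  shows "AE w in M. cint M mX (kint h) w = cint M mZ h w"
proof (rule A.cint_unique)
  fix A assume A[measurable]: "A \<in> sets M"
  have h': "h \<in> borel_measurable sZ" using h by (simp add: measurable_mZ)
  have hA: "(\<lambda>p. indicator A (snd p) * h p) \<in> borel_measurable mZ" by measurable
  have "(\<integral>\<^sup>+p. kint h p * indicator A (snd p) \<partial>mX) = (\<integral>\<^sup>+p. kint (\<lambda>p. indicator A (snd p) * h p) p \<partial>mX)"
  proof (rule nn_integral_cong_AE, rule A.AE_fibres)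
    fix x assume "x \<in> X"
    from kint_mult[OF this h', of "indicator A"]
    show "AE w in M. kint h (x, w) * indicator A (snd (x, w)) = kint (\<lambda>p. indicator A (snd p) * h p) (x, w)"
      by (auto simp: mult.commute elim: eventually_mono)
  qed
  also have "\<dots> = (\<integral>\<^sup>+p. indicator A (snd p) * h p \<partial>mZ)"
    using fubini_nn hA by (simp add: measurable_mZ)
  also have "\<dots> = (\<integral>\<^sup>+w. cint M mZ h w * indicator A w \<partial>M)"
    using C.nn_integral_cint[OF h, of "indicator A"] by (simp add: mult.commute)
  finally show "(\<integral>\<^sup>+p. kint h p * indicator A (snd p) \<partial>mX) = (\<integral>\<^sup>+w. cint M mZ h w * indicator A w \<partial>M)" .
qed measurable

end

subsection \<open>Fubini's theorem for integrable functions\<close>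

lemma ennreal_max_zero:
  fixes a :: real
  shows "ennreal (max a 0) = ennreal a" "ennreal (max (- a) 0) = ennreal (- a)"
  by (auto simp: max_def ennreal_neg)

locale stable_fubini = A: stable_prob M X \<X> \<mu> + B: stable_prob M Y \<Y> \<nu>
  for M :: "'w measure" and X :: "('w \<Rightarrow> 'a) set" and \<X> \<mu> and Y :: "('w \<Rightarrow> 'b) set" and \<Y> \<nu> +
  fixes pr :: "('w \<Rightarrow> 'a) \<Rightarrow> ('w \<Rightarrow> 'b) \<Rightarrow> 'w \<Rightarrow> 'c"
begin

sublocale fubini M X A.m Y B.m pr
  by unfold_locales

context
  fixes f :: "('w \<Rightarrow> 'c) \<Rightarrow> 'w \<Rightarrow> real"
  assumes f: "case_prod f \<in> borel_measurable mZ"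
    and fin: "AE w in M. cint M mZ (\<lambda>(z, w). ennreal (f z w)) w < \<infinity>"
      "AE w in M. cint M mZ (\<lambda>(z, w). ennreal (- f z w)) w < \<infinity>"
begin

abbreviation "fp \<equiv> \<lambda>(z, w). ennreal (f z w)"
abbreviation "fn \<equiv> \<lambda>(z, w). ennreal (- f z w)"
abbreviation "F \<equiv> \<lambda>x. stable_integral M Y \<Y> \<nu> (\<lambda>y. f (pr x y))"

text \<open>A jointly measurable version of \<open>F\<close>, whose values are chosen by
  \<open>SOME\<close> for each \<open>x\<close>. It follows the convention of
  \<open>stable_integral\<close> in being 0 where one of the two parts is infinite.\<close>

definition G :: "('w \<Rightarrow> 'a) \<Rightarrow> 'w \<Rightarrow> real" where
  "G x w = (if kint fp (x, w) < \<infinity> \<and> kint fn (x, w) < \<infinity>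
     then enn2real (kint fp (x, w)) - enn2real (kint fn (x, w)) else 0)"

lemma fpn_measurable[measurable]: "fp \<in> borel_measurable mZ" "fn \<in> borel_measurable mZ"
  using measurable_compose[OF f measurable_ennreal]
    measurable_compose[OF borel_measurable_uminus[OF f] measurable_ennreal]
  by (simp_all add: case_prod_unfold)

lemma section_measurable_f:
  assumes x: "x \<in> X"
  shows "case_prod (\<lambda>y. f (pr x y)) \<in> borel_measurable B.m"
  using measurable_compose[OF pr_measurable[OF x], of "case_prod f" borel] f
  by (simp add: measurable_mZ case_prod_unfold)

lemma nn_integral_section:
  assumes x: "x \<in> X"
  shows "AE w in M. stable_nn_integral M Y \<Y> \<nu> (pos_part (\<lambda>y. f (pr x y))) w = kint fp (x, w)"
    and "AE w in M. stable_nn_integral M Y \<Y> \<nu> (neg_part (\<lambda>y. f (pr x y))) w = kint fn (x, w)"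
proof -
  note [measurable] = section_measurable_f[OF x]
  have "(\<lambda>p. max (case_prod (\<lambda>y. f (pr x y)) p) 0) \<in> borel_measurable B.m"
    "(\<lambda>p. max (- case_prod (\<lambda>y. f (pr x y)) p) 0) \<in> borel_measurable B.m" by measurable
  then have m: "case_prod (pos_part (\<lambda>y. f (pr x y))) \<in> borel_measurable B.m"
    "case_prod (neg_part (\<lambda>y. f (pr x y))) \<in> borel_measurable B.m"
    by (simp_all add: pos_part_def neg_part_def case_prod_unfold)
  show "AE w in M. stable_nn_integral M Y \<Y> \<nu> (pos_part (\<lambda>y. f (pr x y))) w = kint fp (x, w)"
    using B.stable_nn_integral_eq_cint[OF m(1)] by (simp add: kint_def pos_part_def ennreal_max_zero case_prod_unfold)
  show "AE w in M. stable_nn_integral M Y \<Y> \<nu> (neg_part (\<lambda>y. f (pr x y))) w = kint fn (x, w)"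
    using B.stable_nn_integral_eq_cint[OF m(2)] by (simp add: kint_def neg_part_def ennreal_max_zero case_prod_unfold)
qed

lemma F_eq_G: "x \<in> X \<Longrightarrow> AE w in M. F x w = G x w"
  using nn_integral_section(1)[of x] nn_integral_section(2)[of x]
  by (auto elim!: eventually_elim2 simp: stable_integral_def G_def Let_def)

lemma G_measurable[measurable]: "case_prod G \<in> borel_measurable A.m"
proof -
  have "(\<lambda>p. if kint fp p < \<infinity> \<and> kint fn p < \<infinity> then enn2real (kint fp p) - enn2real (kint fn p) else 0)
      \<in> borel_measurable A.m"
    by measurable
  also have "(\<lambda>p. if kint fp p < \<infinity> \<and> kint fn p < \<infinity> then enn2real (kint fp p) - enn2real (kint fn p) else 0) = case_prod G"
    by (rule ext) (simp add: G_def split: prod.split)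
  finally show ?thesis .
qed

lemma F_measurable: "case_prod F \<in> borel_measurable A.m"
  by (rule A.AE_cong_measurable[OF G_measurable]) (use F_eq_G in auto)

lemma cint_kint_finite:
  "AE w in M. cint M A.m (kint fp) w < \<infinity>" "AE w in M. cint M A.m (kint fn) w < \<infinity>"
  using cint_kint[OF fpn_measurable(1)] cint_kint[OF fpn_measurable(2)] fin by (auto elim: eventually_elim2)

lemma kint_finite: "AE p in A.m. kint fp p < \<infinity> \<and> kint fn p < \<infinity>"
  using A.AE_finite_of_cint[OF _ cint_kint_finite(1)] A.AE_finite_of_cint[OF _ cint_kint_finite(2)]
  by (auto intro: AE_conjI)

abbreviation "Gp \<equiv> \<lambda>p. ennreal (case_prod G p)"
abbreviation "Gn \<equiv> \<lambda>p. ennreal (- case_prod G p)"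

lemma nn_integral_F:
  "AE w in M. stable_nn_integral M X \<X> \<mu> (pos_part F) w = cint M A.m Gp w"
  "AE w in M. stable_nn_integral M X \<X> \<mu> (neg_part F) w = cint M A.m Gn w"
proof -
  note [measurable] = F_measurable
  have "(\<lambda>p. max (case_prod F p) 0) \<in> borel_measurable A.m"
    "(\<lambda>p. max (- case_prod F p) 0) \<in> borel_measurable A.m" by measurable
  then have m: "case_prod (pos_part F) \<in> borel_measurable A.m" "case_prod (neg_part F) \<in> borel_measurable A.m"
    by (simp_all add: pos_part_def neg_part_def case_prod_unfold)
  have eq: "AE p in A.m. case_prod F p = case_prod G p" by (rule A.AE_fibres) (use F_eq_G in simp)
  have "AE w in M. cint M A.m (\<lambda>p. ennreal (case_prod F p)) w = cint M A.m Gp w"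
    "AE w in M. cint M A.m (\<lambda>p. ennreal (- case_prod F p)) w = cint M A.m Gn w"
    by (rule A.cint_cong_AE; use eq in auto)+
  with A.stable_nn_integral_eq_cint[OF m(1)] A.stable_nn_integral_eq_cint[OF m(2)]
  show "AE w in M. stable_nn_integral M X \<X> \<mu> (pos_part F) w = cint M A.m Gp w"
    "AE w in M. stable_nn_integral M X \<X> \<mu> (neg_part F) w = cint M A.m Gn w"
    by (auto elim!: eventually_elim2 simp: pos_part_def neg_part_def ennreal_max_zero case_prod_unfold)
qed

text \<open>Cancellation prevents the positive part of \<open>G\<close> from being
  \<open>kint fp\<close>; only the inequality and the identity G^+ + \<open>kint fn\<close> = G^- +
  \<open>kint fp\<close> hold. As \<open>ennreal\<close> truncates negative numbers,
  \<open>Gp\<close> and \<open>Gn\<close> are these parts of \<open>G\<close>. Integrating the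
  identity and subtracting, which finiteness permits, gives the claim.\<close>

lemma cint_G:
  "AE w in M. cint M A.m Gp w < \<infinity> \<and> cint M A.m Gn w < \<infinity> \<and>
    enn2real (cint M A.m Gp w) - enn2real (cint M A.m Gn w)
     = enn2real (cint M mZ fp w) - enn2real (cint M mZ fn w)"
proof -
  have pt: "ennreal (G x w) \<le> kint fp (x, w)" "ennreal (- G x w) \<le> kint fn (x, w)"
    "kint fp (x, w) < \<infinity> \<and> kint fn (x, w) < \<infinity> \<Longrightarrow>
      ennreal (G x w) + kint fn (x, w) = ennreal (- G x w) + kint fp (x, w)" for x w
  proof -
    \<comment> \<open>Where one of the integrals is infinite, \<open>G\<close> is 0 by convention,
      so the two bounds persist; the identity is claimed only at finite values.\<close>
    consider (fin) a b where "kint fp (x, w) = ennreal a" "kint fn (x, w) = ennreal b" "0 \<le> a" "0 \<le> b"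
      | (inf) "kint fp (x, w) = \<infinity> \<or> kint fn (x, w) = \<infinity>"
      by (cases "kint fp (x, w)"; cases "kint fn (x, w)") auto
    note cs = this
    show "ennreal (G x w) \<le> kint fp (x, w)" "ennreal (- G x w) \<le> kint fn (x, w)"
      by (cases rule: cs; auto simp: G_def intro!: ennreal_leI)+
    show "kint fp (x, w) < \<infinity> \<and> kint fn (x, w) < \<infinity> \<Longrightarrow>
      ennreal (G x w) + kint fn (x, w) = ennreal (- G x w) + kint fp (x, w)"
    proof (cases rule: cs)
      case fin
      then have "G x w = a - b" by (simp add: G_def)
      with fin show ?thesis
        by (cases "b \<le> a") (simp_all add: ennreal_neg flip: ennreal_plus)
    qed auto
  qed
  have gm[measurable]: "Gp \<in> borel_measurable A.m"
    "Gn \<in> borel_measurable A.m" by measurable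
  have "AE p in A.m. ennreal (case_prod G p) \<le> kint fp p" "AE p in A.m. ennreal (- case_prod G p) \<le> kint fn p"
    using pt(1,2) by (simp_all split: prod.split)
  note le = this
  have 1: "AE w in M. cint M A.m Gp w \<le> cint M A.m (kint fp) w"
    "AE w in M. cint M A.m Gn w \<le> cint M A.m (kint fn) w"
    by (intro A.cint_mono gm kint_measurable fpn_measurable le)+
  have 2: "AE w in M. cint M A.m (\<lambda>p. ennreal (case_prod G p) + kint fn p) w = cint M A.m (\<lambda>p. ennreal (- case_prod G p) + kint fp p) w"
  proof (rule A.cint_cong_AE)
    show "AE p in A.m. ennreal (case_prod G p) + kint fn p = ennreal (- case_prod G p) + kint fp p"
      using kint_finite
    proof eventually_elim
      case (elim p)
      then show ?case using pt(3)[of "fst p" "snd p"] by (simp add: split_beta)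
    qed
  qed measurable
  have 3: "AE w in M. cint M A.m (\<lambda>p. ennreal (case_prod G p) + kint fn p) w = cint M A.m Gp w + cint M A.m (kint fn) w"
    "AE w in M. cint M A.m (\<lambda>p. ennreal (- case_prod G p) + kint fp p) w = cint M A.m Gn w + cint M A.m (kint fp) w"
    by (rule A.cint_add; measurable)+
  show ?thesis
    using 1 2 3 cint_kint[OF fpn_measurable(1)] cint_kint[OF fpn_measurable(2)] fin
  proof eventually_elim
    case (elim w)
    have lt: "cint M A.m Gp w < \<infinity>" "cint M A.m Gn w < \<infinity>"
      using le_less_trans[OF elim(1)] le_less_trans[OF elim(2)] elim(6-9) by auto
    have "cint M A.m Gp w + cint M mZ fn w =
      cint M A.m Gn w + cint M mZ fp w"
      using elim by simp
    note arg_cong[OF this, of enn2real]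
    moreover have "enn2real (cint M A.m Gp w + cint M mZ fn w) =
        enn2real (cint M A.m Gp w) + enn2real (cint M mZ fn w)"
      "enn2real (cint M A.m Gn w + cint M mZ fp w) =
        enn2real (cint M A.m Gn w) + enn2real (cint M mZ fp w)"
      by (rule enn2real_plus; use lt elim(8,9) in simp)+
    ultimately have "enn2real (cint M A.m Gp w) + enn2real (cint M mZ fn w) =
      enn2real (cint M A.m Gn w) + enn2real (cint M mZ fp w)"
      by simp
    then show ?case using lt by simp
  qed
qed

lemma stable_integrable_F: "stable_integrable M X \<X> \<mu> F"
  unfolding stable_integrable_def
  using A.stably_measurableI[OF F_measurable] nn_integral_F cint_G
  by (auto elim!: eventually_elim2)

lemma stable_integral_F:
  "AE w in M. stable_integral M X \<X> \<mu> F w = enn2real (cint M mZ fp w) - enn2real (cint M mZ fn w)"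
  using nn_integral_F cint_G
proof eventually_elim
  case (elim w)
  then show ?case by (simp add: stable_integral_def Let_def)
qed

text \<open>The set where both parts of the inner integral are finite is a graph of full measure.
  Since its domain is then almost all of \<Omega>, it represents \<open>V|\<Omega>\<close> for the
  set \<open>V\<close> of those \<open>x\<close> whose section has almost surely finite
  integrals.\<close>

lemma stable_AE_section_integrable: "stable_AE M X \<X> \<mu> (\<lambda>x. stable_integrable M Y \<Y> \<nu> (\<lambda>y. f (pr x y)))"
proof -
  define E where "E = {p \<in> space A.m. kint fp p < \<infinity> \<and> kint fn p < \<infinity>}"
  have E[measurable]: "E \<in> sets A.m" unfolding E_def by measurable
  then obtain S where S: "S \<in> \<X>" "represents M X S E"
    unfolding A.sets_graph_measure using A.graph_algebraD by blast
  have "AE w in M. cint M A.m (indicator E) w = cint M A.m (\<lambda>p. 1) w"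
    by (rule A.cint_cong_AE) (use kint_finite AE_space in \<open>auto simp: E_def elim!: eventually_elim2\<close>)
  moreover have "AE w in M. cint M A.m (\<lambda>p. 1) w = 1" using A.cint_base[of "\<lambda>_. 1"] by simp
  ultimately have \<mu>1: "AE w in M. \<mu> S w = 1"
    using A.cint_indicator[OF S] by eventually_elim auto
  obtain x0 where x0: "x0 \<in> X" "AE w in M. w \<in> cond_dom M S \<longleftrightarrow> (x0, w) \<in> E"
    using A.represents_dom(2)[OF S(2)] by blast
  \<comment> \<open>By (M1) the value of \<mu> vanishes off the domain of \<open>S\<close>; being 1
    almost surely, it forces the domain, and with it the slice at \<open>x0\<close>, to have full
    probability.\<close>
  have x0E: "AE w in M. (x0, w) \<in> E"
    using x0(2) \<mu>1 A.\<mu>_dom[OF S(1)] by eventually_elim auto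
  let ?V = "{x \<in> X. AE w\<in>space M in M. (x, w) \<in> E}"
  have rep: "represents M X (cond_set M ?V (space M)) E"
    by (rule A.represents_cond_set[OF A.X A.stable_graph_of[OF S(2)] sets.top _ x0(1)])
      (use x0E in \<open>auto simp: E_def A.space_graph_measure elim: eventually_mono\<close>)
  have eqS: "cond_set M ?V (space M) = S" by (rule A.represents_unique[OF A.X rep S(2)])
  show ?thesis
    unfolding stable_AE_def
  proof (intro exI[of _ ?V] conjI ballI)
    show "stable M ?V"
      by (rule A.stable_containing_slices[OF A.X A.stable_graph_of[OF S(2)] x0(1)]) (use x0E in auto)
    show "cond_set M ?V (space M) \<in> \<X>" "AE w in M. \<mu> (cond_set M ?V (space M)) w = 1"
      unfolding eqS by (rule S(1)) (rule \<mu>1)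
    fix x assume "x \<in> ?V"
    then have x: "x \<in> X" and "AE w\<in>space M in M. (x, w) \<in> E" by auto
    note E = this(2)
    have "AE w in M. stable_nn_integral M Y \<Y> \<nu> (pos_part (\<lambda>y. f (pr x y))) w < \<infinity>"
      using nn_integral_section(1)[OF x] E AE_space by eventually_elim (simp add: E_def)
    moreover have "AE w in M. stable_nn_integral M Y \<Y> \<nu> (neg_part (\<lambda>y. f (pr x y))) w < \<infinity>"
      using nn_integral_section(2)[OF x] E AE_space by eventually_elim (simp add: E_def)
    ultimately show "stable_integrable M Y \<Y> \<nu> (\<lambda>y. f (pr x y))"
      unfolding stable_integrable_def using B.stably_measurableI[OF section_measurable_f[OF x]] by blast
  qed auto
qed

end

end

subsection \<open>The stable product measure\<close>

lemma stable_stable_prod: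
  assumes V: "stable M V" and W: "stable M W"
  shows "stable M (stable_prod V W)"
  unfolding stable_def
proof (intro conjI allI impI)
  show "stable_prod V W \<noteq> {}"
    using stable_nonempty[OF V] stable_nonempty[OF W] unfolding stable_prod_def by blast
  fix A z y assume A: "partition_of M A" and z: "range z \<subseteq> stable_prod V W" and y: "is_concat M A z y"
  have "\<forall>k. \<exists>v u. v \<in> V \<and> u \<in> W \<and> z k = fpair v u" using z unfolding stable_prod_def by blast
  then obtain v u where vu: "\<And>k. v k \<in> V" "\<And>k. u k \<in> W" "\<And>k. z k = fpair (v k) (u k)" by metis
  have "is_concat M A v (fst \<circ> y)" "is_concat M A u (snd \<circ> y)"
    using y unfolding is_concat_def by (eventually_elim, simp add: vu fpair_def)+
  then have "fst \<circ> y \<in> V" "snd \<circ> y \<in> W"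
    using stable_concat[OF V A] stable_concat[OF W A] vu by blast+
  moreover have "y = fpair (fst \<circ> y) (snd \<circ> y)" by (simp add: fpair_def fun_eq_iff)
  ultimately show "y \<in> stable_prod V W" unfolding stable_prod_def by blast
qed

context complete_prob_space
begin

text \<open>Agreement of \<open>fpair x y\<close> with a member of \<open>stable_prod V W\<close> is
  agreement in each component, so witnesses for the factors combine into a pair and a pair splits
  into witnesses.\<close>

lemma represents_stable_prod:
  assumes S: "represents M X (cond_set M V A) S" and V: "V \<subseteq> X" "stable M V" and A: "A \<in> sets M"
    and T: "represents M Y (cond_set M W B) T" and W: "W \<subseteq> Y" "stable M W" and B: "B \<in> sets M"
    and E: "E \<subseteq> stable_prod X Y \<times> space M"
      "\<And>x y. x \<in> X \<Longrightarrow> y \<in> Y \<Longrightarrow> AE w in M. (fpair x y, w) \<in> E \<longleftrightarrow> (x, w) \<in> S \<and> (y, w) \<in> T"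
  shows "represents M (stable_prod X Y) (cond_set M (stable_prod V W) (A \<inter> B)) E"
proof (rule representsI)
  show "stable_prod V W \<subseteq> stable_prod X Y" using V W unfolding stable_prod_def by blast
  show "stable M (stable_prod V W)" by (rule stable_stable_prod[OF V(2) W(2)])
  fix z assume "z \<in> stable_prod X Y"
  then obtain x y where z: "z = fpair x y" "x \<in> X" "y \<in> Y" unfolding stable_prod_def by blast
  have sl: "Pair x -` S \<in> sets M" "Pair y -` T \<in> sets M" using slice_sets[OF S z(2)] slice_sets[OF T z(3)] .
  show "Pair z -` E \<in> sets M"
  proof (rule in_sets_AE)
    show "AE w in M. w \<in> Pair x -` S \<inter> Pair y -` T \<longleftrightarrow> w \<in> Pair z -` E"
      using E(2)[OF z(2,3)] by eventually_elim (simp add: z)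
  qed (use sl E(1) in auto)
  have "AE w\<in>Pair x -` S in M. (x, w) \<in> S" "AE w\<in>Pair y -` T in M. (y, w) \<in> T" by auto
  then obtain v u where v: "v \<in> V" "AE w\<in>Pair x -` S in M. w \<in> A \<and> x w = v w"
    and u: "u \<in> W" "AE w\<in>Pair y -` T in M. w \<in> B \<and> y w = u w"
    unfolding represents_graph_iff[OF S V(2) A z(2) sl(1)] represents_graph_iff[OF T W(2) B z(3) sl(2)] by blast
  have "AE w in M. (z, w) \<in> E \<longrightarrow> w \<in> A \<inter> B \<and> z w = fpair v u w"
    using E(2)[OF z(2,3)] v(2) u(2) by eventually_elim (simp add: z fpair_def)
  then show "\<exists>v\<in>stable_prod V W. AE w in M. (z, w) \<in> E \<longrightarrow> w \<in> A \<inter> B \<and> z w = v w"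
    using v(1) u(1) unfolding stable_prod_def by blast
  fix v' D assume "v' \<in> stable_prod V W" and D: "D \<in> sets M" "AE w\<in>D in M. w \<in> A \<inter> B \<and> z w = v' w"
  then obtain v u where v': "v' = fpair v u" "v \<in> V" "u \<in> W" unfolding stable_prod_def by blast
  have "AE w\<in>D in M. w \<in> A \<and> x w = v w" "AE w\<in>D in M. w \<in> B \<and> y w = u w"
    using D(2) by (eventually_elim, simp add: z v' fpair_def)+
  then have "AE w\<in>D in M. (x, w) \<in> S" "AE w\<in>D in M. (y, w) \<in> T"
    unfolding represents_graph_iff[OF S V(2) A z(2) D(1)] represents_graph_iff[OF T W(2) B z(3) D(1)]
    using v'(2,3) by blast+
  then show "AE w\<in>D in M. (z, w) \<in> E"
    using E(2)[OF z(2,3)] by eventually_elim (simp add: z)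
qed (use A B E(1) in auto)

text \<open>\<U> guarantees that the intersection runs over a nonempty family and hence consists of
  conditional subsets of \<open>X\<close>.\<close>

lemma stable_sigma_algebra_gen:
  assumes X: "stable M X" and U: "stable_sigma_algebra M X \<U>" "\<G> \<subseteq> \<U>"
  shows "stable_sigma_algebra M X (stable_sigma_gen M X \<G>)"
  unfolding stable_sigma_algebra_def stable_collection_def
proof (intro conjI allI impI ballI)
  let ?\<H> = "{\<X>. stable_sigma_algebra M X \<X> \<and> \<G> \<subseteq> \<X>}"
  have alg: "stable_algebra M X \<X>" if "\<X> \<in> ?\<H>" for \<X>
    using that X by unfold_locales auto
  show top: "cond_top M X \<in> stable_sigma_gen M X \<G>"
    unfolding stable_sigma_gen_def using stable_algebra.top_in[OF alg] by blast
  then show "stable_sigma_gen M X \<G> \<noteq> {}" by blast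
  show "stable_sigma_gen M X \<G> \<subseteq> cond_Pow M X"
    unfolding stable_sigma_gen_def using stable_algebra.in_cond_Pow[OF alg] U by blast
  show "cond_compl M X S \<in> stable_sigma_gen M X \<G>" if "S \<in> stable_sigma_gen M X \<G>" for S
    using that unfolding stable_sigma_gen_def using stable_algebra.compl_in[OF alg] by blast
  show "cond_Sup M X (range S) \<in> stable_sigma_gen M X \<G>" if "range S \<subseteq> stable_sigma_gen M X \<G>" for S :: "nat \<Rightarrow> _"
    using that unfolding stable_sigma_gen_def using stable_algebra.Sup_in[OF alg] by blast
  show "cond_concat M A S \<in> stable_sigma_gen M X \<G>"
    if "partition_of M A" "range S \<subseteq> stable_sigma_gen M X \<G>" for A S
    using that unfolding stable_sigma_gen_def using stable_algebra.concat_in[OF alg] by blast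
qed

end

section \<open>The stable product space as a fibred product over \<Omega>\<close>

locale stable_product = A: stable_prob M X \<X> \<mu> + B: stable_prob M Y \<Y> \<nu>
  for M :: "'w measure" and X :: "('w \<Rightarrow> 'a) set" and \<X> \<mu> and Y :: "('w \<Rightarrow> 'b) set" and \<Y> \<nu>
begin

sublocale P: stable_fubini M X \<X> \<mu> Y \<Y> \<nu> fpair
  by unfold_locales

text \<open>The same product with exchanged roles: here the inner integral runs over
  \<open>X\<close> and the outer one over \<open>Y\<close>, while the pairing still yields elements
  of \<open>stable_prod X Y\<close>.\<close>

sublocale Q: stable_fubini M Y \<Y> \<nu> X \<X> \<mu> "\<lambda>y x. fpair x y"
  by unfold_locales

abbreviation "Z \<equiv> stable_prod X Y"
abbreviation "\<Z> \<equiv> stable_prod_algebra M X \<X> Y \<Y>"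

definition "gens = {cond_set M (stable_prod V W) (A \<inter> B) | V A W B.
        V \<subseteq> X \<and> stable M V \<and> A \<in> sets M \<and> cond_set M V A \<in> \<X> \<and>
        W \<subseteq> Y \<and> stable M W \<and> B \<in> sets M \<and> cond_set M W B \<in> \<Y>}"

lemma PZ: "P.Z = Z" and QZ: "Q.Z = Z"
  unfolding P.Z_def Q.Z_def stable_prod_def by blast+

lemma Qrect: "Q.rect T S E \<longleftrightarrow> P.rect S T E"
  unfolding P.rect_def Q.rect_def PZ QZ by (auto simp: conj_commute)

lemma QsZ: "Q.sZ = P.sZ"
  unfolding P.sZ_def Q.sZ_def PZ QZ P.rects_def Q.rects_def Qrect by metis

lemma Z_stable: "stable M Z"
  by (rule stable_stable_prod[OF A.X B.X])

interpretation Z: stable_space M Z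
  by unfold_locales (rule Z_stable)

text \<open>With \<open>gen_rect\<close> this matches the generators on both sides: rectangles of
  graphs on the one hand, graphs of conditional rectangles on the other.\<close>

lemma rect_represented:
  assumes E: "P.rect S T E"
  obtains V A W B where "V \<subseteq> X" "stable M V" "A \<in> sets M" "cond_set M V A \<in> \<X>" "represents M X (cond_set M V A) S"
    "W \<subseteq> Y" "stable M W" "B \<in> sets M" "cond_set M W B \<in> \<Y>" "represents M Y (cond_set M W B) T"
    "represents M Z (cond_set M (stable_prod V W) (A \<inter> B)) E"
proof -
  obtain S' T' where S': "S' \<in> \<X>" "represents M X S' S" and T': "T' \<in> \<Y>" "represents M Y T' T"
    using E A.graph_algebraD B.graph_algebraD unfolding P.rect_def A.sets_graph_measure B.sets_graph_measure by blast
  obtain V A where V: "S' = cond_set M V A" "V \<subseteq> X" "stable M V" "A \<in> sets M"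
    using A.in_cond_Pow[OF S'(1)] by (auto elim: cond_PowE)
  obtain W B where W: "T' = cond_set M W B" "W \<subseteq> Y" "stable M W" "B \<in> sets M"
    using B.in_cond_Pow[OF T'(1)] by (auto elim: cond_PowE)
  have "represents M Z (cond_set M (stable_prod V W) (A \<inter> B)) E"
    by (rule A.represents_stable_prod[OF S'(2)[unfolded V(1)] V(2-4) T'(2)[unfolded W(1)] W(2-4)])
      (use E in \<open>auto simp: P.rect_def PZ\<close>)
  then show thesis using that S' T' V W by blast
qed

lemma gen_rect:
  assumes V: "V \<subseteq> X" "stable M V" "A \<in> sets M" "cond_set M V A \<in> \<X>"
    and W: "W \<subseteq> Y" "stable M W" "B \<in> sets M" "cond_set M W B \<in> \<Y>"
  obtains S T E where "represents M X (cond_set M V A) S" "represents M Y (cond_set M W B) T" "P.rect S T E"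
    "represents M Z (cond_set M (stable_prod V W) (A \<inter> B)) E"
proof -
  let ?S = "event_graph M X (cond_set M V A)" and ?T = "event_graph M Y (cond_set M W B)"
  let ?E = "{(z, w). z \<in> Z \<and> w \<in> space M \<and> (fst \<circ> z, w) \<in> ?S \<and> (snd \<circ> z, w) \<in> ?T}"
  have S: "represents M X (cond_set M V A) ?S" by (rule A.represents_event_graph[OF A.in_cond_Pow[OF V(4)]])
  have T: "represents M Y (cond_set M W B) ?T" by (rule A.represents_event_graph[OF B.in_cond_Pow[OF W(4)]])
  have E: "P.rect ?S ?T ?E"
    unfolding P.rect_def
  proof (intro conjI ballI)
    show "?S \<in> sets A.m" unfolding A.sets_graph_measure by (rule A.graph_algebraI[OF V(4) S])
    show "?T \<in> sets B.m" unfolding B.sets_graph_measure by (rule B.graph_algebraI[OF W(4) T])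
    show "?E \<subseteq> P.Z \<times> space M" unfolding PZ by auto
    fix x y assume "x \<in> X" "y \<in> Y"
    then have "fpair x y \<in> Z" unfolding stable_prod_def by blast
    moreover have "fst \<circ> fpair x y = x" "snd \<circ> fpair x y = y" by (simp_all add: fpair_def fun_eq_iff)
    ultimately show "AE w in M. (fpair x y, w) \<in> ?E \<longleftrightarrow> (x, w) \<in> ?S \<and> (y, w) \<in> ?T"
      using AE_space by (auto elim: eventually_mono)
  qed
  have "represents M Z (cond_set M (stable_prod V W) (A \<inter> B)) ?E"
    by (rule A.represents_stable_prod[OF S V(1-3) T W(1-3)]) (use E in \<open>auto simp: P.rect_def PZ\<close>)
  with S T E show thesis by (rule that)
qed

lemma stable_graph_sZ:
  assumes "E \<in> sets P.sZ"
  shows "stable_graph M Z E"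
proof -
  have "P.rects \<subseteq> {E. stable_graph M Z E}"
  proof
    fix E assume "E \<in> P.rects"
    then obtain S T where "P.rect S T E" unfolding P.rects_def by blast
    then show "E \<in> {E. stable_graph M Z E}"
      by (rule rect_represented) (use Z.stable_graph_of in blast)
  qed
  from Z.graphs.sigma_sets_subset[OF this] assms show ?thesis unfolding P.sets_sZ PZ by blast
qed

text \<open>The upper bound for \<Z>: a stable \<sigma>-algebra made of graphs in
  \<open>P.sZ\<close> that contains the conditional rectangles.\<close>

lemma sZ_stable_sigma_algebra:
  "stable_sigma_algebra M Z {S. \<exists>E\<in>sets P.sZ. represents M Z S E}" (is "stable_sigma_algebra M Z ?U")
  and gens_subset: "gens \<subseteq> {S. \<exists>E\<in>sets P.sZ. represents M Z S E}"
proof -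
  show "stable_sigma_algebra M Z ?U"
  proof (rule Z.stable_sigma_algebra_represented)
    show "sigma_algebra (Z \<times> space M) (sets P.sZ)"
      using sets.sigma_algebra_axioms[of P.sZ] by (simp add: P.space_sZ PZ)
    show "Z \<times> A \<in> sets P.sZ" if "A \<in> sets M" for A
      using P.rect_in_sets[OF P.rect_cylinder[OF that]] by (simp add: PZ)
  qed (rule stable_graph_sZ)
  show "gens \<subseteq> ?U"
  proof
    fix G assume "G \<in> gens"
    then obtain V A W B where G: "G = cond_set M (stable_prod V W) (A \<inter> B)"
      and V: "V \<subseteq> X" "stable M V" "A \<in> sets M" "cond_set M V A \<in> \<X>"
      and W: "W \<subseteq> Y" "stable M W" "B \<in> sets M" "cond_set M W B \<in> \<Y>"
      unfolding gens_def by blast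
    show "G \<in> ?U"
      unfolding G by (rule gen_rect[OF V W]) (use P.rect_in_sets in blast)
  qed
qed

lemma Z_alg: "stable_sigma_algebra M Z \<Z>"
  unfolding stable_prod_algebra_def gens_def[symmetric]
  by (rule A.stable_sigma_algebra_gen[OF Z_stable sZ_stable_sigma_algebra gens_subset])

interpretation Z: stable_algebra M Z \<Z>
  by unfold_locales (rule Z_alg)

lemma gens_in: "gens \<subseteq> \<Z>"
  unfolding stable_prod_algebra_def gens_def[symmetric] unfolding stable_sigma_gen_def by blast

text \<open>Stable generation and ordinary generation agree: the upper bound above gives one
  inclusion, and the graph algebra of \<Z>, an ordinary \<sigma>-algebra containing the rectangles,
  gives the other.\<close>

lemma graph_algebra_Z: "graph_algebra M Z \<Z> = sets P.sZ"
proof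
  show "graph_algebra M Z \<Z> \<subseteq> sets P.sZ"
  proof
    fix E assume "E \<in> graph_algebra M Z \<Z>"
    then obtain S where S: "S \<in> \<Z>" "represents M Z S E" using Z.graph_algebraD by blast
    have "\<Z> \<subseteq> {S. \<exists>E\<in>sets P.sZ. represents M Z S E}"
      unfolding stable_prod_algebra_def gens_def[symmetric] unfolding stable_sigma_gen_def
      using sZ_stable_sigma_algebra gens_subset by blast
    then obtain F where F: "F \<in> sets P.sZ" "represents M Z S F" using S by blast
    \<comment> \<open>\<open>E\<close> and \<open>F\<close> are two graphs of the same conditional
      set; they differ by null slices, which the \<sigma>-algebra absorbs.\<close>
    have "E \<in> sets P.mZ"
    proof (rule P.C.AE_cong_sets)
      show "F \<in> sets P.mZ" using F P.sets_mZ by simp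
      show "AE w in M. (z, w) \<in> E \<longleftrightarrow> (z, w) \<in> F" if "z \<in> P.Z" for z
        using A.represents_AE_eq[OF F(2) S(2)] that by (simp add: PZ)
    qed (use S(2) in \<open>auto simp: represents_def PZ\<close>)
    then show "E \<in> sets P.sZ" by (simp add: P.sets_mZ)
  qed
  interpret G: sigma_algebra "Z \<times> space M" "graph_algebra M Z \<Z>" by (rule Z.sigma_algebra_graph_algebra)
  have "P.rects \<subseteq> graph_algebra M Z \<Z>"
  proof
    fix E assume "E \<in> P.rects"
    then obtain S T where "P.rect S T E" unfolding P.rects_def by blast
    then show "E \<in> graph_algebra M Z \<Z>"
    proof (rule rect_represented)
      fix V A W B
      assume V: "V \<subseteq> X" "stable M V" "A \<in> sets M" "cond_set M V A \<in> \<X>"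
        and W: "W \<subseteq> Y" "stable M W" "B \<in> sets M" "cond_set M W B \<in> \<Y>"
        and r: "represents M Z (cond_set M (stable_prod V W) (A \<inter> B)) E"
      have "cond_set M (stable_prod V W) (A \<inter> B) \<in> gens" unfolding gens_def using V W by blast
      then show "E \<in> graph_algebra M Z \<Z>" using gens_in r by (intro Z.graph_algebraI) auto
    qed
  qed
  from G.sigma_sets_subset[OF this] show "sets P.sZ \<subseteq> graph_algebra M Z \<Z>" unfolding P.sets_sZ PZ .
qed

lemma fibred_mZ: "fibred_space M Z P.mZ"
  using P.C.fibred_space_axioms unfolding PZ .

text \<open>Existence of a product measure, on which the \<open>SOME\<close> in
  \<open>stable_prod_measure\<close> rests: the iterated measure is conditioned on \<Omega>, and on
  rectangles the formula for \<open>kint\<close> yields the product of the two values.\<close>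

lemma is_stable_prod_measure_mZ:
  "is_stable_prod_measure M X \<X> \<mu> Y \<Y> \<nu> (\<lambda>S. cint M P.mZ (indicator (event_graph M Z S)))"
  (is "is_stable_prod_measure _ _ _ _ _ _ _ ?\<pi>")
  unfolding is_stable_prod_measure_def
proof (intro conjI allI impI, goal_cases)
  case 1
  show ?case
    by (rule Z.stable_prob_space_of_measure[OF fibred_mZ]) (simp add: P.sets_mZ graph_algebra_Z)
next
  case (2 V A W B)
  then have V: "V \<subseteq> X" "stable M V" "A \<in> sets M" "cond_set M V A \<in> \<X>"
    and W: "W \<subseteq> Y" "stable M W" "B \<in> sets M" "cond_set M W B \<in> \<Y>" by auto
  let ?G = "cond_set M (stable_prod V W) (A \<inter> B)"
  obtain S T E where S: "represents M X (cond_set M V A) S" and T: "represents M Y (cond_set M W B) T"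
    and E: "P.rect S T E" "represents M Z ?G E"
    by (rule gen_rect[OF V W])
  have Em[measurable]: "E \<in> sets P.mZ" using P.rect_in_sets[OF E(1)] P.sets_mZ by simp
  have Sm[measurable]: "S \<in> sets A.m" using E(1) unfolding P.rect_def by blast
  have G: "?G \<in> \<Z>" using gens_in V W unfolding gens_def by blast
  have Gm: "event_graph M Z ?G \<in> sets P.mZ"
    unfolding P.sets_mZ graph_algebra_Z[symmetric]
    using G by (intro Z.graph_algebraI[OF _ A.represents_event_graph] Z.in_cond_Pow)
  have "AE w in M. ?\<pi> ?G w = cint M P.mZ (indicator E) w"
  proof (rule P.C.cint_cong_AE)
    show "AE p in P.mZ. indicator (event_graph M Z ?G) p = (indicator E p :: ennreal)"
    proof (rule P.C.AE_fibres)
      fix z assume "z \<in> P.Z"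
      then have z: "z \<in> Z" unfolding PZ .
      have "represents M Z ?G (event_graph M Z ?G)"
        using E(2) by (intro A.represents_event_graph Z.represents_in_cond_Pow)
      from A.represents_AE_eq[OF E(2) this z]
      show "AE w in M. indicator (event_graph M Z ?G) (z, w) = (indicator E (z, w) :: ennreal)"
        by eventually_elim (auto simp: indicator_def)
    qed
  qed (use Gm in auto)
  moreover have "AE w in M. cint M A.m (P.kint (indicator E)) w = cint M P.mZ (indicator E) w"
    by (rule P.cint_kint) simp
  moreover have "AE w in M. cint M A.m (P.kint (indicator E)) w = cint M A.m (\<lambda>p. cint M B.m (indicator T) (snd p) * indicator S p) w"
  proof (rule A.cint_cong_AE)
    show "AE p in A.m. P.kint (indicator E) p = cint M B.m (indicator T) (snd p) * indicator S p"
      by (rule A.AE_fibres) (use P.kint_rect[OF E(1)] in simp)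
  qed auto
  moreover have "AE w in M. cint M A.m (\<lambda>p. cint M B.m (indicator T) (snd p) * indicator S p) w =
      cint M B.m (indicator T) w * cint M A.m (indicator S) w"
    by (intro A.cint_mult) auto
  ultimately show ?case
    using A.cint_indicator[OF V(4) S] B.cint_indicator[OF W(4) T]
    by eventually_elim (auto simp: mult.commute)
qed

abbreviation "\<pi> \<equiv> stable_prod_measure M X \<X> \<mu> Y \<Y> \<nu>"

lemma is_stable_prod_measure: "is_stable_prod_measure M X \<X> \<mu> Y \<Y> \<nu> \<pi>"
  unfolding stable_prod_measure_def
  by (rule someI[where P = "is_stable_prod_measure M X \<X> \<mu> Y \<Y> \<nu>", OF is_stable_prod_measure_mZ])

sublocale Z: stable_prob M Z \<Z> \<pi>
  using is_stable_prod_measure unfolding is_stable_prod_measure_def by (intro A.stable_probI) blast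

text \<open>The chosen product measure need not be the one constructed above; only its values on
  conditional rectangles are used, and \<open>cint_indicator\<close> rewrites them in a form
  symmetric in the factors.\<close>

lemma emeasure_product_rect:
  assumes E: "P.rect S T E"
  shows "emeasure Z.m E = (\<integral>\<^sup>+w. cint M A.m (indicator S) w * cint M B.m (indicator T) w \<partial>M)"
  using E
proof (rule rect_represented)
  fix V A W B
  assume V: "V \<subseteq> X" "stable M V" "A \<in> sets M" "cond_set M V A \<in> \<X>" "represents M X (cond_set M V A) S"
    and W: "W \<subseteq> Y" "stable M W" "B \<in> sets M" "cond_set M W B \<in> \<Y>" "represents M Y (cond_set M W B) T"
    and r: "represents M Z (cond_set M (stable_prod V W) (A \<inter> B)) E"
  let ?G = "cond_set M (stable_prod V W) (A \<inter> B)"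
  have "?G \<in> \<Z>" using gens_in V W unfolding gens_def by blast
  then have "emeasure Z.m E = (\<integral>\<^sup>+w. \<pi> ?G w \<partial>M)" using r by (rule Z.emeasure_graph_measure)
  also have "\<dots> = (\<integral>\<^sup>+w. cint M A.m (indicator S) w * cint M B.m (indicator T) w \<partial>M)"
  proof (rule nn_integral_cong_AE)
    have "AE w in M. \<pi> ?G w = \<mu> (cond_set M V A) w * \<nu> (cond_set M W B) w"
      using is_stable_prod_measure V W unfolding is_stable_prod_measure_def by blast
    with A.cint_indicator[OF V(4,5)] B.cint_indicator[OF W(4,5)]
    show "AE w in M. \<pi> ?G w = cint M A.m (indicator S) w * cint M B.m (indicator T) w"
      by eventually_elim auto
  qed
  finally show ?thesis .
qed

text \<open>Here the two orders of integration meet: both iterated measures have the values on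
  rectangles of the graph measure of the product, the second one by commutativity of
  multiplication.\<close>

lemma mZ_eq: "P.mZ = Z.m" "Q.mZ = Z.m"
proof -
  have s: "sets Z.m = sets P.sZ" unfolding Z.sets_graph_measure by (rule graph_algebra_Z)
  show "P.mZ = Z.m" by (rule P.mZ_unique[symmetric, OF s emeasure_product_rect])
  show "Q.mZ = Z.m"
  proof (rule Q.mZ_unique[symmetric])
    show "sets Z.m = sets Q.sZ" using s by (simp add: QsZ)
    show "emeasure Z.m E = (\<integral>\<^sup>+w. cint M B.m (indicator T) w * cint M A.m (indicator S) w \<partial>M)"
      if "Q.rect T S E" for T S E
      using emeasure_product_rect that[unfolded Qrect] by (simp add: mult.commute)
  qed
qed

lemma integrableD:
  assumes f: "stable_integrable M Z \<Z> \<pi> f"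
  shows "case_prod f \<in> borel_measurable Z.m"
    and "AE w in M. cint M Z.m (\<lambda>(z, w). ennreal (f z w)) w < \<infinity>"
    and "AE w in M. cint M Z.m (\<lambda>(z, w). ennreal (- f z w)) w < \<infinity>"
    and "AE w in M. stable_integral M Z \<Z> \<pi> f w = enn2real (cint M Z.m (\<lambda>(z, w). ennreal (f z w)) w) -
      enn2real (cint M Z.m (\<lambda>(z, w). ennreal (- f z w)) w)"
proof -
  show fm[measurable]: "case_prod f \<in> borel_measurable Z.m"
    using f unfolding stable_integrable_def by (intro Z.stably_measurableD) blast
  have "(\<lambda>p. max (case_prod f p) 0) \<in> borel_measurable Z.m"
    "(\<lambda>p. max (- case_prod f p) 0) \<in> borel_measurable Z.m" by measurable
  then have m: "case_prod (pos_part f) \<in> borel_measurable Z.m" "case_prod (neg_part f) \<in> borel_measurable Z.m"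
    by (simp_all add: pos_part_def neg_part_def case_prod_unfold)
  have "AE w in M. stable_nn_integral M Z \<Z> \<pi> (pos_part f) w = cint M Z.m (\<lambda>(z, w). ennreal (f z w)) w"
    using Z.stable_nn_integral_eq_cint[OF m(1)] by (simp add: pos_part_def ennreal_max_zero)
  moreover have "AE w in M. stable_nn_integral M Z \<Z> \<pi> (neg_part f) w = cint M Z.m (\<lambda>(z, w). ennreal (- f z w)) w"
    using Z.stable_nn_integral_eq_cint[OF m(2)] by (simp add: neg_part_def ennreal_max_zero)
  moreover have "AE w in M. stable_nn_integral M Z \<Z> \<pi> (pos_part f) w < \<infinity>"
    "AE w in M. stable_nn_integral M Z \<Z> \<pi> (neg_part f) w < \<infinity>"
    using f unfolding stable_integrable_def by blast+
  ultimately show "AE w in M. cint M Z.m (\<lambda>(z, w). ennreal (f z w)) w < \<infinity>"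
    "AE w in M. cint M Z.m (\<lambda>(z, w). ennreal (- f z w)) w < \<infinity>"
    "AE w in M. stable_integral M Z \<Z> \<pi> f w = enn2real (cint M Z.m (\<lambda>(z, w). ennreal (f z w)) w) -
      enn2real (cint M Z.m (\<lambda>(z, w). ennreal (- f z w)) w)"
    by (eventually_elim, simp add: stable_integral_def Let_def)+
qed

end

section \<open>Exchange of the order of integration\<close>

theorem theorem5p4:
  fixes M :: "'w measure"
    and X :: "('w \<Rightarrow> 'a) set" and \<X> :: "('w \<Rightarrow> 'a option) set set"
    and \<mu> :: "('w \<Rightarrow> 'a option) set \<Rightarrow> 'w \<Rightarrow> ennreal"
    and Y :: "('w \<Rightarrow> 'b) set" and \<Y> :: "('w \<Rightarrow> 'b option) set set"
    and \<nu> :: "('w \<Rightarrow> 'b option) set \<Rightarrow> 'w \<Rightarrow> ennreal"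
    and f :: "('w \<Rightarrow> 'a \<times> 'b) \<Rightarrow> 'w \<Rightarrow> real"
  assumes "prob_space M" and "complete_measure M"
    and "stable_prob_space M X \<X> \<mu>"
    and "stable_prob_space M Y \<Y> \<nu>"
    and "stable_integrable M (stable_prod X Y) (stable_prod_algebra M X \<X> Y \<Y>)
           (stable_prod_measure M X \<X> \<mu> Y \<Y> \<nu>) f"
  shows "stable_AE M X \<X> \<mu> (\<lambda>x. stable_integrable M Y \<Y> \<nu> (\<lambda>y. f (fpair x y))) \<and>
    stable_AE M Y \<Y> \<nu> (\<lambda>y. stable_integrable M X \<X> \<mu> (\<lambda>x. f (fpair x y))) \<and>
    stable_integrable M X \<X> \<mu> (\<lambda>x. stable_integral M Y \<Y> \<nu> (\<lambda>y. f (fpair x y))) \<and>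
    stable_integrable M Y \<Y> \<nu> (\<lambda>y. stable_integral M X \<X> \<mu> (\<lambda>x. f (fpair x y))) \<and>
    (AE w in M. stable_integral M (stable_prod X Y) (stable_prod_algebra M X \<X> Y \<Y>)
                      (stable_prod_measure M X \<X> \<mu> Y \<Y> \<nu>) f w =
                    stable_integral M X \<X> \<mu>
                      (\<lambda>x. stable_integral M Y \<Y> \<nu> (\<lambda>y. f (fpair x y))) w) \<and>
    (AE w in M. stable_integral M X \<X> \<mu>
                      (\<lambda>x. stable_integral M Y \<Y> \<nu> (\<lambda>y. f (fpair x y))) w =
                    stable_integral M Y \<Y> \<nu>
                      (\<lambda>y. stable_integral M X \<X> \<mu> (\<lambda>x. f (fpair x y))) w)"
proof -
  interpret M: complete_prob_space M
    using assms(1,2) by (rule complete_prob_space.intro)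
  interpret stable_product M X \<X> \<mu> Y \<Y> \<nu>
    unfolding stable_product_def by (intro conjI M.stable_probI assms(3,4))
  note f = integrableD[OF assms(5)]
  note fP = f(1-3)[folded mZ_eq(1)] and fQ = f(1-3)[folded mZ_eq(2)]
  \<comment> \<open>After this rewriting both iterated integrals are expressed by the same two
    conditional integrals over the product.\<close>
  note iP = P.stable_integral_F[OF fP, unfolded mZ_eq] and iQ = Q.stable_integral_F[OF fQ, unfolded mZ_eq]
  show ?thesis
  proof (intro conjI)
    show "stable_AE M X \<X> \<mu> (\<lambda>x. stable_integrable M Y \<Y> \<nu> (\<lambda>y. f (fpair x y)))"
      by (rule P.stable_AE_section_integrable[OF fP])
    show "stable_AE M Y \<Y> \<nu> (\<lambda>y. stable_integrable M X \<X> \<mu> (\<lambda>x. f (fpair x y)))"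
      by (rule Q.stable_AE_section_integrable[OF fQ])
    show "stable_integrable M X \<X> \<mu> (\<lambda>x. stable_integral M Y \<Y> \<nu> (\<lambda>y. f (fpair x y)))"
      by (rule P.stable_integrable_F[OF fP])
    show "stable_integrable M Y \<Y> \<nu> (\<lambda>y. stable_integral M X \<X> \<mu> (\<lambda>x. f (fpair x y)))"
      by (rule Q.stable_integrable_F[OF fQ])
    show "AE w in M. stable_integral M Z \<Z> \<pi> f w =
        stable_integral M X \<X> \<mu> (\<lambda>x. stable_integral M Y \<Y> \<nu> (\<lambda>y. f (fpair x y))) w"
      using f(4) iP by eventually_elim simp
    show "AE w in M. stable_integral M X \<X> \<mu> (\<lambda>x. stable_integral M Y \<Y> \<nu> (\<lambda>y. f (fpair x y))) w =
        stable_integral M Y \<Y> \<nu> (\<lambda>y. stable_integral M X \<X> \<mu> (\<lambda>x. f (fpair x y))) w"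
      using iP iQ by eventually_elim simp
  qed
qed

end
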